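(* Let $L>0$, $a>0$, $b_0>0$, $c_0>0$ and $0<\alpha_1<\alpha_2<\alpha_3<\alpha_4<L$, and let $\mathcal{A}$ be the operator on $\mathcal{H}$ defined in the context. Then the $C_0$-semigroup of contractions $(e^{t\mathcal{A}})_{t\ge 0}$ is strongly stable in $\mathcal{H}$, i.e. for every $U_0\in\mathcal{H}$, $$\lim_{t\to+\infty}\|e^{t\mathcal{A}}U_0\|_{\mathcal{H}}=0 .$$
   Context: Functions are complex valued. Let $b(x)=b_0$ if $x\in(\alpha_1,\alpha_3)$ and $b(x)=0$ otherwise; $c(x)=c_0$ if $x\in(\alpha_2,\alpha_4)$ and $c(x)=0$ otherwise. The energy space is $\mathcal{H}=(H_0^1(0,L)\times L^2(0,L))^2$ with inner product, for $U=(u,v,y,z)$, $U_1=(u_1,v_1,y_1,z_1)$, $$\langle U,U_1\rangle_{\mathcal{H}}=\int_0^L v\overline{v_1}\,dx+a\int_0^L u_x\overline{(u_1)_x}\,dx+\int_0^L z\overline{z_1}\,dx+\int_0^L y_x\overline{(y_1)_x}\,dx .$$ The unbounded operator $\mathcal{A}:D(\mathcal{A})\subset\mathcal{H}\to\mathcal{H}$ has domain $$D(\mathcal{A})=\{U=(u,v,y,z)\in\mathcal{H}:\ y\in H^2(0,L)\cap H_0^1(0,L),\ v,z\in H_0^1(0,L),\ (au_x+b(x)v_x)_x\in L^2(0,L)\}$$ and $$\mathcal{A}(u,v,y,z)=\big(v,\ (au_x+b(x)v_x)_x-c(x)z,\ z,\ y_{xx}+c(x)v\big).$$ $\mathcal{A}$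 generates a $C_0$-semigroup of contractions $(e^{t\mathcal{A}})_{t\ge0}$ on $\mathcal{H}$. It describes the system $u_{tt}-(au_x+b(x)u_{tx})_x+c(x)y_t=0$, $y_{tt}-y_{xx}-c(x)u_t=0$ on $(0,L)$ with homogeneous Dirichlet boundary conditions, with $v=u_t$, $z=y_t$. *)

theory Defs
  imports "HOL-Analysis.Analysis" "HOL-Library.Function_Algebras"
begin

section \<open>Complex Sobolev spaces on \<open>(0,L)\<close>\<close>

text \<open>
  Elements of \<open>L\<^sup>2(0,L)\<close> are represented by functions on \<open>real\<close>, two functions representing the
  same element if they agree almost everywhere on \<open>(0,L)\<close>; values outside \<open>(0,L)\<close> are irrelevant.
\<close>

definition L2 :: "real \<Rightarrow> (real \<Rightarrow> complex) set" where
  "L2 L = {f \<in> borel_measurable (lebesgue_on {0<..<L}).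
             integrable (lebesgue_on {0<..<L}) (\<lambda>x. (cmod (f x))\<^sup>2)}"

definition L2_inner :: "real \<Rightarrow> (real \<Rightarrow> complex) \<Rightarrow> (real \<Rightarrow> complex) \<Rightarrow> complex" where
  "L2_inner L f g = (LINT x|lebesgue_on {0<..<L}. f x * cnj (g x))"

text \<open>The space \<open>C\<^sub>c\<^sup>\<infinity>(0,L)\<close>, each function being extended by zero.\<close>

definition test_functions :: "real \<Rightarrow> (real \<Rightarrow> complex) set" where
  "test_functions L =
     {\<phi>. (\<forall>n x. ((\<lambda>f t. vector_derivative f (at t)) ^^ n) \<phi> differentiable (at x)) \<and>
         (\<exists>K. compact K \<and> K \<subseteq> {0<..<L} \<and> (\<forall>x. x \<notin> K \<longrightarrow> \<phi> x = 0))}"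

definition has_weak_derivative :: "real \<Rightarrow> (real \<Rightarrow> complex) \<Rightarrow> (real \<Rightarrow> complex) \<Rightarrow> bool" where
  "has_weak_derivative L f g \<longleftrightarrow>
     f \<in> L2 L \<and> g \<in> L2 L \<and>
     (\<forall>\<phi>\<in>test_functions L.
        (LINT x|lebesgue_on {0<..<L}. f x * vector_derivative \<phi> (at x)) =
        - (LINT x|lebesgue_on {0<..<L}. g x * \<phi> x))"

definition H1 :: "real \<Rightarrow> (real \<Rightarrow> complex) set" where
  "H1 L = {f. \<exists>g. has_weak_derivative L f g}"

text \<open>A representative of the weak derivative, which is unique only almost everywhere on \<open>(0,L)\<close>.\<close>

definition wderiv :: "real \<Rightarrow> (real \<Rightarrow> complex) \<Rightarrow> real \<Rightarrow> complex" where
  "wderiv L f = (SOME g. has_weak_derivative L f g)"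

definition H1_norm :: "real \<Rightarrow> (real \<Rightarrow> complex) \<Rightarrow> real" where
  "H1_norm L f = sqrt (Re (L2_inner L f f) + Re (L2_inner L (wderiv L f) (wderiv L f)))"

definition H10 :: "real \<Rightarrow> (real \<Rightarrow> complex) set" where
  "H10 L = {f \<in> H1 L. \<exists>\<phi>. (\<forall>n::nat. \<phi> n \<in> test_functions L) \<and>
                          (\<lambda>n. H1_norm L (f - \<phi> n)) \<longlonglongrightarrow> 0}"

definition H2 :: "real \<Rightarrow> (real \<Rightarrow> complex) set" where
  "H2 L = {f \<in> H1 L. wderiv L f \<in> H1 L}"


section \<open>The energy space and the operator\<close>

type_synonym state =
  "(real \<Rightarrow> complex) \<times> (real \<Rightarrow> complex) \<times> (real \<Rightarrow> complex) \<times> (real \<Rightarrow> complex)"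

fun state_scale :: "complex \<Rightarrow> state \<Rightarrow> state" where
  "state_scale k (u, v, y, z) = (\<lambda>x. k * u x, \<lambda>x. k * v x, \<lambda>x. k * y x, \<lambda>x. k * z x)"

definition energy_space :: "real \<Rightarrow> state set" where
  "energy_space L = H10 L \<times> L2 L \<times> H10 L \<times> L2 L"

fun energy_inner :: "real \<Rightarrow> real \<Rightarrow> state \<Rightarrow> state \<Rightarrow> complex" where
  "energy_inner L a (u, v, y, z) (u1, v1, y1, z1) =
     L2_inner L v v1 + of_real a * L2_inner L (wderiv L u) (wderiv L u1) +
     L2_inner L z z1 + L2_inner L (wderiv L y) (wderiv L y1)"

definition energy_norm :: "real \<Rightarrow> real \<Rightarrow> state \<Rightarrow> real" where
  "energy_norm L a U = sqrt (Re (energy_inner L a U U))"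

definition local_coeff :: "real \<Rightarrow> real \<Rightarrow> real \<Rightarrow> real \<Rightarrow> real" where
  "local_coeff k p q x = (if x \<in> {p<..<q} then k else 0)"

text \<open>The total flux \<open>a u\<^sub>x + b v\<^sub>x\<close>; only this sum, not each summand, is weakly differentiable.\<close>

definition flux ::
    "real \<Rightarrow> real \<Rightarrow> (real \<Rightarrow> real) \<Rightarrow> (real \<Rightarrow> complex) \<Rightarrow> (real \<Rightarrow> complex) \<Rightarrow> real \<Rightarrow> complex" where
  "flux L a b u v = (\<lambda>x. of_real a * wderiv L u x + of_real (b x) * wderiv L v x)"

definition kv_domain :: "real \<Rightarrow> real \<Rightarrow> (real \<Rightarrow> real) \<Rightarrow> state set" where
  "kv_domain L a b =
     {(u, v, y, z). (u, v, y, z) \<in> energy_space L \<and>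
        y \<in> H2 L \<inter> H10 L \<and> v \<in> H10 L \<and> z \<in> H10 L \<and> flux L a b u v \<in> H1 L}"

fun kv_operator :: "real \<Rightarrow> real \<Rightarrow> (real \<Rightarrow> real) \<Rightarrow> (real \<Rightarrow> real) \<Rightarrow> state \<Rightarrow> state" where
  "kv_operator L a b c (u, v, y, z) =
     (v,
      \<lambda>x. wderiv L (flux L a b u v) x - of_real (c x) * z x,
      z,
      \<lambda>x. wderiv L (wderiv L y) x + of_real (c x) * v x)"


section \<open>Contraction semigroups and their generators\<close>

text \<open>
  \<open>H\<close> is a space of representatives with seminorm \<open>N\<close> and complex scaling \<open>scl\<close>; equality of the
  represented elements is \<open>N (U - W) = 0\<close>. The contraction property makes each \<open>T t\<close> well defined
  on the represented elements.
\<close>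

definition contraction_C0_semigroup ::
    "(complex \<Rightarrow> 'a \<Rightarrow> 'a) \<Rightarrow> 'a set \<Rightarrow> ('a \<Rightarrow> real) \<Rightarrow> (real \<Rightarrow> 'a \<Rightarrow> 'a::ab_group_add) \<Rightarrow> bool" where
  "contraction_C0_semigroup scl H N T \<longleftrightarrow>
     (\<forall>t\<ge>0. \<forall>U\<in>H. T t U \<in> H \<and> N (T t U) \<le> N U) \<and>
     (\<forall>t\<ge>0. \<forall>U\<in>H. \<forall>W\<in>H. N (T t (U + W) - (T t U + T t W)) = 0) \<and>
     (\<forall>t\<ge>0. \<forall>k. \<forall>U\<in>H. N (T t (scl k U) - scl k (T t U)) = 0) \<and>
     (\<forall>U\<in>H. N (T 0 U - U) = 0) \<and>
     (\<forall>s\<ge>0. \<forall>t\<ge>0. \<forall>U\<in>H. N (T (s + t) U - T s (T t U)) = 0) \<and>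
     (\<forall>U\<in>H. ((\<lambda>t. N (T t U - U)) \<longlongrightarrow> 0) (at_right 0))"

text \<open>
  The operator \<open>A\<close> with domain \<open>D\<close> is the infinitesimal generator of \<open>T\<close>: the right derivative of
  \<open>T t U\<close> at \<open>t = 0\<close> exists in \<open>H\<close> exactly for \<open>U \<in> D\<close>, and is then \<open>A U\<close>.
\<close>

definition is_generator ::
    "(complex \<Rightarrow> 'a \<Rightarrow> 'a) \<Rightarrow> 'a set \<Rightarrow> ('a \<Rightarrow> real) \<Rightarrow> (real \<Rightarrow> 'a \<Rightarrow> 'a::ab_group_add) \<Rightarrow>
     'a set \<Rightarrow> ('a \<Rightarrow> 'a) \<Rightarrow> bool" where
  "is_generator scl H N T D A \<longleftrightarrow>
     (\<forall>U\<in>H. \<forall>W\<in>H.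
        ((\<lambda>h. N (scl (of_real (1 / h)) (T h U - U) - W)) \<longlongrightarrow> 0) (at_right 0) \<longleftrightarrow>
        U \<in> D \<and> N (A U - W) = 0)"

end

theory Submission
  imports Defs
begin

text \<open>The energy of an orbit is nonincreasing, so it tends to zero as soon as its average over long time intervals
  does; and since the semigroup is contractive, only initial data in a dense set have to be considered, for
  which the orbit and its first two time derivatives are bounded in the energy norm.

  Smallness on average is expressed by \<open>null_on_average\<close>: a function of time is null on average
  if, up to arbitrarily small constants, it is bounded above by the derivative of a bounded function.
  Derivatives of bounded quantities are null, and Young's inequality shows that the pairing of a null
  quantity with a bounded one is null. The whole proof consists in spreading nullness from the damped region
  to the full energy by multipliers, with no spectral theory and no unique continuation.

  The dissipation controls only the gradient of the velocity, so static states are invisible to it. Therefore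
  the argument is run on the time derivative of the orbit: there both the displacement gradient
  \<open>u\<^sub>x\<close> and the velocity gradient \<open>v\<^sub>x\<close> are null on
  \<open>(\<alpha>\<^sub>1,\<alpha>\<^sub>3)\<close> (\<open>null_ux\<close>, \<open>null_vx\<close>). On
  \<open>(\<alpha>\<^sub>1,\<alpha>\<^sub>2)\<close> there is no coupling, \<open>v\<^sub>t\<close> is the
  derivative of a null flux, and testing with \<open>u\<close> makes \<open>v\<close> null
  (\<open>null_v_local\<close>); as \<open>v\<^sub>x\<close> is null, this carries over to
  \<open>(\<alpha>\<^sub>2,\<alpha>\<^sub>3)\<close> (\<open>null_transfer\<close>). There the coupling
  acts, and the equation of the original orbit expresses \<open>c y\<close> through \<open>v\<close> and the
  derivative of a flux, which makes \<open>y\<close> null (\<open>null_y_local\<close>); because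
  \<open>y\<^sub>x\<^sub>x\<close> is bounded, \<open>y\<^sub>x\<close> and \<open>z\<close> are null as
  well, so the energy is null on a subinterval of \<open>(\<alpha>\<^sub>2,\<alpha>\<^sub>3)\<close>
  (\<open>null_local_energy\<close>).

  A global multiplier \<open>q\<close> that vanishes at both ends of \<open>(0,L)\<close> and changes sign
  inside this subinterval then gives the energy on the whole of \<open>(0,L)\<close>
  (\<open>null_energy1\<close>). Away from the sign change \<open>q'\<close> dominates any prescribed
  multiple of \<open>\<bar>q\<bar>\<close> (\<open>global_weight\<close>), so the coupling terms are
  absorbed, however large \<open>c\<^sub>0\<close> is. The energy of the orbit itself is recovered from that
  of its time derivative by pairing the equations with the displacements, using Poincare's inequality
  (\<open>null_energy0\<close>).

  Since a vector of the energy space is any representative of a class of functions, the calculus of weak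
  derivatives rests on the density in \<open>L\<^sup>2\<close> of test functions that are flat near a given
  finite set (\<open>tests_dense\<close>). Choosing for this set the discontinuities of the coefficients
  makes smooth flat data a dense subset of the domain of \<open>A\<^sup>2\<close>
  (\<open>domain_square_dense\<close>).\<close>

section \<open>Weighted inner products on L2(0,L)\<close>

definition bounded_weight :: "real \<Rightarrow> (real \<Rightarrow> real) \<Rightarrow> bool" where
  "bounded_weight L w \<longleftrightarrow> w \<in> borel_measurable (lebesgue_on {0<..<L}) \<and>
     (\<exists>K. \<forall>x\<in>{0<..<L}. \<bar>w x\<bar> \<le> K)"

text \<open>The multiplier identities involve only real parts of inner products, so weighted pairings are real valued
  throughout; the complex identities that define weak derivatives are recovered in
  \<open>has_weak_derivative_iff\<close>.\<close>

definition wip :: "real \<Rightarrow> (real \<Rightarrow> real) \<Rightarrow> (real \<Rightarrow> complex) \<Rightarrow> (real \<Rightarrow> complex) \<Rightarrow> real" where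
  "wip L w f g = (LINT x|lebesgue_on {0<..<L}. w x * Re (f x * cnj (g x)))"

abbreviation ip :: "real \<Rightarrow> (real \<Rightarrow> complex) \<Rightarrow> (real \<Rightarrow> complex) \<Rightarrow> real" where
  "ip L \<equiv> wip L (\<lambda>x. 1)"

definition nrm :: "real \<Rightarrow> (real \<Rightarrow> complex) \<Rightarrow> real" where
  "nrm L f = sqrt (ip L f f)"

lemma space_interval[simp]: "space (lebesgue_on {0<..<L::real}) = {0<..<L}"
  by simp

lemma interval_in_lebesgue[simp, intro]: "{0<..<L::real} \<in> sets lebesgue"
  by (simp add: fmeasurableD)

lemma finite_measure_interval: "finite_measure (lebesgue_on {0<..<L::real})"
  by (rule finite_measure_lebesgue_on) (simp add: fmeasurable_box[of 0 L, simplified] )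

lemma measurable_continuous_interval:
  fixes f :: "real \<Rightarrow> 'a::euclidean_space"
  assumes "continuous_on UNIV f"
  shows "f \<in> borel_measurable (lebesgue_on {0<..<L})"
  by (intro continuous_imp_measurable_on_sets_lebesgue continuous_on_subset[OF assms]) auto

lemma bounded_weight_continuous:
  assumes "continuous_on UNIV w"
  shows "bounded_weight L w"
proof -
  have "compact (w ` {0..L})"
    using assms by (intro compact_continuous_image) (auto intro: continuous_on_subset)
  then obtain K where "\<And>y. y \<in> w ` {0..L} \<Longrightarrow> \<bar>y\<bar> \<le> K"
    using compact_imp_bounded bounded_real by metis
  then have "\<forall>x\<in>{0<..<L}. \<bar>w x\<bar> \<le> K" by auto
  then show ?thesis
    using measurable_continuous_interval[OF assms] unfolding bounded_weight_def by blast
qed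

lemma bounded_weight_const[simp, intro]: "bounded_weight L (\<lambda>x. k)"
  by (rule bounded_weight_continuous) auto

lemma bounded_weight_mult[intro]:
  assumes "bounded_weight L w" "bounded_weight L r"
  shows "bounded_weight L (\<lambda>x. w x * r x)"
proof -
  obtain K K' where K: "\<forall>x\<in>{0<..<L}. \<bar>w x\<bar> \<le> K" "\<forall>x\<in>{0<..<L}. \<bar>r x\<bar> \<le> K'"
    using assms unfolding bounded_weight_def by blast
  have "\<forall>x\<in>{0<..<L}. \<bar>w x * r x\<bar> \<le> K * K'"
    using K by (auto simp: abs_mult intro!: mult_mono) 
  then show ?thesis using assms unfolding bounded_weight_def by (auto intro!: exI[of _ "K*K'"])
qed

lemma bounded_weight_add[intro]:
  assumes "bounded_weight L w" "bounded_weight L r"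
  shows "bounded_weight L (\<lambda>x. w x + r x)"
proof -
  obtain K K' where K: "\<forall>x\<in>{0<..<L}. \<bar>w x\<bar> \<le> K" "\<forall>x\<in>{0<..<L}. \<bar>r x\<bar> \<le> K'"
    using assms unfolding bounded_weight_def by blast
  have "\<forall>x\<in>{0<..<L}. \<bar>w x + r x\<bar> \<le> K + K'" using K by (smt (verit, best))
  then show ?thesis using assms unfolding bounded_weight_def by (auto intro!: exI[of _ "K+K'"])
qed

lemma bounded_weight_diff[intro]:
  assumes "bounded_weight L w" "bounded_weight L r"
  shows "bounded_weight L (\<lambda>x. w x - r x)"
  using bounded_weight_add[OF assms(1) bounded_weight_mult[OF bounded_weight_const[of L "-1"] assms(2)]] by simp

lemma bounded_weight_abs[intro]: "bounded_weight L w \<Longrightarrow> bounded_weight L (\<lambda>x. \<bar>w x\<bar>)"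
  unfolding bounded_weight_def by (simp add: borel_measurable_abs)

lemma bounded_weight_power[intro]: "bounded_weight L w \<Longrightarrow> bounded_weight L (\<lambda>x. (w x)\<^sup>2)"
  unfolding power2_eq_square by (rule bounded_weight_mult)

lemma bounded_weight_local_coeff[simp, intro]: "bounded_weight L (local_coeff k p q)"
proof -
  have "local_coeff k p q \<in> borel_measurable borel" unfolding local_coeff_def[abs_def] by simp
  then have "local_coeff k p q \<in> borel_measurable (lebesgue_on {0<..<L})"
    by (intro measurable_restrict_space1 measurable_completion) simp
  moreover have "\<forall>x\<in>{0<..<L}. \<bar>local_coeff k p q x\<bar> \<le> \<bar>k\<bar>" by (simp add: local_coeff_def)
  ultimately show ?thesis unfolding bounded_weight_def by blast
qed

lemma L2_measurable[measurable_dest]: "f \<in> L2 L \<Longrightarrow> f \<in> borel_measurable (lebesgue_on {0<..<L})"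
  by (simp add: L2_def)

lemma L2_integrable: "f \<in> L2 L \<Longrightarrow> integrable (lebesgue_on {0<..<L}) (\<lambda>x. (cmod (f x))\<^sup>2)"
  by (simp add: L2_def)

lemma cnj_measurable[measurable]: "cnj \<in> borel_measurable borel"
  by (intro borel_measurable_continuous_onI continuous_intros)

lemma L2_integrable_product:
  assumes "f \<in> L2 L" "g \<in> L2 L"
  shows "integrable (lebesgue_on {0<..<L}) (\<lambda>x. cmod (f x) * cmod (g x))"
proof (rule Bochner_Integration.integrable_bound)
  show "integrable (lebesgue_on {0<..<L}) (\<lambda>x. (cmod (f x))\<^sup>2 + (cmod (g x))\<^sup>2)"
    using assms by (intro Bochner_Integration.integrable_add L2_integrable)
  show "(\<lambda>x. cmod (f x) * cmod (g x)) \<in> borel_measurable (lebesgue_on {0<..<L})"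
    using assms L2_measurable by measurable
  show "AE x in lebesgue_on {0<..<L}. norm (cmod (f x) * cmod (g x)) \<le> norm ((cmod (f x))\<^sup>2 + (cmod (g x))\<^sup>2)"
  proof (rule AE_I2)
    fix x
    have "0 \<le> (cmod (f x) - cmod (g x))\<^sup>2" "0 \<le> cmod (f x) * cmod (g x)" by auto
    then have "cmod (f x) * cmod (g x) \<le> (cmod (f x))\<^sup>2 + (cmod (g x))\<^sup>2"
      unfolding power2_diff by linarith
    then show "norm (cmod (f x) * cmod (g x)) \<le> norm ((cmod (f x))\<^sup>2 + (cmod (g x))\<^sup>2)" by simp
  qed
qed

lemma L2_add[intro]:
  assumes "f \<in> L2 L" "g \<in> L2 L" shows "(\<lambda>x. f x + g x) \<in> L2 L"
proof -
  have "integrable (lebesgue_on {0<..<L}) (\<lambda>x. (cmod (f x + g x))\<^sup>2)"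
  proof (rule Bochner_Integration.integrable_bound)
    show "integrable (lebesgue_on {0<..<L}) (\<lambda>x. 2 * (cmod (f x))\<^sup>2 + 2 * (cmod (g x))\<^sup>2)"
      using assms by (intro Bochner_Integration.integrable_add Bochner_Integration.integrable_mult_right L2_integrable)
    show "(\<lambda>x. (cmod (f x + g x))\<^sup>2) \<in> borel_measurable (lebesgue_on {0<..<L})"
      using assms L2_measurable by measurable
    show "AE x in lebesgue_on {0<..<L}. norm ((cmod (f x + g x))\<^sup>2) \<le> norm (2 * (cmod (f x))\<^sup>2 + 2 * (cmod (g x))\<^sup>2)"
    proof (rule AE_I2)
      fix x
      have "(cmod (f x + g x))\<^sup>2 \<le> (cmod (f x) + cmod (g x))\<^sup>2" by (simp add: norm_triangle_ineq)
      also have "\<dots> \<le> 2 * (cmod (f x))\<^sup>2 + 2 * (cmod (g x))\<^sup>2"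
        using zero_le_power2[of "cmod (f x) - cmod (g x)"] by (simp add: power2_diff power2_sum)
      finally show "norm ((cmod (f x + g x))\<^sup>2) \<le> norm (2 * (cmod (f x))\<^sup>2 + 2 * (cmod (g x))\<^sup>2)" by simp
    qed
  qed
  then show ?thesis using assms by (auto simp: L2_def intro: borel_measurable_add)
qed

lemma L2_bounded:
  assumes "f \<in> borel_measurable (lebesgue_on {0<..<L})" "\<And>x. x \<in> {0<..<L} \<Longrightarrow> cmod (f x) \<le> K"
  shows "f \<in> L2 L"
proof -
  interpret finite_measure "lebesgue_on {0<..<L}" by (rule finite_measure_interval)
  have "integrable (lebesgue_on {0<..<L}) (\<lambda>x. (cmod (f x))\<^sup>2)"
    using assms by (intro integrable_const_bound[of _ "K\<^sup>2"]) (auto intro!: AE_I2 power_mono)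
  then show ?thesis using assms by (simp add: L2_def)
qed

lemma L2_weight[intro]:
  assumes "bounded_weight L w" "f \<in> L2 L" shows "(\<lambda>x. of_real (w x) * f x) \<in> L2 L"
proof -
  obtain K where K: "\<forall>x\<in>{0<..<L}. \<bar>w x\<bar> \<le> K" and [measurable]: "w \<in> borel_measurable (lebesgue_on {0<..<L})"
    using assms unfolding bounded_weight_def by blast
  have "integrable (lebesgue_on {0<..<L}) (\<lambda>x. (cmod (of_real (w x) * f x))\<^sup>2)"
  proof (rule Bochner_Integration.integrable_bound)
    show "integrable (lebesgue_on {0<..<L}) (\<lambda>x. K\<^sup>2 * (cmod (f x))\<^sup>2)"
      using assms by (intro Bochner_Integration.integrable_mult_right L2_integrable)
    show "(\<lambda>x. (cmod (of_real (w x) * f x))\<^sup>2) \<in> borel_measurable (lebesgue_on {0<..<L})"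
      using assms L2_measurable by measurable
    show "AE x in lebesgue_on {0<..<L}. norm ((cmod (of_real (w x) * f x))\<^sup>2) \<le> norm (K\<^sup>2 * (cmod (f x))\<^sup>2)"
      using order_trans[OF bspec[OF K] abs_ge_self]
      by (intro AE_I2) (auto simp: norm_mult power_mult_distrib abs_le_square_iff[symmetric] intro!: mult_right_mono)
  qed
  moreover have "(\<lambda>x. of_real (w x) * f x) \<in> borel_measurable (lebesgue_on {0<..<L})"
    using assms L2_measurable by measurable
  ultimately show ?thesis by (simp add: L2_def)
qed

lemma L2_cmult[intro]:
  assumes "f \<in> L2 L" shows "(\<lambda>x. k * f x) \<in> L2 L"
  using assms by (auto simp: L2_def norm_mult power_mult_distrib)

lemma L2_uminus[intro]: "f \<in> L2 L \<Longrightarrow> (\<lambda>x. - f x) \<in> L2 L"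
  using L2_cmult[of f L "-1"] by simp

lemma L2_diff[intro]: "f \<in> L2 L \<Longrightarrow> g \<in> L2 L \<Longrightarrow> (\<lambda>x. f x - g x) \<in> L2 L"
  using L2_add[of f L "\<lambda>x. - g x"] by auto

lemma L2_continuous:
  assumes "continuous_on UNIV f" shows "f \<in> L2 L"
proof -
  have "compact (f ` {0..L})"
    using assms by (intro compact_continuous_image) (auto intro: continuous_on_subset)
  then obtain K where "\<And>y. y \<in> f ` {0..L} \<Longrightarrow> norm y \<le> K"
    using compact_imp_bounded bounded_iff by metis
  then show ?thesis by (intro L2_bounded[of _ _ K] measurable_continuous_interval assms) auto
qed

lemma L2_const[simp, intro]: "(\<lambda>x. k) \<in> L2 L"
  by (rule L2_continuous) auto

lemma Re_mult_cnj_self: "Re (z * cnj z) = (cmod z)\<^sup>2"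
  by (simp add: cmod_power2) (simp add: power2_eq_square)

lemma wip_integrable:
  assumes "bounded_weight L w" "f \<in> L2 L" "g \<in> L2 L"
  shows "integrable (lebesgue_on {0<..<L}) (\<lambda>x. w x * Re (f x * cnj (g x)))"
proof -
  obtain K where K: "\<forall>x\<in>{0<..<L}. \<bar>w x\<bar> \<le> K" and [measurable]: "w \<in> borel_measurable (lebesgue_on {0<..<L})"
    using assms unfolding bounded_weight_def by blast
  show ?thesis
  proof (rule Bochner_Integration.integrable_bound)
    show "integrable (lebesgue_on {0<..<L}) (\<lambda>x. K * (cmod (f x) * cmod (g x)))"
      using assms by (intro Bochner_Integration.integrable_mult_right L2_integrable_product)
    show "(\<lambda>x. w x * Re (f x * cnj (g x))) \<in> borel_measurable (lebesgue_on {0<..<L})"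
      using assms L2_measurable by measurable
    show "AE x in lebesgue_on {0<..<L}. norm (w x * Re (f x * cnj (g x))) \<le> norm (K * (cmod (f x) * cmod (g x)))"
    proof (intro AE_I2)
      fix x assume x: "x \<in> space (lebesgue_on {0<..<L})"
      have "\<bar>Re (f x * cnj (g x))\<bar> \<le> cmod (f x) * cmod (g x)"
        using abs_Re_le_cmod[of "f x * cnj (g x)"] by (simp only: norm_mult complex_mod_cnj)
      then have "\<bar>w x * Re (f x * cnj (g x))\<bar> \<le> \<bar>K\<bar> * (cmod (f x) * cmod (g x))"
        unfolding abs_mult[of "w x"] using K x
        by (intro mult_mono) (auto intro: order_trans[OF _ abs_ge_self])
      then show "norm (w x * Re (f x * cnj (g x))) \<le> norm (K * (cmod (f x) * cmod (g x)))"
        by (simp add: abs_mult)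
    qed
  qed
qed

lemma wip_cong_AE:
  assumes "AE x in lebesgue_on {0<..<L}. w x * Re (f x * cnj (g x)) = w' x * Re (f' x * cnj (g' x))"
    and "bounded_weight L w" "f \<in> L2 L" "g \<in> L2 L" "bounded_weight L w'" "f' \<in> L2 L" "g' \<in> L2 L"
  shows "wip L w f g = wip L w' f' g'"
  unfolding wip_def
  by (rule integral_cong_AE)
     (use assms wip_integrable in \<open>auto intro: borel_measurable_integrable\<close>)

lemma wip_add_left:
  assumes "bounded_weight L w" "f \<in> L2 L" "h \<in> L2 L" "g \<in> L2 L"
  shows "wip L w (\<lambda>x. f x + h x) g = wip L w f g + wip L w h g"
proof -
  have "wip L w (\<lambda>x. f x + h x) g = (LINT x|lebesgue_on {0<..<L}. w x * Re (f x * cnj (g x)) + w x * Re (h x * cnj (g x)))"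
    unfolding wip_def by (simp add: algebra_simps)
  then show ?thesis unfolding wip_def
    by (simp only: Bochner_Integration.integral_add[OF wip_integrable wip_integrable] assms)
qed

lemma wip_commute: "wip L w f g = wip L w g f"
  unfolding wip_def by (rule Bochner_Integration.integral_cong) (auto simp: algebra_simps)

lemma wip_add_right:
  assumes "bounded_weight L w" "f \<in> L2 L" "h \<in> L2 L" "g \<in> L2 L"
  shows "wip L w g (\<lambda>x. f x + h x) = wip L w g f + wip L w g h"
  using wip_add_left[OF assms] by (simp add: wip_commute[of L w g])

lemma wip_weight_left: "wip L w (\<lambda>x. of_real (r x) * f x) g = wip L (\<lambda>x. w x * r x) f g"
  unfolding wip_def by (rule Bochner_Integration.integral_cong) (auto simp: algebra_simps)

lemma wip_weight_right: "wip L w g (\<lambda>x. of_real (r x) * f x) = wip L (\<lambda>x. w x * r x) g f"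
  unfolding wip_def by (rule Bochner_Integration.integral_cong) (auto simp: algebra_simps)

lemma wip_scale: "wip L (\<lambda>x. k * w x) f g = k * wip L w f g"
  unfolding wip_def by (simp add: mult.assoc)

lemma wip_scale_left: "wip L w (\<lambda>x. of_real k * f x) g = k * wip L w f g"
  unfolding wip_weight_left wip_scale[symmetric] by (simp add: mult.commute)

lemma wip_scale_right: "wip L w g (\<lambda>x. of_real k * f x) = k * wip L w g f"
  unfolding wip_weight_right wip_scale[symmetric] by (simp add: mult.commute)

lemma wip_minus_left: "wip L w (\<lambda>x. - f x) g = - wip L w f g"
  using wip_scale_left[of L w "-1" f g] by simp

lemma wip_minus_right: "wip L w g (\<lambda>x. - f x) = - wip L w g f"
  using wip_scale_right[of L w g "-1" f] by simp

lemma wip_diff_left: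
  assumes "bounded_weight L w" "f \<in> L2 L" "h \<in> L2 L" "g \<in> L2 L"
  shows "wip L w (\<lambda>x. f x - h x) g = wip L w f g - wip L w h g"
  using wip_add_left[of L w f "\<lambda>x. - h x" g] assms by (auto simp: wip_minus_left)

lemma wip_diff_right:
  assumes "bounded_weight L w" "f \<in> L2 L" "h \<in> L2 L" "g \<in> L2 L"
  shows "wip L w g (\<lambda>x. f x - h x) = wip L w g f - wip L w g h"
  using wip_diff_left[OF assms] by (simp add: wip_commute[of L w g])

lemmas wip_linear = wip_add_left wip_add_right wip_diff_left wip_diff_right
  wip_scale_left wip_scale_right wip_minus_left wip_minus_right

lemma wip_diff_weight:
  assumes "bounded_weight L w" "bounded_weight L w'" "f \<in> L2 L" "g \<in> L2 L"
  shows "wip L (\<lambda>x. w x - w' x) f g = wip L w f g - wip L w' f g"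
  unfolding wip_def left_diff_distrib
  by (simp only: Bochner_Integration.integral_diff[OF wip_integrable wip_integrable] assms)

lemma wip_mono_weight:
  assumes "bounded_weight L w" "bounded_weight L w'" "f \<in> L2 L" "\<And>x. x \<in> {0<..<L} \<Longrightarrow> w x \<le> w' x"
  shows "wip L w f f \<le> wip L w' f f"
  unfolding wip_def using assms
  by (intro integral_mono wip_integrable mult_right_mono) auto

lemma wip_nonneg:
  assumes "\<And>x. x \<in> {0<..<L} \<Longrightarrow> 0 \<le> w x"
  shows "0 \<le> wip L w f f"
  unfolding wip_def using assms by (intro Bochner_Integration.integral_nonneg) (auto intro!: mult_nonneg_nonneg)

lemma ip_nonneg[simp]: "0 \<le> ip L f f" by (rule wip_nonneg) simp

lemma nrm_nonneg[simp]: "0 \<le> nrm L f" by (simp add: nrm_def)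

lemma nrm_power2: "(nrm L f)\<^sup>2 = ip L f f" by (simp add: nrm_def)

text \<open>In contrast to the Cauchy--Schwarz inequality, this bound is linear in the quantities that are estimated,
  and so compatible with averages in time. The weight on the small factor \<open>g\<close> is the one for
  which smallness is known, which is why \<open>w\<^sup>2\<close> has to be dominated by it.\<close>

lemma wip_young:
  assumes w: "bounded_weight L w" and r: "bounded_weight L r" and f: "f \<in> L2 L" and g: "g \<in> L2 L"
    and le: "\<And>x. x \<in> {0<..<L} \<Longrightarrow> (w x)\<^sup>2 \<le> K * r x" and e: "e > 0"
  shows "\<bar>wip L w f g\<bar> \<le> e * ip L f f + (K / e) * wip L r g g"
proof -
  have pw: "\<bar>w x * Re (f x * cnj (g x))\<bar> \<le> e * (1 * Re (f x * cnj (f x))) + (K/e) * (r x * Re (g x * cnj (g x)))"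
    if x: "x \<in> {0<..<L}" for x
  proof -
    define F G where "F = cmod (f x)" and "G = cmod (g x)"
    have "\<bar>w x * Re (f x * cnj (g x))\<bar> \<le> \<bar>w x\<bar> * (F * G)"
      unfolding abs_mult[of "w x"] F_def G_def using abs_Re_le_cmod[of "f x * cnj (g x)"]
      by (intro mult_left_mono) (simp_all only: norm_mult complex_mod_cnj abs_ge_zero)
    also have "\<dots> \<le> e * F\<^sup>2 + (w x)\<^sup>2 * G\<^sup>2 / e"
    proof -
      have "0 \<le> (2 * e * F - \<bar>w x\<bar> * G)\<^sup>2" by simp
      then have "\<bar>w x\<bar> * (F * G) * e \<le> e*e * F\<^sup>2 + (w x)\<^sup>2 * G\<^sup>2 / 4"
        by (simp add: power2_diff power_mult_distrib field_simps power2_eq_square)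
      also have "\<dots> \<le> e*e * F\<^sup>2 + (w x)\<^sup>2 * G\<^sup>2" by simp
      finally show ?thesis using e by (simp add: field_simps)
    qed
    also have "(w x)\<^sup>2 * G\<^sup>2 / e \<le> K * r x * G\<^sup>2 / e"
      using le[OF x] e by (intro divide_right_mono mult_right_mono) auto
    finally show ?thesis unfolding Re_mult_cnj_self F_def[symmetric] G_def[symmetric] by (simp add: mult_ac)
  qed
  have "\<bar>wip L w f g\<bar> \<le> (LINT x|lebesgue_on {0<..<L}. \<bar>w x * Re (f x * cnj (g x))\<bar>)"
    unfolding wip_def by (rule integral_abs_bound)
  also have "\<dots> \<le> (LINT x|lebesgue_on {0<..<L}. e * (1 * Re (f x * cnj (f x))) + (K/e) * (r x * Re (g x * cnj (g x))))"
    using w r f g pw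
    by (intro integral_mono Bochner_Integration.integrable_add Bochner_Integration.integrable_mult_right
         integrable_abs wip_integrable) auto
  also have "\<dots> = e * ip L f f + (K / e) * wip L r g g"
    unfolding wip_def
    by (simp only: Bochner_Integration.integral_add[OF Bochner_Integration.integrable_mult_right[OF wip_integrable[OF bounded_weight_const f f]]
          Bochner_Integration.integrable_mult_right[OF wip_integrable[OF r g g]]] Bochner_Integration.integral_mult_right_zero)
  finally show ?thesis .
qed

lemma ip_Cauchy_Schwarz:
  assumes f: "f \<in> L2 L" and g: "g \<in> L2 L"
  shows "\<bar>ip L f g\<bar> \<le> nrm L f * nrm L g"
proof -
  have expand: "0 \<le> ip L f f + 2 * s * ip L f g + s\<^sup>2 * ip L g g" for s
  proof -
    have "0 \<le> ip L (\<lambda>x. f x + of_real s * g x) (\<lambda>x. f x + of_real s * g x)" by simp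
    also have "\<dots> = ip L f f + 2 * s * ip L f g + s\<^sup>2 * ip L g g"
      using f g by (simp add: wip_linear L2_add L2_cmult wip_commute[of L _ g f] power2_eq_square algebra_simps)
    finally show ?thesis .
  qed
  have "(ip L f g)\<^sup>2 \<le> ip L f f * ip L g g"
  proof (cases "ip L g g = 0")
    case True
    have "ip L f g = 0"
    proof (rule ccontr)
      assume "ip L f g \<noteq> 0"
      then have "2 * (- (ip L f f + 1) / (2 * ip L f g)) * ip L f g = - (ip L f f + 1)" by simp
      with expand[of "- (ip L f f + 1) / (2 * ip L f g)"] True show False by simp
    qed
    then show ?thesis by (simp add: True)
  next
    case False
    then have pos: "ip L g g > 0" using ip_nonneg[of L g] by linarith
    have "0 \<le> ip L g g * (ip L f f + 2 * (- ip L f g / ip L g g) * ip L f g + (- ip L f g / ip L g g)\<^sup>2 * ip L g g)"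
      by (intro mult_nonneg_nonneg expand) simp
    also have "\<dots> = ip L f f * ip L g g - (ip L f g)\<^sup>2"
      using pos by (simp add: field_simps power2_eq_square)
    finally show ?thesis by simp
  qed
  then have "sqrt ((ip L f g)\<^sup>2) \<le> sqrt (ip L f f * ip L g g)" by (rule real_sqrt_le_mono)
  then show ?thesis by (simp add: nrm_def real_sqrt_mult)
qed

lemma wip_bound:
  assumes w: "bounded_weight L w" and f: "f \<in> L2 L" and g: "g \<in> L2 L"
    and K: "\<And>x. x \<in> {0<..<L} \<Longrightarrow> \<bar>w x\<bar> \<le> K"
  shows "\<bar>wip L w f g\<bar> \<le> \<bar>K\<bar> * (nrm L f * nrm L g)"
proof -
  let ?wf = "\<lambda>x. of_real (w x) * f x"
  have wf: "?wf \<in> L2 L" by (rule L2_weight[OF w f])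
  have "ip L ?wf ?wf = wip L (\<lambda>x. (w x)\<^sup>2) f f"
    by (simp add: wip_weight_left wip_weight_right power2_eq_square)
  also have "\<dots> \<le> wip L (\<lambda>x. K\<^sup>2 * 1) f f"
    unfolding mult_1_right
  proof (rule wip_mono_weight)
    fix x assume "x \<in> {0<..<L}"
    then have "\<bar>w x\<bar> \<le> \<bar>K\<bar>" by (rule order_trans[OF K abs_ge_self])
    then show "(w x)\<^sup>2 \<le> K\<^sup>2" by (rule abs_le_square_iff[THEN iffD1])
  qed (intro bounded_weight_power bounded_weight_const w f)+
  also have "\<dots> = K\<^sup>2 * ip L f f" using wip_scale[of L "K\<^sup>2" "\<lambda>x. 1"] by simp
  finally have "nrm L ?wf \<le> \<bar>K\<bar> * nrm L f"
    by - (rule power2_le_imp_le[of _ "\<bar>K\<bar> * nrm L f"], simp_all add: nrm_power2 power_mult_distrib)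
  then have "nrm L ?wf * nrm L g \<le> \<bar>K\<bar> * nrm L f * nrm L g" by (rule mult_right_mono) simp
  moreover have "wip L w f g = ip L ?wf g" by (simp add: wip_weight_left)
  ultimately show ?thesis using ip_Cauchy_Schwarz[OF wf g] by (simp add: mult.assoc)
qed

lemma wip_bounded:
  assumes "bounded_weight L w"
  obtains K where "K \<ge> 0" "\<And>f g. f \<in> L2 L \<Longrightarrow> g \<in> L2 L \<Longrightarrow> \<bar>wip L w f g\<bar> \<le> K * (nrm L f * nrm L g)"
proof -
  obtain K where "\<forall>x\<in>{0<..<L}. \<bar>w x\<bar> \<le> K" using assms unfolding bounded_weight_def by blast
  then show ?thesis by (intro that[of "\<bar>K\<bar>"] wip_bound[OF assms]) auto
qed

lemma nrm_triangle:
  assumes f: "f \<in> L2 L" and g: "g \<in> L2 L"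
  shows "nrm L (\<lambda>x. f x + g x) \<le> nrm L f + nrm L g"
proof -
  have "(nrm L (\<lambda>x. f x + g x))\<^sup>2 = ip L f f + 2 * ip L f g + ip L g g"
    using f g by (simp add: nrm_power2 wip_linear L2_add wip_commute[of L _ g f])
  also have "\<dots> \<le> (nrm L f + nrm L g)\<^sup>2"
    using ip_Cauchy_Schwarz[OF f g] by (simp add: power2_sum nrm_power2)
  finally show ?thesis by (rule power2_le_imp_le) simp
qed

lemma nrm_minus: "nrm L (\<lambda>x. - f x) = nrm L f"
  unfolding nrm_def by (simp add: wip_minus_left wip_minus_right)

lemma nrm_diff_commute: "nrm L (\<lambda>x. f x - g x) = nrm L (\<lambda>x. g x - f x)"
  using nrm_minus[of L "\<lambda>x. f x - g x"] by simp

lemma nrm_triangle_diff: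
  assumes f: "f \<in> L2 L" and g: "g \<in> L2 L"
  shows "nrm L f \<le> nrm L (\<lambda>x. f x - g x) + nrm L g"
  using nrm_triangle[OF L2_diff[OF f g] g] by simp

lemma nrm_cmult: "nrm L (\<lambda>x. k * f x) = cmod k * nrm L f"
proof -
  have "ip L (\<lambda>x. k * f x) (\<lambda>x. k * f x) = wip L (\<lambda>x. (cmod k)\<^sup>2 * 1) f f"
    unfolding wip_def Re_mult_cnj_self by (simp add: norm_mult power_mult_distrib)
  also have "\<dots> = (cmod k)\<^sup>2 * ip L f f" by (rule wip_scale)
  finally show ?thesis by (simp add: nrm_def real_sqrt_mult)
qed

lemma nrm_zero_iff:
  assumes "f \<in> L2 L"
  shows "nrm L f = 0 \<longleftrightarrow> (AE x in lebesgue_on {0<..<L}. f x = 0)"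
proof -
  have "ip L f f = 0 \<longleftrightarrow> (AE x in lebesgue_on {0<..<L}. 1 * Re (f x * cnj (f x)) = 0)" (is "_ \<longleftrightarrow> ?R")
    unfolding wip_def
    by (rule integral_nonneg_eq_0_iff_AE[OF wip_integrable[OF bounded_weight_const assms assms]]) auto
  also have "?R \<longleftrightarrow> (AE x in lebesgue_on {0<..<L}. f x = 0)"
    by (simp only: Re_mult_cnj_self mult_1 zero_eq_power2 norm_eq_zero)
  finally show ?thesis by (simp add: nrm_def)
qed

lemma nrm_cong_AE:
  assumes "AE x in lebesgue_on {0<..<L}. f x = g x" "f \<in> L2 L" "g \<in> L2 L"
  shows "nrm L f = nrm L g"
proof -
  have "ip L f f = ip L g g"
    using assms by (intro wip_cong_AE bounded_weight_const) auto
  then show ?thesis by (simp add: nrm_def)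
qed

lemma wip_tendsto:
  assumes w: "bounded_weight L w" and L2: "\<And>n. f n \<in> L2 L" "\<And>n. g n \<in> L2 L" "f' \<in> L2 L" "g' \<in> L2 L"
    and lim: "((\<lambda>n. nrm L (\<lambda>x. f n x - f' x)) \<longlongrightarrow> 0) F" "((\<lambda>n. nrm L (\<lambda>x. g n x - g' x)) \<longlongrightarrow> 0) F"
  shows "((\<lambda>n. wip L w (f n) (g n)) \<longlongrightarrow> wip L w f' g') F"
proof -
  obtain K where K: "\<And>f g. f \<in> L2 L \<Longrightarrow> g \<in> L2 L \<Longrightarrow> \<bar>wip L w f g\<bar> \<le> K * (nrm L f * nrm L g)"
    using wip_bounded[OF w] by metis
  have "((\<lambda>n. wip L w (f n) (g n) - wip L w f' g') \<longlongrightarrow> 0) F"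
  proof (rule Lim_null_comparison)
    show "\<forall>\<^sub>F n in F. norm (wip L w (f n) (g n) - wip L w f' g') \<le>
       K * (nrm L (\<lambda>x. f n x - f' x) * nrm L (\<lambda>x. g n x - g' x)) +
       K * (nrm L (\<lambda>x. f n x - f' x) * nrm L g') + K * (nrm L f' * nrm L (\<lambda>x. g n x - g' x))"
    proof (intro always_eventually allI)
      fix n
      have "wip L w (f n) (g n) - wip L w f' g' =
         wip L w (\<lambda>x. f n x - f' x) (\<lambda>x. g n x - g' x) + wip L w (\<lambda>x. f n x - f' x) g' + wip L w f' (\<lambda>x. g n x - g' x)"
        using w L2 by (simp add: wip_linear L2_diff)
      then show "norm (wip L w (f n) (g n) - wip L w f' g') \<le>
       K * (nrm L (\<lambda>x. f n x - f' x) * nrm L (\<lambda>x. g n x - g' x)) +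
       K * (nrm L (\<lambda>x. f n x - f' x) * nrm L g') + K * (nrm L f' * nrm L (\<lambda>x. g n x - g' x))"
        using K[of "\<lambda>x. f n x - f' x" "\<lambda>x. g n x - g' x"] K[of "\<lambda>x. f n x - f' x" g'] K[of f' "\<lambda>x. g n x - g' x"] L2
        by (simp add: L2_diff)
    qed
    show "((\<lambda>n. K * (nrm L (\<lambda>x. f n x - f' x) * nrm L (\<lambda>x. g n x - g' x)) +
       K * (nrm L (\<lambda>x. f n x - f' x) * nrm L g') + K * (nrm L f' * nrm L (\<lambda>x. g n x - g' x))) \<longlongrightarrow> 0) F"
      using tendsto_add[OF tendsto_add[OF tendsto_mult_left[OF tendsto_mult[OF lim], of K]
          tendsto_mult_left[OF tendsto_mult_right[OF lim(1), of "nrm L g'"], of K]]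
          tendsto_mult_left[OF tendsto_mult_left[OF lim(2), of "nrm L f'"], of K]] by simp
  qed
  then show ?thesis by (simp add: LIM_zero_cancel)
qed

section \<open>Smooth functions and test functions\<close>

abbreviation vd :: "(real \<Rightarrow> complex) \<Rightarrow> real \<Rightarrow> complex" where
  "vd \<equiv> \<lambda>f t. vector_derivative f (at t)"

definition smooth :: "(real \<Rightarrow> complex) \<Rightarrow> bool" where
  "smooth f \<longleftrightarrow> (\<forall>n x. (vd ^^ n) f differentiable (at x))"

text \<open>Smoothness is the largest property that implies differentiability and is inherited by the derivative, so it
  is proved by exhibiting a class of functions closed under differentiation.\<close>

lemma smooth_coinduct:
  assumes P: "P f" and step: "\<And>g. P g \<Longrightarrow> (\<forall>x. g differentiable (at x)) \<and> P (vd g)"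
  shows "smooth f"
proof -
  have "P ((vd ^^ n) f)" for n
    by (induction n) (use P step in auto)
  then show ?thesis using step unfolding smooth_def by blast
qed

lemma smooth_differentiable: "smooth f \<Longrightarrow> f differentiable (at x)"
  unfolding smooth_def by (metis funpow_0)

lemma smooth_vd: "smooth f \<Longrightarrow> smooth (vd f)"
  unfolding smooth_def by (metis funpow_Suc_right comp_apply)

lemma smooth_has_vector_derivative: "smooth f \<Longrightarrow> (f has_vector_derivative vd f x) (at x)"
  using smooth_differentiable vector_derivative_works by blast

lemma smooth_continuous: "smooth f \<Longrightarrow> continuous_on S f"
  by (meson smooth_has_vector_derivative has_vector_derivative_continuous continuous_at_imp_continuous_on)

lemma vd_eqI: "(\<And>x. (f has_vector_derivative f' x) (at x)) \<Longrightarrow> vd f = f'"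
  by (rule ext) (rule vector_derivative_at)

lemma smoothI_derivative:
  assumes "\<And>x. (f has_vector_derivative f' x) (at x)" "smooth f'"
  shows "smooth f"
proof (rule smooth_coinduct[where P="\<lambda>g. g = f \<or> smooth g"])
  show "f = f \<or> smooth f" by simp
  fix g assume "g = f \<or> smooth g"
  then show "(\<forall>x. g differentiable (at x)) \<and> (vd g = f \<or> smooth (vd g))"
    using assms vd_eqI[OF assms(1)] smooth_differentiable smooth_vd
    by (metis differentiableI_vector)
qed

lemma smooth_const[simp, intro]: "smooth (\<lambda>x. k)"
  by (rule smooth_coinduct[where P="\<lambda>g. \<exists>k. g = (\<lambda>x. k)"])
     auto

text \<open>Products of smooth functions are not closed under differentiation, but their sums are, by the Leibniz rule;
  this class is the invariant for the smoothness of products.\<close>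

inductive sum_of_products :: "(real \<Rightarrow> complex) \<Rightarrow> bool" where
  prod: "smooth f \<Longrightarrow> smooth g \<Longrightarrow> sum_of_products (\<lambda>x. f x * g x)"
| sum: "sum_of_products f \<Longrightarrow> sum_of_products g \<Longrightarrow> sum_of_products (\<lambda>x. f x + g x)"

lemma sum_of_products_vd:
  assumes "sum_of_products h"
  shows "(\<forall>x. h differentiable (at x)) \<and> sum_of_products (vd h)"
  using assms
proof induction
  case (prod f g)
  have d: "((\<lambda>x. f x * g x) has_vector_derivative f x * vd g x + vd f x * g x) (at x)" for x
    using smooth_has_vector_derivative[OF prod(1), of x] smooth_has_vector_derivative[OF prod(2), of x]
    by (rule has_vector_derivative_mult)
  have "sum_of_products (\<lambda>x. f x * vd g x + vd f x * g x)"
    using prod smooth_vd by (intro sum_of_products.intros) auto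
  then show ?case using d vd_eqI[OF d] by (metis differentiableI_vector)
next
  case (sum f g)
  have d: "((\<lambda>x. f x + g x) has_vector_derivative vd f x + vd g x) (at x)" for x
    using sum.IH by (intro has_vector_derivative_add) (auto simp: vector_derivative_works)
  have "sum_of_products (\<lambda>x. vd f x + vd g x)"
    using sum.IH by (intro sum_of_products.intros) auto
  then show ?case using d vd_eqI[OF d] by (metis differentiableI_vector)
qed

lemma sum_of_products_smooth: "sum_of_products h \<Longrightarrow> smooth h"
  using smooth_coinduct[of sum_of_products] sum_of_products_vd by blast

lemma smooth_mult[intro]: "smooth f \<Longrightarrow> smooth g \<Longrightarrow> smooth (\<lambda>x. f x * g x)"
  using sum_of_products_smooth sum_of_products.prod by blast

lemma smooth_add[intro]: "smooth f \<Longrightarrow> smooth g \<Longrightarrow> smooth (\<lambda>x. f x + g x)"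
  using sum_of_products_smooth[OF sum_of_products.sum[OF sum_of_products.prod[of f "\<lambda>x. 1"] sum_of_products.prod[of g "\<lambda>x. 1"]]]
  by simp

lemma smooth_diff[intro]: "smooth f \<Longrightarrow> smooth g \<Longrightarrow> smooth (\<lambda>x. f x - g x)"
  using smooth_add[OF _ smooth_mult[OF smooth_const[of "-1"]], of f g] by simp

lemma smooth_prod: "finite A \<Longrightarrow> (\<And>i. i \<in> A \<Longrightarrow> smooth (f i)) \<Longrightarrow> smooth (\<lambda>x. \<Prod>i\<in>A. f i x)"
  by (induction rule: finite_induct) auto

lemma smooth_affine:
  assumes "smooth f" shows "smooth (\<lambda>x. f (k * x + d))"
proof (rule smooth_coinduct[where P="\<lambda>h. \<exists>g c. smooth g \<and> h = (\<lambda>x. c * g (k * x + d))"])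
  show "\<exists>g c. smooth g \<and> (\<lambda>x. f (k * x + d)) = (\<lambda>x. c * g (k * x + d))"
    using assms by (intro exI[of _ f] exI[of _ 1]) simp
  fix h assume "\<exists>g c. smooth g \<and> h = (\<lambda>x. c * g (k * x + d))"
  then obtain g c where g: "smooth g" and h: "h = (\<lambda>x. c * g (k * x + d))" by blast
  have d: "(h has_vector_derivative (c * of_real k) * vd g (k * x + d)) (at x)" for x
  proof -
    have "((\<lambda>x. k * x + d) has_real_derivative k) (at x)" by (auto intro!: derivative_eq_intros)
    then have "((g \<circ> (\<lambda>x. k * x + d)) has_vector_derivative k *\<^sub>R vd g (k * x + d)) (at x)"
      using smooth_has_vector_derivative[OF g]
      by (intro vector_diff_chain_at) (auto simp: has_real_derivative_iff_has_vector_derivative)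
    then have "((\<lambda>x. c * g (k * x + d)) has_vector_derivative c * (k *\<^sub>R vd g (k * x + d))) (at x)"
      unfolding o_def by (rule has_vector_derivative_mult_right)
    then show ?thesis unfolding h by (simp add: scaleR_conv_of_real mult.assoc)
  qed
  then show "(\<forall>x. h differentiable at x) \<and> (\<exists>g c. smooth g \<and> vd h = (\<lambda>x. c * g (k * x + d)))"
    using vd_eqI[OF d] smooth_vd[OF g] by (metis differentiableI_vector)
qed

lemma smooth_polynomial_function:
  assumes "polynomial_function f" shows "smooth f"
  using assms
  by (rule smooth_coinduct) (metis has_vector_derivative_polynomial_function vd_eqI differentiableI_vector)

text \<open>The function \<open>exp (-1/x)\<close>, extended by zero to the left half-line, is smooth because the
  functions \<open>p (1/x) * exp (-1/x)\<close> with a polynomial \<open>p\<close> are closed under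
  differentiation.\<close>

definition flat_poly :: "real poly \<Rightarrow> real \<Rightarrow> complex" where
  "flat_poly p x = of_real (if x > 0 then poly p (1/x) * exp (- (1/x)) else 0)"

lemma poly_exp_minus_tendsto_0: "((\<lambda>t. poly p t * exp (- t)) \<longlongrightarrow> 0) (at_top :: real filter)"
proof -
  have "((\<lambda>t. \<Sum>i\<le>degree p. coeff p i * (t ^ i / exp t)) \<longlongrightarrow> (\<Sum>i\<le>degree p. coeff p i * 0)) at_top"
    by (intro tendsto_sum tendsto_mult_left tendsto_power_div_exp_0)
  moreover have "(\<lambda>t. poly p t * exp (- t)) = (\<lambda>t. \<Sum>i\<le>degree p. coeff p i * (t ^ i / exp t))"
    by (rule ext) (simp add: poly_altdef sum_distrib_right exp_minus divide_inverse mult.assoc)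
  ultimately show ?thesis by simp
qed

lemma flat_poly_has_vector_derivative:
  "(flat_poly p has_vector_derivative flat_poly (pCons 0 (pCons 0 (p - pderiv p))) x) (at x)"
proof -
  define q where "q = pCons 0 (pCons 0 (p - pderiv p))"
  define f where "f = (\<lambda>x::real. if x > 0 then poly p (1/x) * exp (- (1/x)) else 0)"
  have "(f has_real_derivative (if x > 0 then poly q (1/x) * exp (- (1/x)) else 0)) (at x)"
  proof (cases x "0::real" rule: linorder_cases)
    case greater
    have "((\<lambda>x. poly p (1/x) * exp (- (1/x))) has_real_derivative
       poly (pderiv p) (1/x) * (- (1 / x\<^sup>2)) * exp (- (1/x)) + poly p (1/x) * (exp (- (1/x)) * (1 / x\<^sup>2))) (at x)"
      using greater by (auto intro!: derivative_eq_intros DERIV_chain2[OF poly_DERIV] simp: power2_eq_square)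
    then have "((\<lambda>x. poly p (1/x) * exp (- (1/x))) has_real_derivative poly q (1/x) * exp (- (1/x))) (at x)"
      by (rule DERIV_cong) (simp add: q_def power2_eq_square algebra_simps)
    then have "(f has_real_derivative poly q (1/x) * exp (- (1/x))) (at x)"
      by (rule has_field_derivative_transform_within_open[where S="{0<..}"]) (use greater in \<open>auto simp: f_def\<close>)
    then show ?thesis using greater by simp
  next
    case less
    have "((\<lambda>x. 0) has_real_derivative 0) (at x)" by simp
    then have "(f has_real_derivative 0) (at x)"
      by (rule has_field_derivative_transform_within_open[where S="{..<0}"]) (use less in \<open>auto simp: f_def\<close>)
    then show ?thesis using less by simp
  next
    case equal
    have "((\<lambda>h. f h / h) \<longlongrightarrow> 0) (at_right 0)"
    proof -
      have "((\<lambda>t. poly (pCons 0 p) t * exp (- t)) \<longlongrightarrow> 0) at_top" by (rule poly_exp_minus_tendsto_0)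
      then have "((\<lambda>h. poly (pCons 0 p) (inverse h) * exp (- inverse h)) \<longlongrightarrow> 0) (at_right 0)"
        by (rule filterlim_compose[OF _ filterlim_inverse_at_top_right])
      then show ?thesis
        by (rule Lim_transform_eventually) (auto simp: eventually_at_right_field f_def divide_inverse intro!: exI[of _ 1])
    qed
    moreover have "((\<lambda>h. f h / h) \<longlongrightarrow> 0) (at_left 0)"
      by (rule tendsto_eventually) (auto simp: eventually_at_left_field f_def intro!: exI[of _ "-1"])
    ultimately have "((\<lambda>h. f h / h) \<longlongrightarrow> 0) (at 0)" by (simp add: filterlim_split_at)
    moreover have "f (0 + h) - f 0 = f h" for h by (simp add: f_def)
    ultimately have "(f has_real_derivative 0) (at 0)" unfolding DERIV_def by simp
    then show ?thesis using equal by simp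
  qed
  then have "((\<lambda>x. of_real (f x)) has_vector_derivative of_real (if x > 0 then poly q (1/x) * exp (- (1/x)) else 0)) (at x)"
    by (rule has_vector_derivative_of_real)
  then show ?thesis unfolding flat_poly_def f_def q_def .
qed

lemma smooth_flat_poly: "smooth (flat_poly p)"
proof (rule smooth_coinduct[where P="\<lambda>g. \<exists>p. g = flat_poly p"])
  show "\<exists>q. flat_poly p = flat_poly q" by blast
  fix g assume "\<exists>p. g = flat_poly p"
  then show "(\<forall>x. g differentiable at x) \<and> (\<exists>p. vd g = flat_poly p)"
    using flat_poly_has_vector_derivative vd_eqI[OF flat_poly_has_vector_derivative] by (metis differentiableI_vector)
qed

definition flat_step :: "real \<Rightarrow> real" where
  "flat_step x = (if x > 0 then exp (- (1/x)) else 0)"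

lemma smooth_flat_step: "smooth (\<lambda>x. of_real (flat_step (k * x + d)))"
proof -
  have "flat_poly 1 = (\<lambda>x. of_real (flat_step x))" by (rule ext) (simp add: flat_poly_def flat_step_def)
  then show ?thesis using smooth_affine[OF smooth_flat_poly[of 1], of k d] by simp
qed

lemma flat_step_bounds: "0 \<le> flat_step x" "flat_step x \<le> 1"
  by (auto simp: flat_step_def)

lemma flat_step_tendsto_1: "(flat_step \<longlongrightarrow> 1) at_top"
proof -
  have "((\<lambda>x. exp (- inverse x)) \<longlongrightarrow> exp (- 0)) (at_top::real filter)"
    by (intro tendsto_intros tendsto_inverse_0_at_top filterlim_ident)
  then have "((\<lambda>x. exp (- inverse x)) \<longlongrightarrow> 1) (at_top::real filter)" by simp
  then show ?thesis
    by (rule Lim_transform_eventually)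
       (auto simp: flat_step_def divide_inverse intro: eventually_mono[OF eventually_gt_at_top[of 0]])
qed

text \<open>The set \<open>P\<close> will contain the jumps of the coefficients: multiplication by a piecewise constant
  coefficient then preserves these functions.\<close>

definition tests :: "real \<Rightarrow> real set \<Rightarrow> (real \<Rightarrow> complex) set" where
  "tests L P = {\<phi>. smooth \<phi> \<and> (\<exists>K. compact K \<and> K \<subseteq> {0<..<L} - P \<and> (\<forall>x. x \<notin> K \<longrightarrow> \<phi> x = 0))}"

lemma test_functions_eq: "test_functions L = tests L {}"
  unfolding test_functions_def tests_def smooth_def by simp

lemma tests_subset: "tests L P \<subseteq> test_functions L"
  unfolding test_functions_eq tests_def by auto

lemma tests_smooth: "\<phi> \<in> tests L P \<Longrightarrow> smooth \<phi>"
  by (simp add: tests_def)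

lemma testsI_closed:
  assumes "smooth \<phi>" "compact K" "K \<subseteq> {0<..<L} - P" "\<And>x. x \<notin> K \<Longrightarrow> \<phi> x = 0"
  shows "\<phi> \<in> tests L P"
  using assms unfolding tests_def by blast

lemma tests_mult_smooth:
  assumes "\<phi> \<in> tests L P" "smooth g" shows "(\<lambda>x. g x * \<phi> x) \<in> tests L P"
  using assms unfolding tests_def by (auto intro!: smooth_mult)

lemma tests_add:
  assumes "\<phi> \<in> tests L P" "\<psi> \<in> tests L P" shows "(\<lambda>x. \<phi> x + \<psi> x) \<in> tests L P"
proof -
  obtain K K' where K: "compact K" "K \<subseteq> {0<..<L} - P" "\<forall>x. x \<notin> K \<longrightarrow> \<phi> x = 0"
     "compact K'" "K' \<subseteq> {0<..<L} - P" "\<forall>x. x \<notin> K' \<longrightarrow> \<psi> x = 0"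
    using assms unfolding tests_def by blast
  then show ?thesis using assms
    by (intro testsI_closed[where K="K \<union> K'"]) (auto simp: tests_smooth)
qed

lemma tests_cmult: "\<phi> \<in> tests L P \<Longrightarrow> (\<lambda>x. k * \<phi> x) \<in> tests L P"
  by (rule tests_mult_smooth[where g="\<lambda>x. k"]) auto

lemma tests_diff: "\<phi> \<in> tests L P \<Longrightarrow> \<psi> \<in> tests L P \<Longrightarrow> (\<lambda>x. \<phi> x - \<psi> x) \<in> tests L P"
  using tests_add[of \<phi> L P "\<lambda>x. (-1) * \<psi> x"] tests_cmult[of \<psi> L P "-1"] by simp

lemma vd_zero_open:
  assumes "open S" "x \<in> S" "\<And>y. y \<in> S \<Longrightarrow> \<phi> y = 0"
  shows "vd \<phi> x = 0"
proof -
  have "((\<lambda>x. 0) has_vector_derivative 0) (at x)" by simp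
  then have "(\<phi> has_vector_derivative 0) (at x)"
    by (rule has_vector_derivative_transform_within_open) (use assms in auto)
  then show ?thesis by (rule vector_derivative_at)
qed

lemma tests_vd:
  assumes "\<phi> \<in> tests L P" shows "vd \<phi> \<in> tests L P"
proof -
  obtain K where K: "compact K" "K \<subseteq> {0<..<L} - P" "\<forall>x. x \<notin> K \<longrightarrow> \<phi> x = 0"
    using assms unfolding tests_def by blast
  then have "vd \<phi> x = 0" if "x \<notin> K" for x
    using that by (intro vd_zero_open[where S="- K"]) (auto simp: compact_imp_closed open_Compl)
  with K show ?thesis using assms by (intro testsI_closed[where K=K]) (auto simp: tests_smooth smooth_vd)
qed

lemma tests_cnj:
  assumes "\<phi> \<in> tests L P" shows "(\<lambda>x. cnj (\<phi> x)) \<in> tests L P" "vd (\<lambda>x. cnj (\<phi> x)) = (\<lambda>x. cnj (vd \<phi> x))"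
proof -
  have d: "((\<lambda>x. cnj (g x)) has_vector_derivative cnj (vd g x)) (at x)" if "smooth g" for g x
    using bounded_linear.has_vector_derivative[OF bounded_linear_cnj smooth_has_vector_derivative[OF that]] .
  have "smooth (\<lambda>x. cnj (\<phi> x))"
  proof (rule smooth_coinduct[where P="\<lambda>h. \<exists>g. smooth g \<and> h = (\<lambda>x. cnj (g x))"])
    show "\<exists>g. smooth g \<and> (\<lambda>x. cnj (\<phi> x)) = (\<lambda>x. cnj (g x))" using assms tests_smooth by blast
    fix h assume "\<exists>g. smooth g \<and> h = (\<lambda>x. cnj (g x))"
    then show "(\<forall>x. h differentiable at x) \<and> (\<exists>g. smooth g \<and> vd h = (\<lambda>x. cnj (g x)))"
      using d vd_eqI[OF d] smooth_vd by (metis differentiableI_vector)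
  qed
  then show "(\<lambda>x. cnj (\<phi> x)) \<in> tests L P" using assms unfolding tests_def by auto
  show "vd (\<lambda>x. cnj (\<phi> x)) = (\<lambda>x. cnj (vd \<phi> x))"
    using vd_eqI[OF d] assms tests_smooth by blast
qed

lemma tests_continuous: "\<phi> \<in> tests L P \<Longrightarrow> continuous_on S \<phi>"
  using smooth_continuous tests_smooth by blast

lemma tests_L2: "\<phi> \<in> tests L P \<Longrightarrow> \<phi> \<in> L2 L"
  by (rule L2_continuous) (rule tests_continuous)

section \<open>Density of test functions\<close>

lemma cut_arg_at_top: "0 < c \<Longrightarrow> filterlim (\<lambda>n. real (Suc n) * c - 1) at_top sequentially"
proof -
  assume "0 < c"
  then have "filterlim (\<lambda>n. c * real (Suc n)) at_top sequentially"
    by (intro filterlim_tendsto_pos_mult_at_top[OF tendsto_const] filterlim_compose[OF filterlim_real_sequentially filterlim_Suc]) auto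
  then have "filterlim (\<lambda>n. -1 + c * real (Suc n)) at_top sequentially"
    by (rule filterlim_tendsto_add_at_top[OF tendsto_const])
  then show ?thesis by (simp add: mult.commute)
qed

text \<open>Each factor \<open>flat_step (n t - 1)\<close> vanishes for \<open>t \<le> 1/n\<close> and tends to 1 for
  \<open>t > 0\<close> as \<open>n\<close> grows, so the product switches off the boundary points and the
  points of \<open>P\<close>.\<close>

definition cutoff :: "real \<Rightarrow> real set \<Rightarrow> nat \<Rightarrow> real \<Rightarrow> real" where
  "cutoff L P n x = flat_step (real (Suc n) * x - 1) * flat_step (real (Suc n) * (L - x) - 1) *
     (\<Prod>p\<in>P. flat_step (real (Suc n) * (x - p) - 1) + flat_step (real (Suc n) * (p - x) - 1))"

lemma flat_step_sum_bounds:
  "0 \<le> flat_step (c - 1) + flat_step (- c - 1)" "flat_step (c - 1) + flat_step (- c - 1) \<le> 1"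
  by (auto simp: flat_step_def)

lemma cutoff_bounds: "0 \<le> cutoff L P n x" "cutoff L P n x \<le> 1"
proof -
  have a: "flat_step (real (Suc n) * (p - x) - 1) = flat_step (- (real (Suc n) * (x - p)) - 1)" for p
    by (simp add: algebra_simps)
  have "0 \<le> (\<Prod>p\<in>P. flat_step (real (Suc n) * (x - p) - 1) + flat_step (real (Suc n) * (p - x) - 1))"
    unfolding a by (intro prod_nonneg flat_step_sum_bounds)
  moreover have "(\<Prod>p\<in>P. flat_step (real (Suc n) * (x - p) - 1) + flat_step (real (Suc n) * (p - x) - 1)) \<le> 1"
    unfolding a by (intro prod_le_1 conjI flat_step_sum_bounds)
  ultimately show "0 \<le> cutoff L P n x" "cutoff L P n x \<le> 1"
    unfolding cutoff_def using flat_step_bounds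
    by (auto intro!: mult_le_one mult_nonneg_nonneg)
qed

lemma smooth_cutoff:
  assumes "finite P" shows "smooth (\<lambda>x. of_real (cutoff L P n x))"
proof -
  have 1: "smooth (\<lambda>x. of_real (flat_step (real (Suc n) * (x - p) - 1)))" for p
    using smooth_flat_step[of "real (Suc n)" "- real (Suc n) * p - 1"] by (simp add: algebra_simps)
  have 2: "smooth (\<lambda>x. of_real (flat_step (real (Suc n) * (p - x) - 1)))" for p
    using smooth_flat_step[of "- real (Suc n)" "real (Suc n) * p - 1"] by (simp add: algebra_simps)
  show ?thesis
    unfolding cutoff_def of_real_mult of_real_prod of_real_add
    using assms 1[of 0] 2[of L] 1 2
    by (intro smooth_mult smooth_prod smooth_add) auto
qed

lemma cutoff_tests:
  assumes P: "finite P" and g: "smooth g"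
  shows "(\<lambda>x. of_real (cutoff L P n x) * g x) \<in> tests L P"
proof -
  define d where "d = 1 / real (Suc n)"
  have d: "d > 0" "real (Suc n) * d = 1" by (auto simp: d_def)
  define K where "K = {d..L - d} \<inter> (\<Inter>p\<in>P. {x. d \<le> \<bar>x - p\<bar>})"
  have "compact K" unfolding K_def
    by (intro compact_Int_closed compact_Icc closed_INT ballI closed_Collect_le continuous_intros)
  moreover have "K \<subseteq> {0<..<L} - P" using d unfolding K_def by fastforce
  moreover have "cutoff L P n x = 0" if "x \<notin> K" for x
  proof -
    have z: "flat_step (real (Suc n) * c - 1) = 0" if "c \<le> d" for c
    proof -
      have "real (Suc n) * c \<le> real (Suc n) * d" using that by (intro mult_left_mono) auto
      then show ?thesis using d by (simp add: flat_step_def del: of_nat_Suc)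
    qed
    from that consider "x \<le> d" | "L - x \<le> d" | p where "p \<in> P" "\<bar>x - p\<bar> \<le> d"
      unfolding K_def by fastforce
    then show ?thesis
    proof cases
      case 3
      then have "flat_step (real (Suc n) * (x - p) - 1) + flat_step (real (Suc n) * (p - x) - 1) = 0"
        using z[of "x - p"] z[of "p - x"] by (simp del: of_nat_Suc)
      then show ?thesis using 3 P unfolding cutoff_def by (auto intro!: prod_zero simp del: of_nat_Suc)
    qed (auto simp: cutoff_def z simp del: of_nat_Suc)
  qed
  ultimately show ?thesis
    using smooth_mult[OF smooth_cutoff[OF P] g] by (intro testsI_closed[where K=K]) auto
qed

lemma cutoff_tendsto_1:
  assumes P: "finite P" and x: "x \<in> {0<..<L}" "x \<notin> P"
  shows "(\<lambda>n. cutoff L P n x) \<longlonglongrightarrow> 1"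
proof -
  have 1: "(\<lambda>n. flat_step (real (Suc n) * c - 1)) \<longlonglongrightarrow> 1" if "0 < c" for c
    by (rule filterlim_compose[OF flat_step_tendsto_1 cut_arg_at_top[OF that]])
  have 0: "(\<lambda>n. flat_step (real (Suc n) * c - 1)) \<longlonglongrightarrow> 0" if "c < 0" for c
  proof -
    have "\<not> real (Suc n) * c > 1" for n using mult_nonneg_nonpos[of "real (Suc n)" c] that by linarith
    then have "flat_step (real (Suc n) * c - 1) = 0" for n by (simp add: flat_step_def del: of_nat_Suc)
    then show ?thesis by (simp del: of_nat_Suc)
  qed
  have "(\<lambda>n. flat_step (real (Suc n) * (x - p) - 1) + flat_step (real (Suc n) * (p - x) - 1)) \<longlonglongrightarrow> 1"
    if "p \<in> P" for p
  proof (cases "x < p")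
    case True then show ?thesis using tendsto_add[OF 0[of "x-p"] 1[of "p-x"]] by simp
  next
    case False
    moreover have "x \<noteq> p" using that x by blast
    ultimately have "x > p" by simp
    then show ?thesis using tendsto_add[OF 1[of "x-p"] 0[of "p-x"]] by simp
  qed
  then have "(\<lambda>n. \<Prod>p\<in>P. flat_step (real (Suc n) * (x - p) - 1) + flat_step (real (Suc n) * (p - x) - 1)) \<longlonglongrightarrow> (\<Prod>p\<in>P. 1)"
    by (intro tendsto_prod)
  from tendsto_mult[OF tendsto_mult[OF 1[of x] 1[of "L - x"]] this] x
  show ?thesis unfolding cutoff_def by simp
qed

lemma AE_interval_not_in:
  assumes "negligible N" shows "AE x in lebesgue_on {0<..<L::real}. x \<notin> N"
proof -
  have "AE x in lebesgue. x \<notin> N" using assms by (intro AE_not_in) (simp add: negligible_iff_null_sets)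
  then have "AE x in lebesgue. x \<in> {0<..<L} \<longrightarrow> x \<notin> N" by (rule eventually_mono) simp
  then show ?thesis by (simp add: AE_restrict_space_iff)
qed

lemma nrm_tendsto_dominated:
  assumes L2: "\<And>n. g n \<in> L2 L" "f \<in> L2 L" "h \<in> L2 L"
    and lim: "AE x in lebesgue_on {0<..<L}. (\<lambda>n. g n x) \<longlonglongrightarrow> f x"
    and dom: "\<And>n. AE x in lebesgue_on {0<..<L}. cmod (f x - g n x) \<le> cmod (h x)"
  shows "(\<lambda>n. nrm L (\<lambda>x. f x - g n x)) \<longlonglongrightarrow> 0"
proof -
  let ?M = "lebesgue_on {0<..<L}"
  have eq: "ip L k k = (LINT x|?M. (cmod (k x))\<^sup>2)" for k
    unfolding wip_def Re_mult_cnj_self by simp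
  have "(\<lambda>n. LINT x|?M. (cmod (f x - g n x))\<^sup>2) \<longlonglongrightarrow> (LINT x|?M. 0)"
  proof (rule integral_dominated_convergence[where w="\<lambda>x. (cmod (h x))\<^sup>2"])
    show "(\<lambda>x. (cmod (f x - g n x))\<^sup>2) \<in> borel_measurable ?M" for n
      using L2_integrable[OF L2_diff[OF L2(2) L2(1)]] by (rule borel_measurable_integrable)
    show "integrable ?M (\<lambda>x. (cmod (h x))\<^sup>2)" using L2(3) by (rule L2_integrable)
    show "AE x in ?M. (\<lambda>n. (cmod (f x - g n x))\<^sup>2) \<longlonglongrightarrow> 0"
      using lim
    proof (rule AE_mp, intro AE_I2 impI)
      fix x assume "(\<lambda>n. g n x) \<longlonglongrightarrow> f x"
      then have "(\<lambda>n. (cmod (f x - g n x))\<^sup>2) \<longlonglongrightarrow> (cmod (f x - f x))\<^sup>2" by (intro tendsto_intros)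
      then show "(\<lambda>n. (cmod (f x - g n x))\<^sup>2) \<longlonglongrightarrow> 0" by simp
    qed
    show "AE x in ?M. norm ((cmod (f x - g n x))\<^sup>2) \<le> (cmod (h x))\<^sup>2" for n
      using dom[of n] by (rule AE_mp) (auto intro!: AE_I2 power_mono)
  qed simp
  then have "(\<lambda>n. sqrt (ip L (\<lambda>x. f x - g n x) (\<lambda>x. f x - g n x))) \<longlonglongrightarrow> sqrt 0"
    unfolding eq by (intro tendsto_real_sqrt) simp
  then show ?thesis by (simp add: nrm_def)
qed

lemma measure_interval: "L \<ge> 0 \<Longrightarrow> ip L (\<lambda>x. 1) (\<lambda>x. 1) = L"
  unfolding wip_def by (simp add: measure_restrict_space)

lemma nrm_bounded:
  assumes "L \<ge> 0" "f \<in> L2 L" "K \<ge> 0" "\<And>x. x \<in> {0<..<L} \<Longrightarrow> cmod (f x) \<le> K"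
  shows "nrm L f \<le> sqrt L * K"
proof -
  have "ip L f f \<le> ip L (\<lambda>x. of_real K * 1) (\<lambda>x. of_real K * 1)"
    unfolding wip_def Re_mult_cnj_self
  proof (rule integral_mono)
    show "integrable (lebesgue_on {0<..<L}) (\<lambda>x. 1 * (cmod (f x))\<^sup>2)" 
      using L2_integrable[OF assms(2)] by simp
    show "integrable (lebesgue_on {0<..<L}) (\<lambda>x. 1 * (cmod (complex_of_real K * 1))\<^sup>2)"
      using L2_integrable[OF L2_const[of "of_real K"]] by simp
    show "1 * (cmod (f x))\<^sup>2 \<le> 1 * (cmod (complex_of_real K * 1))\<^sup>2" if "x \<in> space (lebesgue_on {0<..<L})" for x
      using assms that by (auto intro!: power_mono)
  qed
  also have "\<dots> = K\<^sup>2 * L"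
    unfolding wip_scale_left wip_scale_right measure_interval[OF assms(1)] by (simp add: power2_eq_square)
  finally have "ip L f f \<le> (sqrt L * K)\<^sup>2" using assms by (simp add: power_mult_distrib mult.commute)
  then show ?thesis using assms by (simp add: nrm_def real_le_lsqrt)
qed

text \<open>Density is established along the chain of classes smooth, continuous, bounded, square integrable; each class
  is approximated in norm by the preceding one.\<close>

definition approximable :: "real \<Rightarrow> (real \<Rightarrow> complex) set \<Rightarrow> (real \<Rightarrow> complex) \<Rightarrow> bool" where
  "approximable L V f \<longleftrightarrow> f \<in> L2 L \<and> (\<forall>e>0. \<exists>\<phi>\<in>V. \<phi> \<in> L2 L \<and> nrm L (\<lambda>x. f x - \<phi> x) < e)"

lemma approximable_step:
  assumes f: "f \<in> L2 L" and ap: "\<And>e. e > 0 \<Longrightarrow> \<exists>g. approximable L V g \<and> nrm L (\<lambda>x. f x - g x) < e"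
  shows "approximable L V f"
  unfolding approximable_def
proof (intro conjI f allI impI)
  fix e :: real assume "e > 0"
  then obtain g where g: "approximable L V g" "nrm L (\<lambda>x. f x - g x) < e / 2" using ap[of "e/2"] by auto
  then obtain \<phi> where \<phi>: "\<phi> \<in> V" "\<phi> \<in> L2 L" "nrm L (\<lambda>x. g x - \<phi> x) < e / 2"
    using \<open>e > 0\<close> unfolding approximable_def by (metis half_gt_zero)
  have "nrm L (\<lambda>x. (f x - g x) + (g x - \<phi> x)) \<le> nrm L (\<lambda>x. f x - g x) + nrm L (\<lambda>x. g x - \<phi> x)"
    using f g \<phi> by (intro nrm_triangle L2_diff) (auto simp: approximable_def)
  then show "\<exists>\<phi>\<in>V. \<phi> \<in> L2 L \<and> nrm L (\<lambda>x. f x - \<phi> x) < e" using g \<phi> by auto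
qed

lemma approximable_lim:
  assumes f: "f \<in> L2 L" and ap: "\<And>n. approximable L V (g n)"
    and lim: "(\<lambda>n. nrm L (\<lambda>x. f x - g n x)) \<longlonglongrightarrow> 0"
  shows "approximable L V f"
proof (rule approximable_step[OF f])
  fix e :: real assume "e > 0"
  then have "\<forall>\<^sub>F n in sequentially. nrm L (\<lambda>x. f x - g n x) < e" using order_tendstoD(2)[OF lim] by simp
  then show "\<exists>g. approximable L V g \<and> nrm L (\<lambda>x. f x - g x) < e"
    using ap by (auto simp: eventually_sequentially)
qed

lemma approximable_smooth:
  assumes P: "finite P" and g: "smooth g"
  shows "approximable L (tests L P) g"
proof (rule approximable_lim[where g="\<lambda>n x. of_real (cutoff L P n x) * g x"])
  have gc: "continuous_on UNIV g" using g by (rule smooth_continuous)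
  show gL: "g \<in> L2 L" using gc by (rule L2_continuous)
  have t: "(\<lambda>x. of_real (cutoff L P n x) * g x) \<in> tests L P" for n by (rule cutoff_tests[OF P g])
  have z: "nrm L (\<lambda>x. 0) = 0" by (simp add: nrm_def wip_def)
  show "approximable L (tests L P) (\<lambda>x. of_real (cutoff L P n x) * g x)" for n
    using t[of n] tests_L2[OF t[of n]] z unfolding approximable_def by (auto intro!: bexI[OF _ t[of n]])
  show "(\<lambda>n. nrm L (\<lambda>x. g x - of_real (cutoff L P n x) * g x)) \<longlonglongrightarrow> 0"
  proof (rule nrm_tendsto_dominated[where h=g])
    show "AE x in lebesgue_on {0<..<L}. (\<lambda>n. of_real (cutoff L P n x) * g x) \<longlonglongrightarrow> g x"
      using AE_interval_not_in[OF negligible_finite[OF P]]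
    proof (rule AE_mp, intro AE_I2 impI)
      fix x assume "x \<in> space (lebesgue_on {0<..<L})" "x \<notin> P"
      then have "(\<lambda>n. of_real (cutoff L P n x) * g x) \<longlonglongrightarrow> of_real 1 * g x"
        by (intro tendsto_intros cutoff_tendsto_1 P) auto
      then show "(\<lambda>n. of_real (cutoff L P n x) * g x) \<longlonglongrightarrow> g x" by simp
    qed
    show "AE x in lebesgue_on {0<..<L}. cmod (g x - of_real (cutoff L P n x) * g x) \<le> cmod (g x)" for n
    proof (rule AE_I2)
      fix x
      have "g x - of_real (cutoff L P n x) * g x = of_real (1 - cutoff L P n x) * g x" by (simp add: algebra_simps)
      then have "cmod (g x - of_real (cutoff L P n x) * g x) = \<bar>1 - cutoff L P n x\<bar> * cmod (g x)"
        by (simp only: norm_mult norm_of_real)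
      also have "\<dots> \<le> 1 * cmod (g x)" using cutoff_bounds[of L P n x] by (intro mult_right_mono) auto
      finally show "cmod (g x - of_real (cutoff L P n x) * g x) \<le> cmod (g x)" by simp
    qed
  qed (use tests_L2[OF t] gL in auto)
qed

lemma approximable_continuous:
  assumes L: "L > 0" and P: "finite P" and g: "continuous_on UNIV g"
  shows "approximable L (tests L P) g"
proof (rule approximable_step)
  show gL: "g \<in> L2 L" using g by (rule L2_continuous)
  fix e :: real assume e: "e > 0"
  define d where "d = e / (2 * sqrt L)"
  have d: "d > 0" using e L by (simp add: d_def)
  obtain p where p: "polynomial_function p" "\<forall>x\<in>{0..L}. norm (g x - p x) < d"
    using Stone_Weierstrass_polynomial_function[of "{0..L}" g d] d continuous_on_subset[OF g] by auto
  have ps: "smooth p" using p by (intro smooth_polynomial_function)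
  have "nrm L (\<lambda>x. g x - p x) \<le> sqrt L * d"
    using L d p gL L2_continuous[OF smooth_continuous[OF ps]]
    by (intro nrm_bounded L2_diff) (auto intro: less_imp_le)
  also have "\<dots> = e / 2" using L by (simp add: d_def)
  finally show "\<exists>p. approximable L (tests L P) p \<and> nrm L (\<lambda>x. g x - p x) < e"
    using approximable_smooth[OF P ps] e by (intro exI[of _ p]) auto
qed

text \<open>Radial retraction onto the disc of radius \<open>K\<close>. It turns continuous functions that converge
  almost everywhere to a bounded function into uniformly bounded ones with the same limit, so that dominated
  convergence applies.\<close>

definition clip :: "real \<Rightarrow> complex \<Rightarrow> complex" where
  "clip K z = of_real (K / max K (cmod z)) * z"

lemma clip_bound: "K > 0 \<Longrightarrow> cmod (clip K z) \<le> K"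
  unfolding clip_def norm_mult norm_of_real
  by (simp add: divide_le_eq abs_of_pos max_def)

lemma clip_id: "K > 0 \<Longrightarrow> cmod z \<le> K \<Longrightarrow> clip K z = z"
  by (simp add: clip_def max_def)

lemma continuous_clip: "K > 0 \<Longrightarrow> continuous_on UNIV (clip K)"
  unfolding clip_def by (intro continuous_intros) auto

lemma approximable_bounded:
  assumes L: "L > 0" and P: "finite P" and f: "f \<in> borel_measurable (lebesgue_on {0<..<L})"
    and K: "K > 0" "\<And>x. x \<in> {0<..<L} \<Longrightarrow> cmod (f x) \<le> K"
  shows "approximable L (tests L P) f"
proof -
  have fL: "f \<in> L2 L" using f K(2) by (rule L2_bounded)
  have "f measurable_on {0<..<L}" using f measurable_on_iff_borel_measurable[OF interval_in_lebesgue] by blast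
  then obtain N g where N: "negligible N" and g: "\<And>n. continuous_on UNIV (g n)"
    and lim: "\<And>x. x \<notin> N \<Longrightarrow> (\<lambda>n. g n x) \<longlonglongrightarrow> (if x \<in> {0<..<L} then f x else 0)"
    unfolding measurable_on_def by blast
  have cg: "continuous_on UNIV (\<lambda>x. clip K (g n x))" for n
    by (rule continuous_on_compose2[OF continuous_clip[OF K(1)] g]) auto
  show ?thesis
  proof (rule approximable_lim[OF fL])
    show "approximable L (tests L P) (\<lambda>x. clip K (g n x))" for n
      by (rule approximable_continuous[OF L P cg])
    show "(\<lambda>n. nrm L (\<lambda>x. f x - clip K (g n x))) \<longlonglongrightarrow> 0"
    proof (rule nrm_tendsto_dominated[where h="\<lambda>x. of_real (2 * K)"])
      show "AE x in lebesgue_on {0<..<L}. (\<lambda>n. clip K (g n x)) \<longlonglongrightarrow> f x"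
        using AE_interval_not_in[OF N]
      proof (rule AE_mp, intro AE_I2 impI)
        fix x assume x: "x \<in> space (lebesgue_on {0<..<L})" "x \<notin> N"
        then have "(\<lambda>n. g n x) \<longlonglongrightarrow> f x" using lim[of x] by simp
        then have "(\<lambda>n. clip K (g n x)) \<longlonglongrightarrow> clip K (f x)"
          by (rule continuous_on_tendsto_compose[OF continuous_clip[OF K(1)]]) auto
        then show "(\<lambda>n. clip K (g n x)) \<longlonglongrightarrow> f x" using x K clip_id by simp
      qed
      show "AE x in lebesgue_on {0<..<L}. cmod (f x - clip K (g n x)) \<le> cmod (of_real (2 * K))" for n
      proof (rule AE_I2)
        fix x assume "x \<in> space (lebesgue_on {0<..<L})"
        then have "cmod (f x) \<le> K" using K by simp
        then show "cmod (f x - clip K (g n x)) \<le> cmod (of_real (2 * K))"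
          using norm_triangle_ineq4[of "f x" "clip K (g n x)"] clip_bound[OF K(1), of "g n x"] K by (simp add: norm_mult)
      qed
    qed (use fL L2_continuous[OF cg] in auto)
  qed
qed

lemma tests_dense:
  assumes L: "L > 0" and P: "finite P" and f: "f \<in> L2 L"
  shows "approximable L (tests L P) f"
proof -
  define g where "g n x = (if cmod (f x) \<le> real (Suc n) then f x else 0)" for n x
  have [measurable]: "f \<in> borel_measurable (lebesgue_on {0<..<L})" using f by (rule L2_measurable)
  have gm: "g n \<in> borel_measurable (lebesgue_on {0<..<L})" for n unfolding g_def by measurable
  have gL: "g n \<in> L2 L" for n by (rule L2_bounded[OF gm, of n "real (Suc n)"]) (simp add: g_def)
  show ?thesis
  proof (rule approximable_lim[OF f])
    show "approximable L (tests L P) (g n)" for n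
      by (rule approximable_bounded[OF L P gm, of "real (Suc n)"]) (auto simp: g_def)
    show "(\<lambda>n. nrm L (\<lambda>x. f x - g n x)) \<longlonglongrightarrow> 0"
    proof (rule nrm_tendsto_dominated[where h=f])
      show "AE x in lebesgue_on {0<..<L}. (\<lambda>n. g n x) \<longlonglongrightarrow> f x"
      proof (rule AE_I2, rule tendsto_eventually)
        fix x
        obtain m where "cmod (f x) \<le> real m" using real_arch_simple by blast
        then show "\<forall>\<^sub>F n in sequentially. g n x = f x"
          unfolding eventually_sequentially g_def by (intro exI[of _ m]) auto
      qed
      show "AE x in lebesgue_on {0<..<L}. cmod (f x - g n x) \<le> cmod (f x)" for n
        by (rule AE_I2) (simp add: g_def)
    qed (use f gL in auto)
  qed
qed

lemma tests_dense_obtain: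
  assumes "L > 0" "finite P" "f \<in> L2 L" "e > 0"
  obtains \<phi> where "\<phi> \<in> tests L P" "nrm L (\<lambda>x. f x - \<phi> x) < e"
  using tests_dense[OF assms(1-3)] assms(4) unfolding approximable_def by blast

section \<open>Primitives and the real form of weak derivatives\<close>

lemma integral_interval_continuous:
  fixes f :: "real \<Rightarrow> 'a::euclidean_space"
  assumes "continuous_on UNIV f"
  shows "integrable (lebesgue_on {0<..<L}) f" "(LINT x|lebesgue_on {0<..<L}. f x) = integral {0..L} f"
proof -
  have "integrable (lebesgue_on {0..L}) f"
    by (intro continuous_imp_integrable_real continuous_on_subset[OF assms]) auto
  then have "set_integrable lebesgue {0..L} f" by (simp add: integrable_restrict_space set_integrable_def)
  then have "set_integrable lebesgue {0<..<L} f" by (rule set_integrable_subset) auto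
  then show i: "integrable (lebesgue_on {0<..<L}) f" by (simp add: integrable_restrict_space set_integrable_def)
  show "(LINT x|lebesgue_on {0<..<L}. f x) = integral {0..L} f"
    by (simp add: lebesgue_integral_eq_integral[OF i] integral_open_interval_real)
qed

lemma integral_interval_derivative:
  fixes F f :: "real \<Rightarrow> 'a::euclidean_space"
  assumes "L \<ge> 0" "\<And>x. (F has_vector_derivative f x) (at x)" "continuous_on UNIV f"
  shows "(LINT x|lebesgue_on {0<..<L}. f x) = F L - F 0"
  unfolding integral_interval_continuous(2)[OF assms(3)]
  using assms by (intro integral_unique fundamental_theorem_of_calculus) (auto intro: has_vector_derivative_at_within)

definition C1 :: "(real \<Rightarrow> 'a::real_normed_vector) \<Rightarrow> (real \<Rightarrow> 'a) \<Rightarrow> bool" where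
  "C1 F F' \<longleftrightarrow> (\<forall>x. (F has_vector_derivative F' x) (at x)) \<and> continuous_on UNIV F'"

lemma C1_derivative: "C1 F F' \<Longrightarrow> (F has_vector_derivative F' x) (at x)"
  and C1_continuous': "C1 F F' \<Longrightarrow> continuous_on UNIV F'"
  by (auto simp: C1_def)

lemma C1_continuous: "C1 F F' \<Longrightarrow> continuous_on UNIV F"
  by (meson C1_derivative has_vector_derivative_continuous continuous_at_imp_continuous_on)

lemma C1_smooth: "smooth F \<Longrightarrow> C1 F (vd F)"
  by (simp add: C1_def smooth_has_vector_derivative smooth_continuous smooth_vd)

lemma C1_const: "C1 (\<lambda>x. k) (\<lambda>x. 0)"
  by (simp add: C1_def)

lemma C1_add: "C1 F F' \<Longrightarrow> C1 G G' \<Longrightarrow> C1 (\<lambda>x. F x + G x) (\<lambda>x. F' x + G' x)"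
  unfolding C1_def by (auto intro!: has_vector_derivative_add continuous_intros)

lemma C1_ibp:
  assumes L: "L \<ge> 0" and q: "C1 q q'" and F: "C1 F F'" and G: "C1 G G'"
  shows "wip L q F' G + wip L q F G' + wip L q' F G = q L * Re (F L * cnj (G L)) - q 0 * Re (F 0 * cnj (G 0))"
proof -
  define h where "h x = q x * Re (F x * cnj (G x))" for x
  define h' where "h' x = q x * Re (F' x * cnj (G x)) + q x * Re (F x * cnj (G' x)) + q' x * Re (F x * cnj (G x))" for x
  have d: "(h has_vector_derivative h' x) (at x)" for x
  proof -
    have "((\<lambda>x. F x * cnj (G x)) has_vector_derivative (F x * cnj (G' x) + F' x * cnj (G x))) (at x)"
      by (intro has_vector_derivative_mult C1_derivative[OF F]
           bounded_linear.has_vector_derivative[OF bounded_linear_cnj] C1_derivative[OF G])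
    then have "((\<lambda>x. Re (F x * cnj (G x))) has_vector_derivative Re (F x * cnj (G' x) + F' x * cnj (G x))) (at x)"
      by (rule bounded_linear.has_vector_derivative[OF bounded_linear_Re])
    from has_vector_derivative_mult[OF C1_derivative[OF q, of x] this]
    show ?thesis unfolding h_def h'_def by (simp add: algebra_simps)
  qed
  have cont: "continuous_on UNIV q" "continuous_on UNIV q'" "continuous_on UNIV F" "continuous_on UNIV F'"
     "continuous_on UNIV G" "continuous_on UNIV G'"
    using q F G C1_continuous C1_continuous' by blast+
  have w: "bounded_weight L q" "bounded_weight L q'" "F \<in> L2 L" "F' \<in> L2 L" "G \<in> L2 L" "G' \<in> L2 L"
    using cont bounded_weight_continuous L2_continuous by blast+
  have "wip L q F' G + wip L q F G' + wip L q' F G = (LINT x|lebesgue_on {0<..<L}. h' x)"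
    unfolding wip_def h'_def
    by (simp only: Bochner_Integration.integral_add Bochner_Integration.integrable_add wip_integrable w)
  also have "\<dots> = h L - h 0"
    unfolding h'_def[abs_def]
    by (rule integral_interval_derivative[OF L])
       (use d cont in \<open>auto simp: h'_def intro!: continuous_intros\<close>)
  finally show ?thesis by (simp add: h_def)
qed

text \<open>Vanishing of \<open>f\<close> on the left half-line makes the integral from 0 a primitive on the whole line,
  although it is constantly zero for negative \<open>x\<close>.\<close>

lemma antiderivative:
  fixes f :: "real \<Rightarrow> 'a::euclidean_space"
  assumes f: "continuous_on UNIV f" and z: "\<And>x. x \<le> 0 \<Longrightarrow> f x = 0"
  obtains F where "C1 F f" "\<And>x. x \<le> 0 \<Longrightarrow> F x = 0" "\<And>x. F x = integral {0..x} f"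
proof -
  define F where "F x = integral {0..x} f" for x
  \<comment> \<open>Starting the integral to the left of 0 makes differentiability at 0 an interior statement.\<close>
  define G where "G x = integral {-1..x} f" for x
  have FG: "F x = G x" for x
  proof (cases "x \<le> 0")
    case True
    have "integral {-1..x} f = integral {-1..x} (\<lambda>x::real. 0::'a)" using z True by (intro Henstock_Kurzweil_Integration.integral_cong) auto
    moreover have "integral {0..x} f = integral {0..x} (\<lambda>x::real. 0::'a)" using z True by (intro Henstock_Kurzweil_Integration.integral_cong) auto
    ultimately show ?thesis by (simp add: F_def G_def)
  next
    case False
    have "integral {-1..0} f + integral {0..x} f = integral {-1..x} f"
      using False by (intro Henstock_Kurzweil_Integration.integral_combine integrable_continuous_real continuous_on_subset[OF f]) auto
    moreover have "integral {-1..0} f = integral {-1..0} (\<lambda>x::real. 0::'a)" by (rule Henstock_Kurzweil_Integration.integral_cong) (simp add: z)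
    ultimately show ?thesis by (simp add: F_def G_def)
  qed
  have d: "(F has_vector_derivative f x) (at x)" for x
  proof (cases "x > -1")
    case True
    have "(G has_vector_derivative f x) (at x within {-1..x+1})"
      unfolding G_def using True by (intro integral_has_vector_derivative continuous_on_subset[OF f]) auto
    then have "(G has_vector_derivative f x) (at x)"
      using True by (simp add: at_within_Icc_at)
    then show ?thesis unfolding FG[abs_def] by simp
  next
    case False
    have "((\<lambda>x. 0) has_vector_derivative f x) (at x)" using z[of x] False by simp
    then show ?thesis
      by (rule has_vector_derivative_transform_within_open[where S="{..<0}"]) (use False in \<open>auto simp: F_def\<close>)
  qed
  have "F x = 0" if "x \<le> 0" for x
  proof (cases "x = 0")
    case False
    then show ?thesis using that by (simp add: F_def)
  qed (simp add: F_def)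
  then show ?thesis using d f by (intro that[of F]) (auto simp: C1_def F_def)
qed

lemma L2_integrable_1:
  assumes "f \<in> L2 L" shows "integrable (lebesgue_on {0<..<L}) f"
proof -
  have "integrable (lebesgue_on {0<..<L}) (\<lambda>x. cmod (f x))"
    using L2_integrable_product[OF assms L2_const[of 1]] by simp
  then show ?thesis using assms L2_measurable integrable_norm_iff by blast
qed

lemma norm_integral_le:
  assumes L: "L \<ge> 0" and f: "f \<in> L2 L"
  shows "(LINT x|lebesgue_on {0<..<L}. cmod (f x)) \<le> sqrt L * nrm L f"
    "cmod (LINT x|lebesgue_on {0<..<L}. f x) \<le> sqrt L * nrm L f"
proof -
  let ?g = "\<lambda>x. complex_of_real (cmod (f x))"
  have g: "?g \<in> L2 L" using f by (auto simp: L2_def)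
  have "(LINT x|lebesgue_on {0<..<L}. cmod (f x)) = ip L ?g (\<lambda>x. 1)" by (simp add: wip_def)
  also have "\<dots> \<le> nrm L ?g * nrm L (\<lambda>x. 1)" using ip_Cauchy_Schwarz[OF g L2_const[of 1]] by simp
  also have "nrm L ?g = nrm L f" unfolding nrm_def wip_def Re_mult_cnj_self by simp
  also have "nrm L (\<lambda>x. 1) = sqrt L" using L by (simp add: nrm_def measure_interval)
  finally show 1: "(LINT x|lebesgue_on {0<..<L}. cmod (f x)) \<le> sqrt L * nrm L f" by (simp add: mult.commute)
  then show "cmod (LINT x|lebesgue_on {0<..<L}. f x) \<le> sqrt L * nrm L f"
    by (rule order_trans[OF integral_norm_bound])
qed

lemma antiderivative_bound:
  fixes f :: "real \<Rightarrow> complex"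
  assumes L: "L \<ge> 0" and f: "continuous_on UNIV f" and x: "x \<in> {0..L}"
  shows "cmod (integral {0..x} f) \<le> sqrt L * nrm L f"
proof -
  have c: "continuous_on UNIV (\<lambda>x. cmod (f x))" using f by (intro continuous_intros)
  have i: "(\<lambda>x. cmod (f x)) integrable_on {0..y}" "f integrable_on {0..y}" for y
    using continuous_on_subset[OF c] continuous_on_subset[OF f] by (auto intro!: integrable_continuous_real)
  have "cmod (integral {0..x} f) \<le> integral {0..x} (\<lambda>x. cmod (f x))"
    by (rule integral_norm_bound_integral) (use i in auto)
  also have "\<dots> \<le> integral {0..L} (\<lambda>x. cmod (f x))"
    using x by (intro integral_subset_le i) auto
  also have "\<dots> = (LINT x|lebesgue_on {0<..<L}. cmod (f x))"
    by (simp add: integral_interval_continuous(2)[OF c])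
  also have "\<dots> \<le> sqrt L * nrm L f" by (rule norm_integral_le[OF L L2_continuous[OF f]])
  finally show ?thesis .
qed

text \<open>A primitive of a compactly supported function of mean zero is again compactly supported. It need not vanish
  on the gaps near \<open>P\<close>, where it is only constant; that is why just its derivative is flat
  there.\<close>

lemma tests_antiderivative:
  assumes L: "L > 0" and \<theta>: "\<theta> \<in> tests L P" and mean: "(LINT x|lebesgue_on {0<..<L}. \<theta> x) = 0"
  obtains \<psi> where "\<psi> \<in> test_functions L" "vd \<psi> = \<theta>" "nrm L \<psi> \<le> L * nrm L \<theta>"
proof -
  obtain K where K: "compact K" "K \<subseteq> {0<..<L} - P" "\<And>x. x \<notin> K \<Longrightarrow> \<theta> x = 0"
    using \<theta> unfolding tests_def by blast
  have c: "continuous_on UNIV \<theta>" using \<theta> by (rule tests_continuous)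
  have z: "\<theta> x = 0" if "x \<le> 0" for x using K that by (metis Diff_iff greaterThanLessThan_iff not_le subsetD)
  obtain \<psi> where \<psi>: "C1 \<psi> \<theta>" "\<And>x. x \<le> 0 \<Longrightarrow> \<psi> x = 0" "\<And>x. \<psi> x = integral {0..x} \<theta>"
    using antiderivative[OF c z] by blast
  have s: "smooth \<psi>" using smoothI_derivative[OF C1_derivative[OF \<psi>(1)] tests_smooth[OF \<theta>]] .
  obtain l r where lr: "0 < l" "l < r" "r < L" "K \<subseteq> {l..r}"
  proof (cases "K = {}")
    case True then show ?thesis using L that[of "L/3" "L/2"] by auto
  next
    case False
    obtain l where l: "l \<in> K" "\<forall>x\<in>K. l \<le> x" using compact_attains_inf[OF K(1) False] by blast
    obtain r where r: "r \<in> K" "\<forall>x\<in>K. x \<le> r" using compact_attains_sup[OF K(1) False] by blast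
    have "0 < l" "r < L" "l \<le> r" using l r K(2) by auto
    then show ?thesis using l r by (intro that[of l "(r+L)/2"]) force+
  qed
  have L0: "\<psi> L = 0"
    using integral_interval_derivative[OF _ C1_derivative[OF \<psi>(1)] c, of L] L mean \<psi>(2)[of 0] by simp
  have "\<psi> x = 0" if "x \<notin> {l..r}" for x
  proof -
    have const: "\<psi> x = \<psi> y" if S: "convex S" and xy: "x \<in> S" "y \<in> S" and SK: "S \<inter> K = {}" for S y
    proof -
      have d: "(\<psi> has_vector_derivative 0) (at x within S)" if "x \<in> S" for x
      proof -
        have "\<theta> x = 0" using K(3)[of x] that SK by blast
        then show ?thesis using has_vector_derivative_at_within[OF C1_derivative[OF \<psi>(1), of x]] by simp
      qed
      obtain c where "\<And>x. x \<in> S \<Longrightarrow> \<psi> x = c"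
        by (rule has_vector_derivative_zero_constant[OF S d]) auto
      then show ?thesis using xy by simp
    qed
    show ?thesis
    proof (cases "x < l")
      case True
      have "\<psi> x = \<psi> 0" by (rule const[of "{..<l}"]) (use True lr in auto)
      then show ?thesis using \<psi>(2)[of 0] by simp
    next
      case False
      then have "x > r" using that by simp
      have "\<psi> x = \<psi> L" by (rule const[of "{r<..}"]) (use \<open>x > r\<close> lr in auto)
      then show ?thesis using L0 by simp
    qed
  qed
  then have "\<psi> \<in> test_functions L" unfolding test_functions_eq
    using s lr by (intro testsI_closed[where K="{l..r}"]) auto
  moreover have "vd \<psi> = \<theta>" by (rule vd_eqI[OF C1_derivative[OF \<psi>(1)]])
  moreover have "nrm L \<psi> \<le> sqrt L * (sqrt L * nrm L \<theta>)"
  proof (rule nrm_bounded)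
    show "\<psi> \<in> L2 L" using C1_continuous[OF \<psi>(1)] by (rule L2_continuous)
    show "cmod (\<psi> x) \<le> sqrt L * nrm L \<theta>" if "x \<in> {0<..<L}" for x
      unfolding \<psi>(3) using that L by (intro antiderivative_bound c) auto
  qed (use L in auto)
  moreover have "sqrt L * (sqrt L * nrm L \<theta>) = L * nrm L \<theta>"
    using L by (simp add: mult.assoc[symmetric])
  ultimately show ?thesis using that[of \<psi>] by simp
qed

lemma ip_eq_Re_integral:
  assumes "f \<in> L2 L" "g \<in> L2 L"
  shows "integrable (lebesgue_on {0<..<L}) (\<lambda>x. f x * cnj (g x))"
    "ip L f g = Re (LINT x|lebesgue_on {0<..<L}. f x * cnj (g x))"
proof -
  show i: "integrable (lebesgue_on {0<..<L}) (\<lambda>x. f x * cnj (g x))"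
  proof (rule Bochner_Integration.integrable_bound[OF L2_integrable_product[OF assms]])
    show "(\<lambda>x. f x * cnj (g x)) \<in> borel_measurable (lebesgue_on {0<..<L})"
      using assms L2_measurable by measurable
  qed (auto simp: norm_mult)
  show "ip L f g = Re (LINT x|lebesgue_on {0<..<L}. f x * cnj (g x))"
    unfolding wip_def by (subst integral_Re[OF i, symmetric]) simp
qed

lemma L2_inner_Re: "f \<in> L2 L \<Longrightarrow> g \<in> L2 L \<Longrightarrow> Re (L2_inner L f g) = ip L f g"
  by (simp add: L2_inner_def ip_eq_Re_integral)

text \<open>The real part of the defining identity suffices: test functions may be conjugated, and multiplied by complex
  constants, which recovers the imaginary part.\<close>

lemma has_weak_derivative_iff:
  "has_weak_derivative L f g \<longleftrightarrow> f \<in> L2 L \<and> g \<in> L2 L \<and>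
     (\<forall>\<phi>\<in>test_functions L. ip L f (vd \<phi>) = - ip L g \<phi>)" (is "?l \<longleftrightarrow> ?r")
proof
  assume l: ?l
  then have fg: "f \<in> L2 L" "g \<in> L2 L" by (auto simp: has_weak_derivative_def)
  have "ip L f (vd \<phi>) = - ip L g \<phi>" if \<phi>: "\<phi> \<in> test_functions L" for \<phi>
  proof -
    have \<phi>': "\<phi> \<in> tests L {}" using \<phi> by (simp add: test_functions_eq)
    note c = tests_cnj[OF \<phi>']
    have L2: "\<phi> \<in> L2 L" "vd \<phi> \<in> L2 L" using tests_L2 \<phi>' tests_vd by blast+
    have "(LINT x|lebesgue_on {0<..<L}. f x * cnj (vd \<phi> x)) = - (LINT x|lebesgue_on {0<..<L}. g x * cnj (\<phi> x))"
    proof -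
      have "(\<lambda>x. cnj (\<phi> x)) \<in> test_functions L" using c(1) by (simp add: test_functions_eq)
      then have "(LINT x|lebesgue_on {0<..<L}. f x * vd (\<lambda>x. cnj (\<phi> x)) x) = - (LINT x|lebesgue_on {0<..<L}. g x * cnj (\<phi> x))"
        using l unfolding has_weak_derivative_def by blast
      then show ?thesis unfolding fun_cong[OF c(2), simplified] .
    qed
    then show ?thesis using fg L2 by (simp add: ip_eq_Re_integral)
  qed
  then show ?r using fg by blast
next
  assume r: ?r
  then have fg: "f \<in> L2 L" "g \<in> L2 L" by auto
  have "(LINT x|lebesgue_on {0<..<L}. f x * vd \<phi> x) = - (LINT x|lebesgue_on {0<..<L}. g x * \<phi> x)"
    if \<phi>: "\<phi> \<in> test_functions L" for \<phi>
  proof -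
    have \<phi>': "\<phi> \<in> tests L {}" using \<phi> by (simp add: test_functions_eq)
    have key: "Re (k * (LINT x|lebesgue_on {0<..<L}. f x * vd \<phi> x)) = Re (k * - (LINT x|lebesgue_on {0<..<L}. g x * \<phi> x))" for k
    proof -
      define \<psi> where "\<psi> = (\<lambda>x. cnj k * cnj (\<phi> x))"
      have \<psi>: "\<psi> \<in> tests L {}" unfolding \<psi>_def using tests_cnj(1)[OF \<phi>'] by (rule tests_cmult)
      have vd: "vd \<psi> = (\<lambda>x. cnj k * cnj (vd \<phi> x))"
      proof (rule vd_eqI)
        fix x
        have "((\<lambda>x. cnj (\<phi> x)) has_vector_derivative cnj (vd \<phi> x)) (at x)"
          using smooth_has_vector_derivative[OF tests_smooth[OF tests_cnj(1)[OF \<phi>']], of x]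
          unfolding fun_cong[OF tests_cnj(2)[OF \<phi>'], simplified] .
        then show "(\<psi> has_vector_derivative cnj k * cnj (vd \<phi> x)) (at x)"
          unfolding \<psi>_def by (rule has_vector_derivative_mult_right)
      qed
      have L2: "\<psi> \<in> L2 L" "vd \<psi> \<in> L2 L" using tests_L2 \<psi> tests_vd by blast+
      have "ip L f (vd \<psi>) = - ip L g \<psi>" using r \<psi> by (simp add: test_functions_eq)
      then have "Re (LINT x|lebesgue_on {0<..<L}. f x * cnj (vd \<psi> x)) = - Re (LINT x|lebesgue_on {0<..<L}. g x * cnj (\<psi> x))"
        using fg L2 by (simp add: ip_eq_Re_integral)
      moreover have "(LINT x|lebesgue_on {0<..<L}. f x * cnj (vd \<psi> x)) = k * (LINT x|lebesgue_on {0<..<L}. f x * vd \<phi> x)"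
        using fun_cong[OF vd] by (simp add: mult.left_commute)
      moreover have "(LINT x|lebesgue_on {0<..<L}. g x * cnj (\<psi> x)) = k * (LINT x|lebesgue_on {0<..<L}. g x * \<phi> x)"
        unfolding \<psi>_def by (simp add: mult.left_commute)
      ultimately show ?thesis by simp
    qed
    show ?thesis using key[of 1] key[of "- \<i>"] by (simp add: complex_eq_iff)
  qed
  then show ?l using fg by (simp add: has_weak_derivative_def)
qed

lemma hwd_L2: "has_weak_derivative L f g \<Longrightarrow> f \<in> L2 L" "has_weak_derivative L f g \<Longrightarrow> g \<in> L2 L"
  by (auto simp: has_weak_derivative_def)

section \<open>Sobolev functions on an interval\<close>

lemma test_L2: "\<phi> \<in> test_functions L \<Longrightarrow> \<phi> \<in> L2 L" "\<phi> \<in> test_functions L \<Longrightarrow> vd \<phi> \<in> L2 L"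
  unfolding test_functions_eq by (blast intro: tests_L2 tests_vd)+

text \<open>Norm bounds by duality: it is enough to test \<open>k\<close> against functions \<open>\<theta>\<close> that
  approximate \<open>k\<close> itself, because then \<open>ip L k \<theta>\<close> is close to the squared
  norm.\<close>

lemma nrm_le_if_dense:
  assumes L: "L > 0" and k: "k \<in> L2 L" and B: "0 \<le> B"
    and bound: "\<And>\<delta>. \<delta> > 0 \<Longrightarrow> \<exists>\<theta>\<in>L2 L. nrm L (\<lambda>x. k x - \<theta> x) < \<delta> \<and> ip L k \<theta> \<le> B * nrm L \<theta>"
  shows "nrm L k \<le> B"
proof (rule ccontr)
  assume "\<not> nrm L k \<le> B"
  then have N: "nrm L k > B" by simp
  define X where "X = nrm L k * (nrm L k - B)"
  \<comment> \<open>With this choice the approximation errors consume only half of the excess \<open>X\<close>.\<close>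
  define \<delta> where "\<delta> = X / 2 / (nrm L k + B)"
  have X: "X > 0" using N B unfolding X_def by (intro mult_pos_pos) auto
  then have "\<delta> > 0" using N B unfolding \<delta>_def by (intro divide_pos_pos) auto
  then obtain \<theta> where \<theta>: "\<theta> \<in> L2 L" "nrm L (\<lambda>x. k x - \<theta> x) < \<delta>" "ip L k \<theta> \<le> B * nrm L \<theta>"
    using bound by blast
  have "(nrm L k)\<^sup>2 = ip L k (\<lambda>x. k x - \<theta> x) + ip L k \<theta>"
    using k \<theta> by (simp add: nrm_power2 wip_linear)
  also have "ip L k (\<lambda>x. k x - \<theta> x) \<le> nrm L k * \<delta>"
    using ip_Cauchy_Schwarz[OF k L2_diff[OF k \<theta>(1)]] mult_left_mono[OF less_imp_le[OF \<theta>(2)], of "nrm L k"] by simp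
  also have "ip L k \<theta> \<le> B * (nrm L k + \<delta>)"
  proof -
    have "nrm L \<theta> \<le> nrm L (\<lambda>x. \<theta> x - k x) + nrm L k" by (rule nrm_triangle_diff[OF \<theta>(1) k])
    then have "nrm L \<theta> \<le> nrm L k + \<delta>" using \<theta>(2) nrm_diff_commute[of L \<theta> k] by simp
    from mult_left_mono[OF this B] show ?thesis using \<theta>(3) by linarith
  qed
  finally have "(nrm L k)\<^sup>2 \<le> nrm L k * B + (nrm L k + B) * \<delta>" by (simp add: algebra_simps)
  also have "(nrm L k + B) * \<delta> = X / 2"
  proof -
    have "nrm L k + B \<noteq> 0" using N B by linarith
    then show ?thesis unfolding \<delta>_def by (metis nonzero_mult_div_cancel_left times_divide_eq_right)
  qed
  finally have "X \<le> X / 2" unfolding X_def power2_eq_square right_diff_distrib by linarith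
  then show False using X by linarith
qed

lemma nrm_zero_if_orthogonal_tests:
  assumes L: "L > 0" and k: "k \<in> L2 L" and orth: "\<And>\<phi>. \<phi> \<in> test_functions L \<Longrightarrow> ip L k \<phi> = 0"
  shows "nrm L k = 0"
proof -
  have "nrm L k \<le> 0"
  proof (rule nrm_le_if_dense[OF L k])
    fix \<delta> :: real assume "\<delta> > 0"
    then obtain \<phi> where "\<phi> \<in> tests L {}" "nrm L (\<lambda>x. k x - \<phi> x) < \<delta>" using tests_dense_obtain[OF L finite.emptyI k] by blast
    then show "\<exists>\<theta>\<in>L2 L. nrm L (\<lambda>x. k x - \<theta> x) < \<delta> \<and> ip L k \<theta> \<le> 0 * nrm L \<theta>"
      using tests_L2 orth[of \<phi>] by (auto simp: test_functions_eq)
  qed simp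
  then show ?thesis using nrm_nonneg[of L k] by linarith
qed

lemma hwd_unique:
  assumes L: "L > 0" and 1: "has_weak_derivative L f g" and 2: "has_weak_derivative L f h"
  shows "AE x in lebesgue_on {0<..<L}. g x = h x"
proof -
  have gh: "(\<lambda>x. g x - h x) \<in> L2 L" using 1 2 hwd_L2 by blast
  have "nrm L (\<lambda>x. g x - h x) = 0"
  proof (rule nrm_zero_if_orthogonal_tests[OF L gh])
    fix \<phi> assume \<phi>: "\<phi> \<in> test_functions L"
    then have "\<phi> \<in> L2 L" using tests_L2 by (auto simp: test_functions_eq)
    then show "ip L (\<lambda>x. g x - h x) \<phi> = 0"
      using 1 2 \<phi> hwd_L2[OF 1] hwd_L2[OF 2] by (simp add: wip_linear has_weak_derivative_iff)
  qed
  then show ?thesis using nrm_zero_iff[OF gh] by simp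
qed

lemma hwd_cong_AE:
  assumes 1: "has_weak_derivative L f g" and f': "f' \<in> L2 L" "AE x in lebesgue_on {0<..<L}. f x = f' x"
    and g': "g' \<in> L2 L" "AE x in lebesgue_on {0<..<L}. g x = g' x"
  shows "has_weak_derivative L f' g'"
  unfolding has_weak_derivative_iff
proof (intro conjI ballI f' g')
  fix \<phi> assume \<phi>: "\<phi> \<in> test_functions L"
  note t = test_L2[OF \<phi>]
  have "ip L f' (vd \<phi>) = ip L f (vd \<phi>)" using f'(2) hwd_L2[OF 1] f'(1) t by (intro wip_cong_AE) auto
  moreover have "ip L g' \<phi> = ip L g \<phi>" using g'(2) hwd_L2[OF 1] g'(1) t by (intro wip_cong_AE) auto
  ultimately show "ip L f' (vd \<phi>) = - ip L g' \<phi>" using 1 \<phi> by (simp add: has_weak_derivative_iff)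
qed

lemma hwd_add:
  assumes 1: "has_weak_derivative L f f'" and 2: "has_weak_derivative L g g'"
  shows "has_weak_derivative L (\<lambda>x. f x + g x) (\<lambda>x. f' x + g' x)"
  unfolding has_weak_derivative_iff
proof (intro conjI ballI)
  fix \<phi> assume \<phi>: "\<phi> \<in> test_functions L"
  note t = test_L2[OF \<phi>]
  then show "ip L (\<lambda>x. f x + g x) (vd \<phi>) = - ip L (\<lambda>x. f' x + g' x) \<phi>"
    using hwd_L2[OF 1] hwd_L2[OF 2] 1 2 \<phi> by (simp add: wip_linear has_weak_derivative_iff)
qed (use hwd_L2[OF 1] hwd_L2[OF 2] in auto)

lemma hwd_cmult:
  assumes 1: "has_weak_derivative L f f'"
  shows "has_weak_derivative L (\<lambda>x. k * f x) (\<lambda>x. k * f' x)"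
  using 1 unfolding has_weak_derivative_def by (auto simp: mult.assoc)

lemma hwd_diff:
  assumes 1: "has_weak_derivative L f f'" and 2: "has_weak_derivative L g g'"
  shows "has_weak_derivative L (\<lambda>x. f x - g x) (\<lambda>x. f' x - g' x)"
  using hwd_add[OF 1 hwd_cmult[OF 2, of "-1"]] by simp

lemma hwd_C1:
  assumes L: "L \<ge> 0" and F: "C1 F F'"
  shows "has_weak_derivative L F F'"
  unfolding has_weak_derivative_iff
proof (intro conjI ballI)
  show "F \<in> L2 L" "F' \<in> L2 L" using F C1_continuous C1_continuous' L2_continuous by blast+
  fix \<phi> assume "\<phi> \<in> test_functions L"
  then have \<phi>: "\<phi> \<in> tests L {}" by (simp add: test_functions_eq)
  then obtain K where "K \<subseteq> {0<..<L}" "\<forall>x. x \<notin> K \<longrightarrow> \<phi> x = 0" unfolding tests_def by blast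
  then have "\<phi> 0 = 0" "\<phi> L = 0" by auto
  then show "ip L F (vd \<phi>) = - ip L F' \<phi>"
    using C1_ibp[OF L C1_const F C1_smooth[OF tests_smooth[OF \<phi>]], of 1] by (simp add: wip_def)
qed

lemma hwd_test:
  assumes "L \<ge> 0" "\<phi> \<in> test_functions L" shows "has_weak_derivative L \<phi> (vd \<phi>)"
  using assms by (intro hwd_C1 C1_smooth) (auto simp: test_functions_eq tests_smooth)

lemma test_mean_one:
  assumes L: "L > 0" and P: "finite P"
  obtains \<rho> where "\<rho> \<in> tests L P" "(LINT x|lebesgue_on {0<..<L}. \<rho> x) = 1"
proof -
  have "sqrt L / 2 > 0" using L by simp
  then obtain \<phi> where \<phi>: "\<phi> \<in> tests L P" "nrm L (\<lambda>x. 1 - \<phi> x) < sqrt L / 2"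
    using tests_dense_obtain[OF L P L2_const[of 1]] by blast
  define m where "m = (LINT x|lebesgue_on {0<..<L}. \<phi> x)"
  have \<phi>L: "\<phi> \<in> L2 L" by (rule tests_L2[OF \<phi>(1)])
  have "of_real L - m = (LINT x|lebesgue_on {0<..<L}. 1 - \<phi> x)"
    unfolding m_def using L2_integrable_1[OF \<phi>L] L2_integrable_1[OF L2_const[of 1 L]] L
    by (subst Bochner_Integration.integral_diff) (auto simp: measure_restrict_space scaleR_conv_of_real)
  then have "cmod (of_real L - m) \<le> sqrt L * nrm L (\<lambda>x. 1 - \<phi> x)"
    using norm_integral_le(2)[OF less_imp_le[OF L] L2_diff[OF L2_const \<phi>L], of 1] by (simp del: Bochner_Integration.integral_diff)
  also have "\<dots> \<le> sqrt L * (sqrt L / 2)" using \<phi>(2) L by (intro mult_left_mono) auto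
  also have "\<dots> < L" using L by simp
  finally have "m \<noteq> 0" using L by auto
  then show ?thesis
    using that[OF tests_cmult[OF \<phi>(1), of "1/m"]] by (simp add: m_def)
qed

text \<open>A dense approximation of \<open>k\<close> has a small mean, which is removed by subtracting a small multiple
  of one fixed flat function of mean one; the remainder is then the derivative of a test function.\<close>

lemma mean_zero_approx:
  assumes L: "L > 0" and P: "finite P" and k: "k \<in> L2 L" and mean: "(LINT x|lebesgue_on {0<..<L}. k x) = 0"
    and e: "e > 0"
  obtains \<psi> where "\<psi> \<in> test_functions L" "vd \<psi> \<in> tests L P" "nrm L (\<lambda>x. k x - vd \<psi> x) < e"
    "nrm L \<psi> \<le> L * nrm L (vd \<psi>)"
proof -
  obtain \<rho> where \<rho>: "\<rho> \<in> tests L P" "(LINT x|lebesgue_on {0<..<L}. \<rho> x) = 1" using test_mean_one[OF L P] by blast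
  \<comment> \<open>Correcting the mean increases the error by the factor \<open>1 + sqrt L * nrm L \<rho>\<close>.\<close>
  define \<delta> where "\<delta> = e / (1 + sqrt L * nrm L \<rho>)"
  have d1: "1 + sqrt L * nrm L \<rho> > 0" using L by (intro add_pos_nonneg mult_nonneg_nonneg) auto
  then have "\<delta> > 0" using e by (simp add: \<delta>_def)
  then obtain \<theta> where \<theta>: "\<theta> \<in> tests L P" "nrm L (\<lambda>x. k x - \<theta> x) < \<delta>" using tests_dense_obtain[OF L P k] by blast
  have L2: "\<theta> \<in> L2 L" "\<rho> \<in> L2 L" using tests_L2 \<theta> \<rho> by blast+
  define m where "m = (LINT x|lebesgue_on {0<..<L}. \<theta> x)"
  have "- m = (LINT x|lebesgue_on {0<..<L}. k x - \<theta> x)"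
    unfolding m_def using L2_integrable_1[OF k] L2_integrable_1[OF L2(1)] mean
    by (subst Bochner_Integration.integral_diff) auto
  then have m: "cmod m \<le> sqrt L * nrm L (\<lambda>x. k x - \<theta> x)"
    using norm_integral_le(2)[OF less_imp_le[OF L] L2_diff[OF k L2(1)]] by (metis norm_minus_cancel)
  define \<eta> where "\<eta> = (\<lambda>x. \<theta> x - m * \<rho> x)"
  have \<eta>: "\<eta> \<in> tests L P" unfolding \<eta>_def by (intro tests_diff tests_cmult \<theta> \<rho>)
  have "(LINT x|lebesgue_on {0<..<L}. \<eta> x) = m - m * 1"
    unfolding \<eta>_def \<rho>(2)[symmetric] using L2_integrable_1[OF L2(1)] L2_integrable_1[OF L2(2)]
    by (subst Bochner_Integration.integral_diff) (auto simp: m_def)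
  then obtain \<psi> where \<psi>: "\<psi> \<in> test_functions L" "vd \<psi> = \<eta>" "nrm L \<psi> \<le> L * nrm L \<eta>"
    using tests_antiderivative[OF L \<eta>] by auto
  have "nrm L (\<lambda>x. (k x - \<theta> x) + m * \<rho> x) \<le> nrm L (\<lambda>x. k x - \<theta> x) + nrm L (\<lambda>x. m * \<rho> x)"
    using k L2 by (intro nrm_triangle) auto
  also have "\<dots> \<le> nrm L (\<lambda>x. k x - \<theta> x) + sqrt L * nrm L (\<lambda>x. k x - \<theta> x) * nrm L \<rho>"
    using m by (simp add: nrm_cmult mult_right_mono)
  also have "\<dots> = nrm L (\<lambda>x. k x - \<theta> x) * (1 + sqrt L * nrm L \<rho>)" by (simp add: algebra_simps)
  also have "\<dots> < \<delta> * (1 + sqrt L * nrm L \<rho>)" using \<theta>(2) d1 by (rule mult_strict_right_mono)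
  also have "\<dots> = e" using d1 by (simp add: \<delta>_def)
  finally have "nrm L (\<lambda>x. k x - \<eta> x) < e" by (simp add: \<eta>_def algebra_simps)
  then show ?thesis using \<psi> \<eta> by (intro that[of \<psi>]) (simp_all add: fun_cong[OF \<psi>(2), simplified])
qed

text \<open>The Poincare--Wirtinger inequality follows by duality: after subtraction of its mean, \<open>f\<close> is
  approximated by derivatives of test functions \<open>\<psi>\<close>, and pairing \<open>f\<close> with the
  derivative of \<open>\<psi>\<close> is pairing \<open>g\<close> with \<open>-\<psi>\<close>.\<close>

lemma Wirtinger:
  assumes L: "L > 0" and fg: "has_weak_derivative L f g"
  obtains \<mu> where "nrm L (\<lambda>x. f x - \<mu>) \<le> L * nrm L g"
proof -
  have f: "f \<in> L2 L" and g: "g \<in> L2 L" using hwd_L2[OF fg] by auto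
  define \<mu> where "\<mu> = (LINT x|lebesgue_on {0<..<L}. f x) / of_real L"
  define k where "k = (\<lambda>x. f x - \<mu>)"
  have k: "k \<in> L2 L" unfolding k_def using f by auto
  have mean: "(LINT x|lebesgue_on {0<..<L}. k x) = 0"
    unfolding k_def using L2_integrable_1[OF f] L2_integrable_1[OF L2_const[of \<mu> L]] L
    by (subst Bochner_Integration.integral_diff) (auto simp: measure_restrict_space \<mu>_def scaleR_conv_of_real)
  have kg: "has_weak_derivative L k g"
    using hwd_diff[OF fg hwd_C1[OF less_imp_le[OF L] C1_const[of \<mu>]]] by (simp add: k_def)
  have "nrm L k \<le> L * nrm L g"
  proof (rule nrm_le_if_dense[OF L k])
    fix \<delta> :: real assume "\<delta> > 0"
    then obtain \<psi> where \<psi>: "\<psi> \<in> test_functions L" "vd \<psi> \<in> tests L {}" "nrm L (\<lambda>x. k x - vd \<psi> x) < \<delta>"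
        "nrm L \<psi> \<le> L * nrm L (vd \<psi>)"
      using mean_zero_approx[OF L finite.emptyI k mean \<open>\<delta> > 0\<close>] by blast
    have \<psi>L: "\<psi> \<in> L2 L" by (rule test_L2(1)[OF \<psi>(1)])
    have "ip L k (vd \<psi>) = - ip L g \<psi>" using kg \<psi>(1) by (simp add: has_weak_derivative_iff)
    also have "\<dots> \<le> nrm L g * nrm L \<psi>" using ip_Cauchy_Schwarz[OF g \<psi>L] by simp
    also have "\<dots> \<le> nrm L g * (L * nrm L (vd \<psi>))" using \<psi>(4) by (intro mult_left_mono) auto
    finally show "\<exists>\<theta>\<in>L2 L. nrm L (\<lambda>x. k x - \<theta> x) < \<delta> \<and> ip L k \<theta> \<le> L * nrm L g * nrm L \<theta>"
      using \<psi> tests_L2[OF \<psi>(2)] by (intro bexI[of _ "vd \<psi>"]) (auto simp: mult_ac)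
  qed (use L in auto)
  then show ?thesis using that[of \<mu>] by (simp add: k_def)
qed

text \<open>The approximation of \<open>g\<close> by a test function is integrated; the Wirtinger inequality bounds the
  error of the primitive up to a constant, which is added to it.\<close>

lemma H1_approx_C1:
  assumes L: "L > 0" and fg: "has_weak_derivative L f g" and e: "e > 0"
  obtains F F' where "C1 F F'" "nrm L (\<lambda>x. F x - f x) < e" "nrm L (\<lambda>x. F' x - g x) < e"
proof -
  have f: "f \<in> L2 L" and g: "g \<in> L2 L" using hwd_L2[OF fg] by auto
  define \<delta> where "\<delta> = e / (1 + L)"
  have \<delta>: "\<delta> > 0" "L * \<delta> < e" "\<delta> < e" using L e by (auto simp: \<delta>_def field_simps)
  obtain \<eta> where \<eta>: "\<eta> \<in> tests L {}" "nrm L (\<lambda>x. g x - \<eta> x) < \<delta>" using tests_dense_obtain[OF L finite.emptyI g \<delta>(1)] by blast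
  have c: "continuous_on UNIV \<eta>" using \<eta>(1) by (rule tests_continuous)
  have z: "\<eta> x = 0" if "x \<le> 0" for x
  proof -
    obtain K where "K \<subseteq> {0<..<L} - {}" "\<forall>x. x \<notin> K \<longrightarrow> \<eta> x = 0" using \<eta>(1) unfolding tests_def by blast
    moreover have "x \<notin> {0<..<L}" using that by simp
    ultimately show ?thesis by blast
  qed
  obtain G where G: "C1 G \<eta>" by (rule antiderivative[OF c z])
  obtain \<mu> where \<mu>: "nrm L (\<lambda>x. f x - G x - \<mu>) \<le> L * nrm L (\<lambda>x. g x - \<eta> x)"
    using Wirtinger[OF L hwd_diff[OF fg hwd_C1[OF less_imp_le[OF L] G]]] by blast
  have "C1 (\<lambda>x. G x + \<mu>) \<eta>" using C1_add[OF G C1_const[of \<mu>]] by simp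
  moreover have "nrm L (\<lambda>x. (G x + \<mu>) - f x) < e"
  proof -
    have "nrm L (\<lambda>x. (G x + \<mu>) - f x) = nrm L (\<lambda>x. f x - (G x + \<mu>))" by (rule nrm_diff_commute)
    also have "\<dots> \<le> L * nrm L (\<lambda>x. g x - \<eta> x)" using \<mu> by (simp add: diff_diff_eq)
    also have "\<dots> \<le> L * \<delta>" using \<eta>(2) L by (intro mult_left_mono) auto
    finally show ?thesis using \<delta> by simp
  qed
  moreover have "nrm L (\<lambda>x. \<eta> x - g x) < e" using \<eta>(2) \<delta> nrm_diff_commute[of L \<eta> g] by simp
  ultimately show ?thesis using that by blast
qed

lemma H1_approx_C1_seq:
  assumes L: "L > 0" and fg: "has_weak_derivative L f g"
  obtains F F' where "\<And>n::nat. C1 (F n) (F' n)" "(\<lambda>n. nrm L (\<lambda>x. F n x - f x)) \<longlonglongrightarrow> 0"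
    "(\<lambda>n. nrm L (\<lambda>x. F' n x - g x)) \<longlonglongrightarrow> 0"
proof -
  have "\<exists>F F'. C1 F F' \<and> nrm L (\<lambda>x. F x - f x) < 1 / real (Suc n) \<and> nrm L (\<lambda>x. F' x - g x) < 1 / real (Suc n)" for n
  proof -
    have "0 < 1 / real (Suc n)" by simp
    from H1_approx_C1[OF L fg this] show ?thesis by blast
  qed
  then obtain F F' where F: "\<And>n. C1 (F n) (F' n)" "\<And>n. nrm L (\<lambda>x. F n x - f x) < 1 / real (Suc n)"
    "\<And>n. nrm L (\<lambda>x. F' n x - g x) < 1 / real (Suc n)" by metis
  have lim: "(\<lambda>n. a n) \<longlonglongrightarrow> 0" if "\<And>n. 0 \<le> a n" "\<And>n. a n < 1 / real (Suc n)" for a :: "nat \<Rightarrow> real"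
    by (rule tendsto_sandwich[OF _ _ tendsto_const LIMSEQ_Suc[OF lim_1_over_n]])
       (use that less_imp_le in \<open>auto intro!: always_eventually\<close>)
  show ?thesis by (rule that[OF F(1) lim[OF nrm_nonneg F(2)] lim[OF nrm_nonneg F(3)]])
qed

text \<open>The identity passes to the limit from functions of class C1. It holds in \<open>H\<^sup>1\<close> without
  boundary conditions, since the vanishing of the weight at both ends removes the boundary terms.\<close>

lemma weak_ibp:
  assumes L: "L > 0" and q: "C1 q q'" "q 0 = 0" "q L = 0"
    and f: "has_weak_derivative L f f'" and g: "has_weak_derivative L g g'"
  shows "wip L q f' g + wip L q f g' + wip L q' f g = 0"
proof -
  obtain F F' where F: "\<And>n::nat. C1 (F n) (F' n)" "(\<lambda>n. nrm L (\<lambda>x. F n x - f x)) \<longlonglongrightarrow> 0"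
    "(\<lambda>n. nrm L (\<lambda>x. F' n x - f' x)) \<longlonglongrightarrow> 0" using H1_approx_C1_seq[OF L f] by blast
  obtain G G' where G: "\<And>n::nat. C1 (G n) (G' n)" "(\<lambda>n. nrm L (\<lambda>x. G n x - g x)) \<longlonglongrightarrow> 0"
    "(\<lambda>n. nrm L (\<lambda>x. G' n x - g' x)) \<longlonglongrightarrow> 0" using H1_approx_C1_seq[OF L g] by blast
  have w: "bounded_weight L q" "bounded_weight L q'"
    using q C1_continuous C1_continuous' bounded_weight_continuous by blast+
  have L2: "F n \<in> L2 L" "F' n \<in> L2 L" "G n \<in> L2 L" "G' n \<in> L2 L" for n
    using F(1)[of n] G(1)[of n] C1_continuous C1_continuous' L2_continuous by blast+
  have "(\<lambda>n. wip L q (F' n) (G n) + wip L q (F n) (G' n) + wip L q' (F n) (G n))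
     \<longlonglongrightarrow> wip L q f' g + wip L q f g' + wip L q' f g"
    by (rule tendsto_add[OF tendsto_add[OF
          wip_tendsto[OF w(1) L2(2,3) hwd_L2(2)[OF f] hwd_L2(1)[OF g] F(3) G(2)]
          wip_tendsto[OF w(1) L2(1,4) hwd_L2(1)[OF f] hwd_L2(2)[OF g] F(2) G(3)]]
          wip_tendsto[OF w(2) L2(1,3) hwd_L2(1)[OF f] hwd_L2(1)[OF g] F(2) G(2)]])
  moreover have "wip L q (F' n) (G n) + wip L q (F n) (G' n) + wip L q' (F n) (G n) = 0" for n
    using C1_ibp[OF less_imp_le[OF L] q(1) F(1) G(1)] q by simp
  ultimately have "(\<lambda>n. 0 :: real) \<longlonglongrightarrow> wip L q f' g + wip L q f g' + wip L q' f g" by simp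
  then show ?thesis by (simp add: LIMSEQ_const_iff)
qed

lemma H1_norm_eq:
  assumes "has_weak_derivative L f g" "L > 0"
  shows "H1_norm L f = sqrt ((nrm L f)\<^sup>2 + (nrm L g)\<^sup>2)"
proof -
  have w: "has_weak_derivative L f (wderiv L f)" unfolding wderiv_def by (rule someI[of "has_weak_derivative L f", OF assms(1)])
  have "nrm L (wderiv L f) = nrm L g"
    using hwd_unique[OF assms(2) w assms(1)] hwd_L2 w assms by (intro nrm_cong_AE) auto
  then show ?thesis using hwd_L2[OF w] unfolding H1_norm_def by (simp add: L2_inner_Re nrm_power2[symmetric])
qed

lemma wderiv_hwd:
  assumes "f \<in> H1 L" shows "has_weak_derivative L f (wderiv L f)"
proof -
  obtain g where "has_weak_derivative L f g" using assms unfolding H1_def by blast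
  then show ?thesis unfolding wderiv_def by (rule someI[of "has_weak_derivative L f"])
qed

text \<open>Membership in \<open>H10\<close> together with a chosen weak derivative \<open>g\<close>. Carrying
  \<open>g\<close> along avoids the arbitrary representative \<open>wderiv\<close> in computations.\<close>

definition H10_derivative :: "real \<Rightarrow> (real \<Rightarrow> complex) \<Rightarrow> (real \<Rightarrow> complex) \<Rightarrow> bool" where
  "H10_derivative L f g \<longleftrightarrow> has_weak_derivative L f g \<and> (\<exists>\<phi>. (\<forall>n::nat. \<phi> n \<in> test_functions L) \<and>
     (\<lambda>n. nrm L (\<lambda>x. \<phi> n x - f x)) \<longlonglongrightarrow> 0 \<and> (\<lambda>n. nrm L (\<lambda>x. vd (\<phi> n) x - g x)) \<longlonglongrightarrow> 0)"

lemma H10_derivative_hwd: "H10_derivative L f g \<Longrightarrow> has_weak_derivative L f g"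
  by (simp add: H10_derivative_def)

lemma sqrt_sum_tendsto_0_iff:
  fixes a b :: "nat \<Rightarrow> real"
  assumes "\<And>n. 0 \<le> a n" "\<And>n. 0 \<le> b n"
  shows "(\<lambda>n. sqrt ((a n)\<^sup>2 + (b n)\<^sup>2)) \<longlonglongrightarrow> 0 \<longleftrightarrow> a \<longlonglongrightarrow> 0 \<and> b \<longlonglongrightarrow> 0"
proof
  assume l: "(\<lambda>n. sqrt ((a n)\<^sup>2 + (b n)\<^sup>2)) \<longlonglongrightarrow> 0"
  have le: "a n \<le> sqrt ((a n)\<^sup>2 + (b n)\<^sup>2)" "b n \<le> sqrt ((a n)\<^sup>2 + (b n)\<^sup>2)" for n
    by (rule real_le_rsqrt, simp)+
  show "a \<longlonglongrightarrow> 0 \<and> b \<longlonglongrightarrow> 0"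
    by (intro conjI; rule tendsto_sandwich[OF _ _ tendsto_const l]) (simp_all add: assms le)
next
  assume "a \<longlonglongrightarrow> 0 \<and> b \<longlonglongrightarrow> 0"
  then have "(\<lambda>n. sqrt ((a n)\<^sup>2 + (b n)\<^sup>2)) \<longlonglongrightarrow> sqrt (0\<^sup>2 + 0\<^sup>2)" by (intro tendsto_intros) auto
  then show "(\<lambda>n. sqrt ((a n)\<^sup>2 + (b n)\<^sup>2)) \<longlonglongrightarrow> 0" by simp
qed

lemma H10_iff:
  assumes L: "L > 0" and f: "has_weak_derivative L f g"
  shows "f \<in> H10 L \<longleftrightarrow> H10_derivative L f g"
proof -
  have "f \<in> H1 L" using f by (auto simp: H1_def)
  moreover have "(\<lambda>n. H1_norm L (f - \<phi> n)) \<longlonglongrightarrow> 0 \<longleftrightarrow>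
     (\<lambda>n. nrm L (\<lambda>x. \<phi> n x - f x)) \<longlonglongrightarrow> 0 \<and> (\<lambda>n. nrm L (\<lambda>x. vd (\<phi> n) x - g x)) \<longlonglongrightarrow> 0"
    if "\<forall>n::nat. \<phi> n \<in> test_functions L" for \<phi>
  proof -
    have "H1_norm L (f - \<phi> n) = sqrt ((nrm L (\<lambda>x. \<phi> n x - f x))\<^sup>2 + (nrm L (\<lambda>x. vd (\<phi> n) x - g x))\<^sup>2)" for n
    proof -
      have "H1_norm L (\<lambda>x. f x - \<phi> n x) = sqrt ((nrm L (\<lambda>x. f x - \<phi> n x))\<^sup>2 + (nrm L (\<lambda>x. g x - vd (\<phi> n) x))\<^sup>2)"
        by (rule H1_norm_eq[OF hwd_diff[OF f hwd_test[OF less_imp_le[OF L]]] L]) (use that in blast)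
      moreover have "f - \<phi> n = (\<lambda>x. f x - \<phi> n x)" by (rule ext) simp
      ultimately show ?thesis
        by (simp only: nrm_diff_commute[of L f "\<phi> n"] nrm_diff_commute[of L g "vd (\<phi> n)"])
    qed
    then show ?thesis by (simp add: sqrt_sum_tendsto_0_iff)
  qed
  ultimately show ?thesis using f unfolding H10_def H10_derivative_def by blast
qed

lemma H10_wderiv:
  assumes "L > 0" "f \<in> H10 L" shows "H10_derivative L f (wderiv L f)"
proof -
  have "f \<in> H1 L" using assms(2) by (simp add: H10_def)
  from H10_iff[OF assms(1) wderiv_hwd[OF this]] show ?thesis using assms(2) by simp
qed

lemma H10_derivative_H10:
  assumes "L > 0" "H10_derivative L f g" shows "f \<in> H10 L"
  using H10_iff[OF assms(1) H10_derivative_hwd[OF assms(2)]] assms(2) by simp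

lemma H10_derivative_test: "L > 0 \<Longrightarrow> \<phi> \<in> test_functions L \<Longrightarrow> H10_derivative L \<phi> (vd \<phi>)"
  unfolding H10_derivative_def
  by (intro conjI hwd_test exI[of _ "\<lambda>n. \<phi>"]) (simp_all add: nrm_def wip_def)

lemma H10_derivative_cong_AE:
  assumes "H10_derivative L f g" and f': "f' \<in> L2 L" "AE x in lebesgue_on {0<..<L}. f x = f' x"
    and g': "g' \<in> L2 L" "AE x in lebesgue_on {0<..<L}. g x = g' x"
  shows "H10_derivative L f' g'"
proof -
  obtain \<phi> where \<phi>: "has_weak_derivative L f g" "\<forall>n::nat. \<phi> n \<in> test_functions L" 
     "(\<lambda>n. nrm L (\<lambda>x. \<phi> n x - f x)) \<longlonglongrightarrow> 0" "(\<lambda>n. nrm L (\<lambda>x. vd (\<phi> n) x - g x)) \<longlonglongrightarrow> 0"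
    using assms(1) unfolding H10_derivative_def by blast
  have t: "\<phi> n \<in> L2 L" "vd (\<phi> n) \<in> L2 L" for n
    using \<phi>(2) test_L2 by blast+
  have "nrm L (\<lambda>x. \<phi> n x - f' x) = nrm L (\<lambda>x. \<phi> n x - f x)" for n
    using t[of n] f' hwd_L2[OF \<phi>(1)] by (intro nrm_cong_AE L2_diff) auto
  moreover have "nrm L (\<lambda>x. vd (\<phi> n) x - g' x) = nrm L (\<lambda>x. vd (\<phi> n) x - g x)" for n
    using t[of n] g' hwd_L2[OF \<phi>(1)] by (intro nrm_cong_AE L2_diff) auto
  ultimately show ?thesis using hwd_cong_AE[OF \<phi>(1) f' g'] \<phi> unfolding H10_derivative_def by auto
qed

lemma H10_derivative_lincomb:
  assumes L: "L > 0" and 1: "H10_derivative L f f'" and 2: "H10_derivative L g g'"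
  shows "H10_derivative L (\<lambda>x. j * f x + k * g x) (\<lambda>x. j * f' x + k * g' x)"
proof -
  obtain \<phi> where \<phi>: "has_weak_derivative L f f'" "\<forall>n::nat. \<phi> n \<in> test_functions L" 
     "(\<lambda>n. nrm L (\<lambda>x. \<phi> n x - f x)) \<longlonglongrightarrow> 0" "(\<lambda>n. nrm L (\<lambda>x. vd (\<phi> n) x - f' x)) \<longlonglongrightarrow> 0"
    using 1 unfolding H10_derivative_def by blast
  obtain \<psi> where \<psi>: "has_weak_derivative L g g'" "\<forall>n::nat. \<psi> n \<in> test_functions L" 
     "(\<lambda>n. nrm L (\<lambda>x. \<psi> n x - g x)) \<longlonglongrightarrow> 0" "(\<lambda>n. nrm L (\<lambda>x. vd (\<psi> n) x - g' x)) \<longlonglongrightarrow> 0"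
    using 2 unfolding H10_derivative_def by blast
  have t: "\<phi> n \<in> L2 L" "vd (\<phi> n) \<in> L2 L" "\<psi> n \<in> L2 L" "vd (\<psi> n) \<in> L2 L" for n
    using \<phi>(2) \<psi>(2) test_L2 by blast+
  have vd: "vd (\<lambda>x. j * \<phi> n x + k * \<psi> n x) = (\<lambda>x. j * vd (\<phi> n) x + k * vd (\<psi> n) x)" for n
  proof -
    have "smooth (\<phi> n)" "smooth (\<psi> n)"
      using \<phi>(2) \<psi>(2) tests_smooth unfolding test_functions_eq by blast+
    then show ?thesis
      by (intro vd_eqI has_vector_derivative_add has_vector_derivative_mult_right smooth_has_vector_derivative)
  qed
  have lim: "(\<lambda>n. nrm L (\<lambda>x. (j * p n x + k * r n x) - (j * p' x + k * r' x))) \<longlonglongrightarrow> 0"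
    if L2: "\<And>n. p n \<in> L2 L" "p' \<in> L2 L" "\<And>n. r n \<in> L2 L" "r' \<in> L2 L"
      and l: "(\<lambda>n. nrm L (\<lambda>x. p n x - p' x)) \<longlonglongrightarrow> 0" "(\<lambda>n. nrm L (\<lambda>x. r n x - r' x)) \<longlonglongrightarrow> 0" for p r :: "nat \<Rightarrow> real \<Rightarrow> complex" and p' r'
  proof (rule Lim_null_comparison)
    show "\<forall>\<^sub>F n in sequentially. norm (nrm L (\<lambda>x. (j * p n x + k * r n x) - (j * p' x + k * r' x)))
       \<le> cmod j * nrm L (\<lambda>x. p n x - p' x) + cmod k * nrm L (\<lambda>x. r n x - r' x)"
    proof (intro always_eventually allI)
      fix n
      have "nrm L (\<lambda>x. j * (p n x - p' x) + k * (r n x - r' x)) \<le> nrm L (\<lambda>x. j * (p n x - p' x)) + nrm L (\<lambda>x. k * (r n x - r' x))"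
        using L2 by (intro nrm_triangle L2_cmult L2_diff) auto
      moreover have "(\<lambda>x. j * (p n x - p' x) + k * (r n x - r' x)) = (\<lambda>x. (j * p n x + k * r n x) - (j * p' x + k * r' x))"
        by (simp add: algebra_simps)
      ultimately show "norm (nrm L (\<lambda>x. (j * p n x + k * r n x) - (j * p' x + k * r' x)))
       \<le> cmod j * nrm L (\<lambda>x. p n x - p' x) + cmod k * nrm L (\<lambda>x. r n x - r' x)" by (simp add: nrm_cmult)
    qed
    show "(\<lambda>n. cmod j * nrm L (\<lambda>x. p n x - p' x) + cmod k * nrm L (\<lambda>x. r n x - r' x)) \<longlonglongrightarrow> 0"
      using tendsto_add[OF tendsto_mult_left[OF l(1), of "cmod j"] tendsto_mult_left[OF l(2), of "cmod k"]] by simp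
  qed
  show ?thesis unfolding H10_derivative_def
  proof (intro conjI exI[of _ "\<lambda>n x. j * \<phi> n x + k * \<psi> n x"] allI)
    show "has_weak_derivative L (\<lambda>x. j * f x + k * g x) (\<lambda>x. j * f' x + k * g' x)"
      by (intro hwd_add hwd_cmult \<phi> \<psi>)
    show "(\<lambda>x. j * \<phi> n x + k * \<psi> n x) \<in> test_functions L" for n
      using \<phi>(2) \<psi>(2) by (simp add: test_functions_eq tests_add tests_cmult)
    show "(\<lambda>n. nrm L (\<lambda>x. j * \<phi> n x + k * \<psi> n x - (j * f x + k * g x))) \<longlonglongrightarrow> 0"
      using t hwd_L2[OF \<phi>(1)] hwd_L2[OF \<psi>(1)] \<phi> \<psi> by (intro lim) auto
    show "(\<lambda>n. nrm L (\<lambda>x. vd (\<lambda>x. j * \<phi> n x + k * \<psi> n x) x - (j * f' x + k * g' x))) \<longlonglongrightarrow> 0"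
      using lim[of "\<lambda>n. vd (\<phi> n)" f' "\<lambda>n. vd (\<psi> n)" g'] t hwd_L2[OF \<phi>(1)] hwd_L2[OF \<psi>(1)] \<phi> \<psi>
      by (simp add: fun_cong[OF vd])
  qed
qed

lemma H10_ibp:
  assumes f: "has_weak_derivative L f f'" and g: "H10_derivative L g g'"
  shows "ip L f' g = - ip L f g'"
proof -
  obtain \<phi> where \<phi>: "has_weak_derivative L g g'" "\<forall>n::nat. \<phi> n \<in> test_functions L" 
     "(\<lambda>n. nrm L (\<lambda>x. \<phi> n x - g x)) \<longlonglongrightarrow> 0" "(\<lambda>n. nrm L (\<lambda>x. vd (\<phi> n) x - g' x)) \<longlonglongrightarrow> 0"
    using g unfolding H10_derivative_def by blast
  have t: "\<phi> n \<in> L2 L" "vd (\<phi> n) \<in> L2 L" for n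
    using \<phi>(2) test_L2 by blast+
  have z: "(\<lambda>n::nat. nrm L (\<lambda>x. h x - h x)) \<longlonglongrightarrow> 0" for h by (simp add: nrm_def wip_def)
  have "(\<lambda>n. ip L f' (\<phi> n)) \<longlonglongrightarrow> ip L f' g"
    by (rule wip_tendsto[OF bounded_weight_const hwd_L2(2)[OF f] t(1) hwd_L2(2)[OF f] hwd_L2(1)[OF \<phi>(1)] z \<phi>(3)])
  moreover have "(\<lambda>n. - ip L f (vd (\<phi> n))) \<longlonglongrightarrow> - ip L f g'"
    by (rule tendsto_minus[OF wip_tendsto[OF bounded_weight_const hwd_L2(1)[OF f] t(2) hwd_L2(1)[OF f] hwd_L2(2)[OF \<phi>(1)] z \<phi>(4)]])
  moreover have "ip L f' (\<phi> n) = - ip L f (vd (\<phi> n))" for n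
    using f \<phi>(2) by (simp add: has_weak_derivative_iff)
  ultimately show ?thesis by (simp add: LIMSEQ_unique)
qed

lemma test_Poincare:
  assumes L: "L > 0" and \<phi>: "\<phi> \<in> test_functions L"
  shows "nrm L \<phi> \<le> L * nrm L (vd \<phi>)"
proof -
  have \<phi>t: "\<phi> \<in> tests L {}" using \<phi> by (simp add: test_functions_eq)
  then have z: "\<phi> x = 0" if "x \<notin> {0<..<L}" for x using that unfolding tests_def by blast
  note C = C1_smooth[OF tests_smooth[OF \<phi>t]]
  have "nrm L \<phi> \<le> sqrt L * (sqrt L * nrm L (vd \<phi>))"
  proof (rule nrm_bounded)
    show "\<phi> \<in> L2 L" by (rule tests_L2[OF \<phi>t])
    fix x assume x: "x \<in> {0<..<L}"
    have "(vd \<phi> has_integral \<phi> x - \<phi> 0) {0..x}"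
      by (rule fundamental_theorem_of_calculus[OF _ has_vector_derivative_at_within[OF C1_derivative[OF C]]])
         (use x in auto)
    from integral_unique[OF this] have "\<phi> x = integral {0..x} (vd \<phi>)" using z[of 0] by simp
    moreover have "cmod (integral {0..x} (vd \<phi>)) \<le> sqrt L * nrm L (vd \<phi>)"
      by (rule antiderivative_bound[OF _ C1_continuous'[OF C]]) (use L x in auto)
    ultimately show "cmod (\<phi> x) \<le> sqrt L * nrm L (vd \<phi>)" by metis
  qed (use L in auto)
  also have "\<dots> = L * nrm L (vd \<phi>)" using L by (simp add: mult.assoc[symmetric])
  finally show ?thesis .
qed

lemma nrm_tendsto:
  assumes "\<And>n. f n \<in> L2 L" "g \<in> L2 L" "((\<lambda>n. nrm L (\<lambda>x. f n x - g x)) \<longlongrightarrow> 0) F"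
  shows "((\<lambda>n. nrm L (f n)) \<longlongrightarrow> nrm L g) F"
  unfolding nrm_def
  by (rule tendsto_real_sqrt[OF wip_tendsto[OF bounded_weight_const assms(1) assms(1) assms(2) assms(2) assms(3) assms(3)]])

lemma Poincare:
  assumes L: "L > 0" and f: "H10_derivative L f g"
  shows "nrm L f \<le> L * nrm L g"
proof -
  obtain \<phi> where \<phi>: "has_weak_derivative L f g" "\<forall>n::nat. \<phi> n \<in> test_functions L" 
     "(\<lambda>n. nrm L (\<lambda>x. \<phi> n x - f x)) \<longlonglongrightarrow> 0" "(\<lambda>n. nrm L (\<lambda>x. vd (\<phi> n) x - g x)) \<longlonglongrightarrow> 0"
    using f unfolding H10_derivative_def by blast
  have t: "\<phi> n \<in> L2 L" "vd (\<phi> n) \<in> L2 L" for n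
    using \<phi>(2) test_L2 by blast+
  have "(\<lambda>n. nrm L (\<phi> n)) \<longlonglongrightarrow> nrm L f"
    by (rule nrm_tendsto[OF t(1) hwd_L2(1)[OF \<phi>(1)] \<phi>(3)])
  moreover have "(\<lambda>n. L * nrm L (vd (\<phi> n))) \<longlonglongrightarrow> L * nrm L g"
    by (rule tendsto_mult_left[OF nrm_tendsto[OF t(2) hwd_L2(2)[OF \<phi>(1)] \<phi>(4)]])
  moreover have "\<forall>n\<ge>0. nrm L (\<phi> n) \<le> L * nrm L (vd (\<phi> n))" using test_Poincare[OF L] \<phi>(2) by blast
  ultimately show ?thesis by (blast intro: LIMSEQ_le)
qed

section \<open>Functions that are null on average in time\<close>

text \<open>For a nonnegative integrable \<open>f\<close> this implies that its average over long time intervals becomes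
  arbitrarily small. The formulation by derivatives avoids integrals over time, and with them any
  measurability in time.\<close>

definition null_on_average :: "(real \<Rightarrow> real) \<Rightarrow> bool" where
  "null_on_average f \<longleftrightarrow> (\<forall>e>0. \<exists>F F' C. (\<forall>t>0. \<bar>F t\<bar> \<le> C) \<and>
     (\<forall>t>0. (F has_real_derivative F' t) (at t)) \<and> (\<forall>t>0. f t \<le> e + F' t))"

lemma null_on_averageE:
  assumes "null_on_average f" "e > 0"
  obtains F F' C where "\<forall>t>0. \<bar>F t\<bar> \<le> C" "\<forall>t>0. (F has_real_derivative F' t) (at t)" "\<forall>t>0. f t \<le> e + F' t"
  using spec[OF assms(1)[unfolded null_on_average_def], of e, THEN mp, OF assms(2)]
  by (elim exE conjE) (rule that)

lemma null_mono:
  assumes "null_on_average g" "\<And>t. t > 0 \<Longrightarrow> f t \<le> g t" shows "null_on_average f"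
  unfolding null_on_average_def
proof (intro allI impI)
  fix e :: real assume "e > 0"
  then obtain F F' C where F: "\<forall>t>0. \<bar>F t\<bar> \<le> C" "\<forall>t>0. (F has_real_derivative F' t) (at t)" "\<forall>t>0. g t \<le> e + F' t"
    by (rule null_on_averageE[OF assms(1)])
  have le: "\<forall>t>0. f t \<le> e + F' t"
  proof (intro allI impI)
    fix t :: real assume t: "t > 0"
    have "g t \<le> e + F' t" using F(3) t by simp
    then show "f t \<le> e + F' t" by (rule order_trans[OF assms(2)[OF t]])
  qed
  show "\<exists>F F' C. (\<forall>t>0. \<bar>F t\<bar> \<le> C) \<and> (\<forall>t>0. (F has_real_derivative F' t) (at t)) \<and> (\<forall>t>0. f t \<le> e + F' t)"
    by (rule exI[of _ F], rule exI[of _ F'], rule exI[of _ C], intro conjI F le)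
qed

lemma null_derivative:
  assumes "\<And>t. t > 0 \<Longrightarrow> \<bar>F t\<bar> \<le> C" "\<And>t. t > 0 \<Longrightarrow> (F has_real_derivative F' t) (at t)"
  shows "null_on_average F'"
  unfolding null_on_average_def
proof (intro allI impI)
  fix e :: real assume "e > 0"
  then show "\<exists>F F'' C. (\<forall>t>0. \<bar>F t\<bar> \<le> C) \<and> (\<forall>t>0. (F has_real_derivative F'' t) (at t)) \<and> (\<forall>t>0. F' t \<le> e + F'' t)"
    by - (rule exI[of _ F], rule exI[of _ F'], rule exI[of _ C], intro conjI allI impI assms, simp_all)
qed

lemma null_add:
  assumes "null_on_average f" "null_on_average g" shows "null_on_average (\<lambda>t. f t + g t)"
  unfolding null_on_average_def
proof (intro allI impI)
  fix e :: real assume "e > 0"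
  then have e: "e/2 > 0" by simp
  obtain F F' C where F: "\<forall>t>0. \<bar>F t\<bar> \<le> C" "\<forall>t>0. (F has_real_derivative F' t) (at t)" "\<forall>t>0. f t \<le> e/2 + F' t"
    by (rule null_on_averageE[OF assms(1) e])
  obtain G G' D where G: "\<forall>t>0. \<bar>G t\<bar> \<le> D" "\<forall>t>0. (G has_real_derivative G' t) (at t)" "\<forall>t>0. g t \<le> e/2 + G' t"
    by (rule null_on_averageE[OF assms(2) e])
  show "\<exists>F F' C. (\<forall>t>0. \<bar>F t\<bar> \<le> C) \<and> (\<forall>t>0. (F has_real_derivative F' t) (at t)) \<and> (\<forall>t>0. f t + g t \<le> e + F' t)"
  proof (rule exI[of _ "\<lambda>t. F t + G t"], rule exI[of _ "\<lambda>t. F' t + G' t"], rule exI[of _ "C + D"], intro conjI allI impI)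
    fix t :: real assume t: "t > 0"
    have "\<bar>F t\<bar> \<le> C" "\<bar>G t\<bar> \<le> D" using F(1) G(1) t by simp_all
    then show "\<bar>F t + G t\<bar> \<le> C + D" by linarith
    show "((\<lambda>t. F t + G t) has_real_derivative F' t + G' t) (at t)" using F(2) G(2) t by (intro DERIV_add) auto
    have "f t \<le> e/2 + F' t" "g t \<le> e/2 + G' t" using F(3) G(3) t by simp_all
    then show "f t + g t \<le> e + (F' t + G' t)" by linarith
  qed
qed

lemma null_cmult:
  assumes "null_on_average f" "k \<ge> 0" shows "null_on_average (\<lambda>t. k * f t)"
proof (cases "k = 0")
  case True
  then show ?thesis using null_derivative[of "\<lambda>t. 0" 0 "\<lambda>t. 0"] by simp
next
  case False
  then have k: "k > 0" using assms by simp
  show ?thesis unfolding null_on_average_def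
  proof (intro allI impI)
    fix e :: real assume "e > 0"
    then have "e / k > 0" using k by simp
    then obtain F F' C where F: "\<forall>t>0. \<bar>F t\<bar> \<le> C" "\<forall>t>0. (F has_real_derivative F' t) (at t)" "\<forall>t>0. f t \<le> e/k + F' t"
      by (rule null_on_averageE[OF assms(1)])
    show "\<exists>F F' C. (\<forall>t>0. \<bar>F t\<bar> \<le> C) \<and> (\<forall>t>0. (F has_real_derivative F' t) (at t)) \<and> (\<forall>t>0. k * f t \<le> e + F' t)"
    proof (rule exI[of _ "\<lambda>t. k * F t"], rule exI[of _ "\<lambda>t. k * F' t"], rule exI[of _ "k * C"], intro conjI allI impI)
      fix t :: real assume t: "t > 0"
      show "\<bar>k * F t\<bar> \<le> k * C" using F(1) t k by (simp add: abs_mult)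
      show "((\<lambda>t. k * F t) has_real_derivative k * F' t) (at t)" using F(2) t by (intro DERIV_cmult) auto
      have "k * f t \<le> k * (e/k + F' t)" using F(3) t k by (intro mult_left_mono) auto
      then show "k * f t \<le> e + k * F' t" using k by (simp add: distrib_left)
    qed
  qed
qed

text \<open>How nullness propagates: a bound of the form delivered by Young's inequality, with a bounded part
  \<open>A\<close> that can be made negligible at the price of a large multiple of the null function
  \<open>g\<close>.\<close>

lemma null_young:
  assumes g: "null_on_average g" and A: "A \<ge> 0" and K: "K \<ge> 0"
    and le: "\<And>e t. e > 0 \<Longrightarrow> t > 0 \<Longrightarrow> f t \<le> e * A + (K / e) * g t"
  shows "null_on_average f"
  unfolding null_on_average_def
proof (intro allI impI)
  fix e :: real assume e: "e > 0"
  define d where "d = e / (2 * (A + 1))"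
  have d: "d > 0" "d * A \<le> e / 2" using e A by (auto simp: d_def field_simps)
  have "null_on_average (\<lambda>t. (K / d) * g t)" using g K d by (intro null_cmult) auto
  moreover have "e/2 > 0" using e by simp
  ultimately obtain F F' C where F: "\<forall>t>0. \<bar>F t\<bar> \<le> C" "\<forall>t>0. (F has_real_derivative F' t) (at t)" "\<forall>t>0. (K / d) * g t \<le> e/2 + F' t"
    by (rule null_on_averageE)
  have le: "f t \<le> e + F' t" if "t > 0" for t
  proof -
    have "f t \<le> d * A + (K / d) * g t" by (rule le[OF d(1) that])
    moreover have "(K / d) * g t \<le> e/2 + F' t" using F(3) that by blast
    ultimately show ?thesis using d(2) by linarith
  qed
  show "\<exists>F F' C. (\<forall>t>0. \<bar>F t\<bar> \<le> C) \<and> (\<forall>t>0. (F has_real_derivative F' t) (at t)) \<and> (\<forall>t>0. f t \<le> e + F' t)"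
    by (rule exI[of _ F], rule exI[of _ F'], rule exI[of _ C], intro conjI F allI impI le)
qed

text \<open>If a nonincreasing \<open>g\<close> stays above \<open>e\<close> up to time \<open>t\<close>, the bounded
  function \<open>F\<close> in the definition of nullness must grow at rate at least \<open>e/2\<close> on
  \<open>[1,t]\<close>, which bounds \<open>t\<close>.\<close>

lemma null_decreasing_tendsto_0:
  assumes null: "null_on_average g" and nonneg: "\<And>t. t > 0 \<Longrightarrow> g t \<ge> 0"
    and dec: "\<And>s t. 0 < s \<Longrightarrow> s \<le> t \<Longrightarrow> g t \<le> g s"
  shows "(g \<longlongrightarrow> 0) at_top"
proof (rule tendstoI)
  fix e :: real assume "e > 0"
  then have e: "e/2 > 0" by simp
  obtain F F' C where F: "\<forall>t>0. \<bar>F t\<bar> \<le> C" "\<forall>t>0. (F has_real_derivative F' t) (at t)" "\<forall>t>0. g t \<le> e/2 + F' t"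
    by (rule null_on_averageE[OF null e])
  \<comment> \<open>Growth at rate \<open>e/2\<close> from time 1 to \<open>T\<close> would exceed the oscillation
       \<open>2 * \<bar>C\<bar>\<close> allowed to \<open>F\<close>.\<close>
  define T where "T = 2 + 4 * (\<bar>C\<bar> + 1) / e"
  have "g t < e" if t: "t \<ge> T" for t
  proof (rule ccontr)
    assume "\<not> g t < e"
    then have gt: "g t \<ge> e" by simp
    have T: "T \<ge> 2" using \<open>e > 0\<close> by (auto simp: T_def intro!: divide_nonneg_pos)
    define G where "G s = F s - (e/2) * s" for s
    have "G 1 \<le> G t"
    proof (rule DERIV_nonneg_imp_nondecreasing[of 1 t G])
      show "1 \<le> t" using T t by simp
      fix s assume s: "1 \<le> s" "s \<le> t"
      have "(F has_real_derivative F' s) (at s)" using F(2) s by simp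
      then have "(G has_real_derivative F' s - (e/2) * 1) (at s)"
        unfolding G_def by (intro DERIV_diff DERIV_cmult DERIV_ident)
      moreover have "g s \<le> e/2 + F' s" using F(3) s by simp
      then have "F' s - (e/2) * 1 \<ge> 0" using gt dec[of s t] s by linarith
      ultimately show "\<exists>y. (G has_real_derivative y) (at s) \<and> 0 \<le> y" by blast
    qed
    then have "(e/2) * (t - 1) \<le> F t - F 1" unfolding G_def right_diff_distrib by linarith
    also have "\<dots> \<le> 2 * \<bar>C\<bar>"
    proof -
      have "\<bar>F t\<bar> \<le> C" "\<bar>F 1\<bar> \<le> C" using F(1) T t by simp_all
      then show ?thesis by linarith
    qed
    finally have "(e/2) * (t - 1) \<le> 2 * \<bar>C\<bar>" .
    moreover have le: "(e/2) * (4 * (\<bar>C\<bar> + 1) / e) \<le> (e/2) * (t - 1)"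
      using t e by (intro mult_left_mono) (auto simp: T_def)
    moreover have "(e/2) * (4 * (\<bar>C\<bar> + 1) / e) = 2 * (\<bar>C\<bar> + 1)" using \<open>e > 0\<close> by simp
    note le[unfolded this]
    ultimately have "2 * (\<bar>C\<bar> + 1) \<le> 2 * \<bar>C\<bar>" by linarith
    then show False by simp
  qed
  moreover have "T \<ge> 0" using \<open>e > 0\<close> by (auto simp: T_def intro!: add_nonneg_nonneg divide_nonneg_pos)
  moreover have "T > 0" using \<open>e > 0\<close> by (auto simp: T_def intro!: add_pos_nonneg divide_nonneg_pos)
  ultimately show "\<forall>\<^sub>F t in at_top. dist (g t) 0 < e"
    using nonneg by (intro eventually_at_top_linorderI[of T]) (auto simp: dist_real_def)
qed

definition L2_time_derivative :: "real \<Rightarrow> (real \<Rightarrow> real \<Rightarrow> complex) \<Rightarrow> (real \<Rightarrow> complex) \<Rightarrow> real \<Rightarrow> bool" where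
  "L2_time_derivative L p p' t \<longleftrightarrow>
     ((\<lambda>h. nrm L (\<lambda>x. of_real (1 / h) * (p (t + h) x - p t x) - p' x)) \<longlongrightarrow> 0) (at 0)"

lemma wip_time_derivative:
  assumes w: "bounded_weight L w"
    and L2: "\<And>s. p s \<in> L2 L" "\<And>s. q s \<in> L2 L" "p' \<in> L2 L" "q' \<in> L2 L"
    and p: "L2_time_derivative L p p' t" and q: "L2_time_derivative L q q' t"
  shows "((\<lambda>t. wip L w (p t) (q t)) has_real_derivative wip L w p' (q t) + wip L w (p t) q') (at t)"
proof -
  define \<Delta> where "\<Delta> r h = (\<lambda>x. complex_of_real (1 / h) * (r (t + h) x - r t x))" for r :: "real \<Rightarrow> real \<Rightarrow> complex" and h
  have \<Delta>L2: "\<Delta> p h \<in> L2 L" "\<Delta> q h \<in> L2 L" for h unfolding \<Delta>_def by (rule L2_cmult[OF L2_diff], rule L2, rule L2)+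
  have \<Delta>lim: "((\<lambda>h. nrm L (\<lambda>x. \<Delta> p h x - p' x)) \<longlongrightarrow> 0) (at 0)" "((\<lambda>h. nrm L (\<lambda>x. \<Delta> q h x - q' x)) \<longlongrightarrow> 0) (at 0)"
    using p q unfolding L2_time_derivative_def \<Delta>_def by auto
  have z: "((\<lambda>h::real. nrm L (\<lambda>x. p t x - p t x)) \<longlongrightarrow> 0) (at 0)" by (simp add: nrm_def wip_def)
  have qlim: "((\<lambda>h. nrm L (\<lambda>x. q (t + h) x - q t x)) \<longlongrightarrow> 0) (at 0)"
  proof -
    have "((\<lambda>h. \<bar>h\<bar> * nrm L (\<Delta> q h)) \<longlongrightarrow> \<bar>0\<bar> * nrm L q') (at 0)"
      by (intro tendsto_mult tendsto_rabs tendsto_ident_at nrm_tendsto[OF \<Delta>L2(2) L2(4) \<Delta>lim(2)])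
    then have "((\<lambda>h. \<bar>h\<bar> * nrm L (\<Delta> q h)) \<longlongrightarrow> 0) (at 0)" by simp
    then show ?thesis
    proof (rule Lim_transform_eventually)
      show "\<forall>\<^sub>F h in at 0. \<bar>h\<bar> * nrm L (\<Delta> q h) = nrm L (\<lambda>x. q (t + h) x - q t x)"
        using eventually_neq_at_within[of 0 0 UNIV]
      proof (rule eventually_mono)
        fix h :: real assume "h \<noteq> 0"
        then show "\<bar>h\<bar> * nrm L (\<Delta> q h) = nrm L (\<lambda>x. q (t + h) x - q t x)"
          unfolding \<Delta>_def nrm_cmult norm_of_real by simp
      qed
    qed
  qed
  have "((\<lambda>h. wip L w (\<Delta> p h) (q (t + h)) + wip L w (p t) (\<Delta> q h)) \<longlongrightarrow> wip L w p' (q t) + wip L w (p t) q') (at 0)"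
    by (rule tendsto_add[OF wip_tendsto[OF w \<Delta>L2(1) L2(2) L2(3) L2(2) \<Delta>lim(1) qlim]
          wip_tendsto[OF w L2(1) \<Delta>L2(2) L2(1) L2(4) z \<Delta>lim(2)]])
  then have "((\<lambda>h. (wip L w (p (t + h)) (q (t + h)) - wip L w (p t) (q t)) / h) \<longlongrightarrow> wip L w p' (q t) + wip L w (p t) q') (at 0)"
  proof (rule Lim_transform_eventually)
    show "\<forall>\<^sub>F h in at 0. wip L w (\<Delta> p h) (q (t + h)) + wip L w (p t) (\<Delta> q h)
       = (wip L w (p (t + h)) (q (t + h)) - wip L w (p t) (q t)) / h"
      using eventually_neq_at_within[of 0 0 UNIV]
    proof (rule eventually_mono)
      fix h :: real assume h: "h \<noteq> 0"
      have "wip L w (\<Delta> p h) (q (t + h)) + wip L w (p t) (\<Delta> q h)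
        = (1/h) * (wip L w (p (t+h)) (q (t+h)) - wip L w (p t) (q (t+h))) + (1/h) * (wip L w (p t) (q (t+h)) - wip L w (p t) (q t))"
        unfolding \<Delta>_def wip_scale_left wip_scale_right
        by (simp only: wip_diff_left[OF w L2(1) L2(1) L2(2)] wip_diff_right[OF w L2(2) L2(2) L2(1)])
      then show "wip L w (\<Delta> p h) (q (t + h)) + wip L w (p t) (\<Delta> q h)
       = (wip L w (p (t + h)) (q (t + h)) - wip L w (p t) (q t)) / h" by (simp add: diff_divide_distrib)
    qed
  qed
  then show ?thesis unfolding DERIV_def .
qed

text \<open>The basic source of null functions: time derivatives of pairings of bounded families. Both signs are
  recorded, as they are used to move a time derivative from one factor of a pairing to the other.\<close>

lemma null_wip_derivative:
  assumes w: "bounded_weight L w"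
    and L2: "\<And>s. p s \<in> L2 L" "\<And>s. q s \<in> L2 L" "\<And>s. p' s \<in> L2 L" "\<And>s. q' s \<in> L2 L"
    and p: "\<And>t. t > 0 \<Longrightarrow> L2_time_derivative L p (p' t) t" and q: "\<And>t. t > 0 \<Longrightarrow> L2_time_derivative L q (q' t) t"
    and M: "\<And>t. t > 0 \<Longrightarrow> nrm L (p t) \<le> M" "\<And>t. t > 0 \<Longrightarrow> nrm L (q t) \<le> M"
  shows "null_on_average (\<lambda>t. wip L w (p' t) (q t) + wip L w (p t) (q' t))"
    "null_on_average (\<lambda>t. - (wip L w (p' t) (q t) + wip L w (p t) (q' t)))"
proof -
  obtain K where K: "K \<ge> 0" "\<And>f g. f \<in> L2 L \<Longrightarrow> g \<in> L2 L \<Longrightarrow> \<bar>wip L w f g\<bar> \<le> K * (nrm L f * nrm L g)"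
    using wip_bounded[OF w] by blast
  have bd: "\<bar>wip L w (p t) (q t)\<bar> \<le> K * (M * M)" if t: "t > 0" for t
  proof -
    have "nrm L (p t) * nrm L (q t) \<le> M * M"
      using M[OF t] order_trans[OF nrm_nonneg M(1)[OF t]] by (intro mult_mono) auto
    from mult_left_mono[OF this K(1)] show ?thesis by (rule order_trans[OF K(2)[OF L2(1) L2(2)]])
  qed
  have d: "((\<lambda>t. wip L w (p t) (q t)) has_real_derivative wip L w (p' t) (q t) + wip L w (p t) (q' t)) (at t)"
    if "t > 0" for t by (rule wip_time_derivative[OF w L2(1,2,3,4) p[OF that] q[OF that]])
  show "null_on_average (\<lambda>t. wip L w (p' t) (q t) + wip L w (p t) (q' t))"
    by (rule null_derivative[OF bd d])
  show "null_on_average (\<lambda>t. - (wip L w (p' t) (q t) + wip L w (p t) (q' t)))"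
    by (rule null_derivative[OF _ DERIV_minus[OF d]]) (use bd in simp_all)
qed

text \<open>If \<open>g\<close> is null for the weight \<open>r\<close>, every pairing of \<open>g\<close> with a
  bounded family is null, provided that the weight of the pairing is supported where \<open>r\<close> is
  effective.\<close>

lemma null_wip:
  assumes w: "bounded_weight L w" and r: "bounded_weight L r"
    and L2: "\<And>s. f s \<in> L2 L" "\<And>s. g s \<in> L2 L"
    and M: "\<And>t. t > 0 \<Longrightarrow> nrm L (f t) \<le> M"
    and le: "\<And>x. x \<in> {0<..<L} \<Longrightarrow> (w x)\<^sup>2 \<le> K * r x" and K: "K \<ge> 0"
    and g: "null_on_average (\<lambda>t. wip L r (g t) (g t))"
  shows "null_on_average (\<lambda>t. \<bar>wip L w (f t) (g t)\<bar>)"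
proof (rule null_young[OF g _ K])
  fix e t :: real assume e: "e > 0" and t: "t > 0"
  have "(nrm L (f t))\<^sup>2 \<le> M\<^sup>2" using M[OF t] by (intro power_mono) auto
  then have "e * ip L (f t) (f t) \<le> e * M\<^sup>2" using e by (simp add: nrm_power2)
  then show "\<bar>wip L w (f t) (g t)\<bar> \<le> e * M\<^sup>2 + (K / e) * wip L r (g t) (g t)"
    using wip_young[OF w r L2(1) L2(2) le e, of t t] by linarith
qed simp

lemma null_wip_self:
  assumes w: "bounded_weight L w" and r: "bounded_weight L r" and L2: "\<And>s. g s \<in> L2 L"
    and le: "\<And>x. x \<in> {0<..<L} \<Longrightarrow> \<bar>w x\<bar> \<le> K * r x" and K: "K \<ge> 0"
    and g: "null_on_average (\<lambda>t. wip L r (g t) (g t))"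
  shows "null_on_average (\<lambda>t. \<bar>wip L w (g t) (g t)\<bar>)"
proof (rule null_mono[OF null_cmult[OF g K]])
  fix t :: real
  have Kr: "bounded_weight L (\<lambda>x. K * r x)" using r by (intro bounded_weight_mult) auto
  have "wip L w (g t) (g t) \<le> wip L (\<lambda>x. K * r x) (g t) (g t)"
    by (rule wip_mono_weight[OF w Kr L2]) (use le abs_ge_self order_trans in blast)
  moreover have "wip L (\<lambda>x. (-1) * w x) (g t) (g t) \<le> wip L (\<lambda>x. K * r x) (g t) (g t)"
    by (rule wip_mono_weight[OF bounded_weight_mult[OF bounded_weight_const w] Kr L2])
       (use le abs_ge_minus_self order_trans in fastforce)
  ultimately show "\<bar>wip L w (g t) (g t)\<bar> \<le> K * wip L r (g t) (g t)" unfolding wip_scale by simp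
qed

lemma null_abs: "null_on_average (\<lambda>t. \<bar>f t\<bar>) \<Longrightarrow> null_on_average f" "null_on_average (\<lambda>t. \<bar>f t\<bar>) \<Longrightarrow> null_on_average (\<lambda>t. - f t)"
  by (erule null_mono, simp)+

section \<open>Multiplier estimates along a trajectory\<close>

lemma wip_cong_weight:
  assumes "\<And>x. x \<in> {0<..<L} \<Longrightarrow> w x = w' x" shows "wip L w f g = wip L w' f g"
  unfolding wip_def using assms by (intro Bochner_Integration.integral_cong) auto

lemma wip_zero_weight: "wip L (\<lambda>x. 0) f g = 0"
  by (simp add: wip_def)

lemma wip_plus_left:
  assumes "bounded_weight L w" "bounded_weight L r" "f \<in> L2 L" "g \<in> L2 L" "h \<in> L2 L"
  shows "wip L w (\<lambda>x. f x + of_real (r x) * g x) h = wip L w f h + wip L (\<lambda>x. w x * r x) g h"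
  using wip_add_left[OF assms(1,3) L2_weight[OF assms(2,4)] assms(5)] unfolding wip_weight_left .

lemma wip_minus_weight_left:
  assumes "bounded_weight L w" "bounded_weight L r" "f \<in> L2 L" "g \<in> L2 L" "h \<in> L2 L"
  shows "wip L w (\<lambda>x. f x - of_real (r x) * g x) h = wip L w f h - wip L (\<lambda>x. w x * r x) g h"
  using wip_diff_left[OF assms(1,3) L2_weight[OF assms(2,4)] assms(5)] unfolding wip_weight_left .

lemma wip_flux_left:
  assumes "bounded_weight L w" "bounded_weight L r" "f \<in> L2 L" "g \<in> L2 L" "h \<in> L2 L"
  shows "wip L w (\<lambda>x. of_real k * f x + of_real (r x) * g x) h = k * wip L w f h + wip L (\<lambda>x. w x * r x) g h"
  using wip_plus_left[OF assms(1,2) L2_cmult[OF assms(3)] assms(4,5), of "of_real k"] unfolding wip_scale_left .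

lemma wip_flux_right:
  assumes "bounded_weight L w" "bounded_weight L r" "f \<in> L2 L" "g \<in> L2 L" "h \<in> L2 L"
  shows "wip L w h (\<lambda>x. of_real k * f x + of_real (r x) * g x) = k * wip L w h f + wip L (\<lambda>x. w x * r x) h g"
  using wip_flux_left[OF assms] by (simp only: wip_commute[of L w h] wip_commute[of L _ h])

lemma L2_plus[intro]:
  assumes "bounded_weight L r" "f \<in> L2 L" "g \<in> L2 L"
  shows "(\<lambda>x. f x + of_real (r x) * g x) \<in> L2 L" "(\<lambda>x. f x - of_real (r x) * g x) \<in> L2 L"
    "(\<lambda>x. of_real k * f x + of_real (r x) * g x) \<in> L2 L"
  using L2_add[OF assms(2) L2_weight[OF assms(1,3)]] L2_diff[OF assms(2) L2_weight[OF assms(1,3)]]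
    L2_add[OF L2_cmult[OF assms(2)] L2_weight[OF assms(1,3)]] by auto

lemma weight_product_bound:
  assumes w: "bounded_weight L w" and r: "bounded_weight L r" and nn: "\<And>x. x \<in> {0<..<L} \<Longrightarrow> 0 \<le> r x"
  obtains K where "K \<ge> 0" "\<And>x. x \<in> {0<..<L} \<Longrightarrow> (w x * r x)\<^sup>2 \<le> K * r x"
    "\<And>x. x \<in> {0<..<L} \<Longrightarrow> \<bar>w x * r x\<bar> \<le> K * r x"
proof -
  obtain W where "\<forall>x\<in>{0<..<L}. \<bar>w x\<bar> \<le> W" using w unfolding bounded_weight_def by blast
  then have W: "\<bar>w x\<bar> \<le> \<bar>W\<bar>" if "x \<in> {0<..<L}" for x using that by (auto intro: order_trans[OF _ abs_ge_self])
  obtain R where "\<forall>x\<in>{0<..<L}. \<bar>r x\<bar> \<le> R" using r unfolding bounded_weight_def by blast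
  then have R: "r x \<le> \<bar>R\<bar>" if "x \<in> {0<..<L}" for x
    using that abs_ge_self[of "r x"] abs_ge_self[of R] by fastforce
  show ?thesis
  proof (rule that[of "\<bar>W\<bar>\<^sup>2 * \<bar>R\<bar> + \<bar>W\<bar>"])
    fix x assume x: "x \<in> {0<..<L}"
    have 1: "0 \<le> \<bar>W\<bar>\<^sup>2 * \<bar>R\<bar> * r x" "0 \<le> \<bar>W\<bar> * r x" using nn[OF x] by auto
    have "\<bar>w x\<bar>\<^sup>2 \<le> \<bar>W\<bar>\<^sup>2" by (rule power_mono[OF W[OF x]]) simp
    moreover have "r x * r x \<le> \<bar>R\<bar> * r x" by (rule mult_right_mono[OF R[OF x] nn[OF x]])
    ultimately have "\<bar>w x\<bar>\<^sup>2 * (r x * r x) \<le> \<bar>W\<bar>\<^sup>2 * (\<bar>R\<bar> * r x)"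
      by (rule mult_mono) simp_all
    then show "(w x * r x)\<^sup>2 \<le> (\<bar>W\<bar>\<^sup>2 * \<bar>R\<bar> + \<bar>W\<bar>) * r x"
      using 1 by (simp add: power_mult_distrib power2_eq_square[of "r x"] distrib_right mult.assoc)
    have "\<bar>w x * r x\<bar> = \<bar>w x\<bar> * r x" using nn[OF x] by (simp add: abs_mult)
    also have "\<dots> \<le> \<bar>W\<bar> * r x" by (rule mult_right_mono[OF W[OF x] nn[OF x]])
    finally show "\<bar>w x * r x\<bar> \<le> (\<bar>W\<bar>\<^sup>2 * \<bar>R\<bar> + \<bar>W\<bar>) * r x" using 1 by (simp add: distrib_right)
  qed simp
qed

lemma null_wip_weighted:
  assumes w: "bounded_weight L w" and r: "bounded_weight L r" and nn: "\<And>x. x \<in> {0<..<L} \<Longrightarrow> 0 \<le> r x"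
    and s: "\<And>x. x \<in> {0<..<L} \<Longrightarrow> s x = w x * r x"
    and L2: "\<And>t. f t \<in> L2 L" "\<And>t. g t \<in> L2 L" and M: "\<And>t. t > 0 \<Longrightarrow> nrm L (f t) \<le> M"
    and g: "null_on_average (\<lambda>t. wip L r (g t) (g t))"
  shows "null_on_average (\<lambda>t. \<bar>wip L s (f t) (g t)\<bar>)"
proof -
  obtain K where K: "K \<ge> 0" "\<And>x. x \<in> {0<..<L} \<Longrightarrow> (w x * r x)\<^sup>2 \<le> K * r x"
    using weight_product_bound[OF w r nn] by metis
  have "wip L s (f t) (g t) = wip L (\<lambda>x. w x * r x) (f t) (g t)" for t by (rule wip_cong_weight[OF s])
  then show ?thesis using null_wip[OF bounded_weight_mult[OF w r] r L2 M K(2,1) g] by simp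
qed

lemma null_wip_self_weighted:
  assumes w: "bounded_weight L w" and r: "bounded_weight L r" and nn: "\<And>x. x \<in> {0<..<L} \<Longrightarrow> 0 \<le> r x"
    and s: "\<And>x. x \<in> {0<..<L} \<Longrightarrow> s x = w x * r x"
    and L2: "\<And>t. g t \<in> L2 L"
    and g: "null_on_average (\<lambda>t. wip L r (g t) (g t))"
  shows "null_on_average (\<lambda>t. \<bar>wip L s (g t) (g t)\<bar>)"
proof -
  obtain K where K: "K \<ge> 0" "\<And>x. x \<in> {0<..<L} \<Longrightarrow> \<bar>w x * r x\<bar> \<le> K * r x"
    using weight_product_bound[OF w r nn] by metis
  have "wip L s (g t) (g t) = wip L (\<lambda>x. w x * r x) (g t) (g t)" for t by (rule wip_cong_weight[OF s])
  then show ?thesis using null_wip_self[OF bounded_weight_mult[OF w r] r L2 K(2,1) g] by simp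
qed

text \<open>The dissipation identity for the coupled system: the coupling terms cancel because they are antisymmetric.
  It is stated for arbitrary functions of \<open>x\<close> so that it applies both to an orbit and to its
  time derivative.\<close>

lemma energy_identity:
  assumes b: "bounded_weight L b" and c: "bounded_weight L c"
    and flux: "has_weak_derivative L (\<lambda>x. of_real a * p x + of_real (b x) * r x) (\<lambda>x. w x + of_real (c x) * s x)"
    and m: "has_weak_derivative L m (\<lambda>x. k x - of_real (c x) * q x)"
    and q: "H10_derivative L q r" and s: "H10_derivative L s n"
    and L2: "p \<in> L2 L" "w \<in> L2 L" "k \<in> L2 L" "m \<in> L2 L"
  shows "ip L w q + a * ip L p r + ip L k s + ip L m n = - wip L b r r"
proof -
  have qs: "q \<in> L2 L" "r \<in> L2 L" "s \<in> L2 L" "n \<in> L2 L"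
    using hwd_L2[OF H10_derivative_hwd[OF q]] hwd_L2[OF H10_derivative_hwd[OF s]] by auto
  have 1: "ip L w q + wip L c s q = - (a * ip L p r + wip L b r r)"
    using H10_ibp[OF flux q]
    unfolding wip_plus_left[OF bounded_weight_const c L2(2) qs(3,1)] wip_flux_left[OF bounded_weight_const b L2(1) qs(2,2)]
    by simp
  have 2: "ip L k s - wip L c q s = - ip L m n"
    using H10_ibp[OF m s] unfolding wip_minus_weight_left[OF bounded_weight_const c L2(3) qs(1,3)] by simp
  show ?thesis using 1 2 wip_commute[of L c q s] by linarith
qed

text \<open>The data of an orbit with initial value in the domain of the squared operator, in terms of functions of
  \<open>x\<close> at each time. The first displacement runs through \<open>u0\<close>, \<open>u\<close>,
  \<open>v\<close>, \<open>v1\<close>, each being the time derivative of the preceding one, and the second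
  displacement through \<open>y0\<close>, \<open>y\<close>, \<open>z\<close>, \<open>z1\<close>; the suffix
  \<open>x\<close> marks the derivative in space. Thus \<open>(u0, u, y0, y)\<close> is the orbit and
  \<open>(u, v, y, z)\<close> its time derivative. The equations of the orbit are \<open>flux0\<close> and
  \<open>y0xx\<close>, those of the time derivative \<open>flux1\<close> and \<open>yxx\<close>.\<close>

locale kv_trajectory =
  fixes L a b0 c0 \<alpha>1 \<alpha>2 \<alpha>3 \<alpha>4 M :: real and b c :: "real \<Rightarrow> real"
    and u0 u0x u ux v vx v1 y0 y0x y yx z zx z1 :: "real \<Rightarrow> real \<Rightarrow> complex"
  assumes b_def: "b = local_coeff b0 \<alpha>1 \<alpha>3" and c_def: "c = local_coeff c0 \<alpha>2 \<alpha>4"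
    and pos: "L > 0" "a > 0" "b0 > 0" "c0 > 0"
    and order: "0 < \<alpha>1" "\<alpha>1 < \<alpha>2" "\<alpha>2 < \<alpha>3" "\<alpha>3 < \<alpha>4" "\<alpha>4 < L"
    and L2s[simp]: "u0 t \<in> L2 L" "u0x t \<in> L2 L" "u t \<in> L2 L" "ux t \<in> L2 L" "v t \<in> L2 L" "vx t \<in> L2 L" "v1 t \<in> L2 L"
      "y0 t \<in> L2 L" "y0x t \<in> L2 L" "y t \<in> L2 L" "yx t \<in> L2 L" "z t \<in> L2 L" "zx t \<in> L2 L" "z1 t \<in> L2 L"
    and bd: "t > 0 \<Longrightarrow> nrm L (u0 t) \<le> M" "t > 0 \<Longrightarrow> nrm L (u0x t) \<le> M" "t > 0 \<Longrightarrow> nrm L (u t) \<le> M"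
      "t > 0 \<Longrightarrow> nrm L (ux t) \<le> M" "t > 0 \<Longrightarrow> nrm L (v t) \<le> M" "t > 0 \<Longrightarrow> nrm L (vx t) \<le> M"
      "t > 0 \<Longrightarrow> nrm L (v1 t) \<le> M"
      "t > 0 \<Longrightarrow> nrm L (y0 t) \<le> M" "t > 0 \<Longrightarrow> nrm L (y0x t) \<le> M" "t > 0 \<Longrightarrow> nrm L (y t) \<le> M"
      "t > 0 \<Longrightarrow> nrm L (yx t) \<le> M" "t > 0 \<Longrightarrow> nrm L (z t) \<le> M" "t > 0 \<Longrightarrow> nrm L (zx t) \<le> M"
      "t > 0 \<Longrightarrow> nrm L (z1 t) \<le> M"
    and H10s: "t > 0 \<Longrightarrow> H10_derivative L (u0 t) (u0x t)" "t > 0 \<Longrightarrow> H10_derivative L (u t) (ux t)"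
      "t > 0 \<Longrightarrow> H10_derivative L (v t) (vx t)" "t > 0 \<Longrightarrow> H10_derivative L (y0 t) (y0x t)"
      "t > 0 \<Longrightarrow> H10_derivative L (y t) (yx t)" "t > 0 \<Longrightarrow> H10_derivative L (z t) (zx t)"
    and flux0: "t > 0 \<Longrightarrow> has_weak_derivative L (\<lambda>x. of_real a * u0x t x + of_real (b x) * ux t x) (\<lambda>x. v t x + of_real (c x) * y t x)"
    and flux1: "t > 0 \<Longrightarrow> has_weak_derivative L (\<lambda>x. of_real a * ux t x + of_real (b x) * vx t x) (\<lambda>x. v1 t x + of_real (c x) * z t x)"
    and y0xx: "t > 0 \<Longrightarrow> has_weak_derivative L (y0x t) (\<lambda>x. z t x - of_real (c x) * u t x)"
    and yxx: "t > 0 \<Longrightarrow> has_weak_derivative L (yx t) (\<lambda>x. z1 t x - of_real (c x) * v t x)"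
    and ddt: "t > 0 \<Longrightarrow> L2_time_derivative L u0 (u t) t" "t > 0 \<Longrightarrow> L2_time_derivative L u (v t) t"
      "t > 0 \<Longrightarrow> L2_time_derivative L v (v1 t) t" "t > 0 \<Longrightarrow> L2_time_derivative L y0 (y t) t"
      "t > 0 \<Longrightarrow> L2_time_derivative L y (z t) t" "t > 0 \<Longrightarrow> L2_time_derivative L z (z1 t) t"
      "t > 0 \<Longrightarrow> L2_time_derivative L u0x (ux t) t" "t > 0 \<Longrightarrow> L2_time_derivative L ux (vx t) t"
      "t > 0 \<Longrightarrow> L2_time_derivative L y0x (yx t) t" "t > 0 \<Longrightarrow> L2_time_derivative L yx (zx t) t"
begin

lemma bw[simp]: "bounded_weight L b" "bounded_weight L c"
  by (simp_all add: b_def c_def)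

lemma b_nonneg: "0 \<le> b x" using pos by (simp add: b_def local_coeff_def)

lemma c_bounds: "0 \<le> c x" "c x \<le> c0" using pos by (auto simp: c_def local_coeff_def)

lemma b_in: "\<alpha>1 < x \<Longrightarrow> x < \<alpha>3 \<Longrightarrow> b x = b0"
  by (simp add: b_def local_coeff_def)

lemma support_factor:
  assumes "x \<notin> {\<alpha>1<..<\<alpha>3} \<Longrightarrow> \<psi> x = 0" shows "\<psi> x = (\<psi> x * (1 / b0)) * b x"
  using assms b_in[of x] pos by (cases "x \<in> {\<alpha>1<..<\<alpha>3}") auto

text \<open>By the dissipation identity of the orbit, \<open>wip L b (ux t) (ux t)\<close> is minus half the derivative
  of the squared energy norm.\<close>

lemma null_ux: "null_on_average (\<lambda>t. wip L b (ux t) (ux t))"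
proof -
  have "null_on_average (\<lambda>t. (1/2) * (- (ip L (v t) (u t) + ip L (u t) (v t)) + (a * (- (ip L (ux t) (u0x t) + ip L (u0x t) (ux t)))
     + (- (ip L (z t) (y t) + ip L (y t) (z t)) + - (ip L (yx t) (y0x t) + ip L (y0x t) (yx t))))))"
    using pos
    by (intro null_cmult null_add null_wip_derivative(2)[OF bounded_weight_const L2s(3,3,5,5) ddt(2,2) bd(3,3)]
       null_wip_derivative(2)[OF bounded_weight_const L2s(2,2,4,4) ddt(7,7) bd(2,2)]
       null_wip_derivative(2)[OF bounded_weight_const L2s(10,10,12,12) ddt(5,5) bd(10,10)]
       null_wip_derivative(2)[OF bounded_weight_const L2s(9,9,11,11) ddt(9,9) bd(9,9)]) simp_all
  then show ?thesis
  proof (rule null_mono)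
    fix t :: real assume t: "t > 0"
    have "ip L (v t) (u t) + a * ip L (u0x t) (ux t) + ip L (z t) (y t) + ip L (y0x t) (yx t) = - wip L b (ux t) (ux t)"
      by (rule energy_identity[OF bw flux0[OF t] y0xx[OF t] H10s(2)[OF t] H10s(5)[OF t]]) simp_all
    then show "wip L b (ux t) (ux t) \<le> (1/2) * (- (ip L (v t) (u t) + ip L (u t) (v t)) + (a * (- (ip L (ux t) (u0x t) + ip L (u0x t) (ux t)))
     + (- (ip L (z t) (y t) + ip L (y t) (z t)) + - (ip L (yx t) (y0x t) + ip L (y0x t) (yx t)))))"
      unfolding wip_commute[of L _ "u t" "v t"] wip_commute[of L _ "ux t" "u0x t"] wip_commute[of L _ "y t" "z t"]
        wip_commute[of L _ "yx t" "y0x t"] by (simp add: algebra_simps)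
  qed
qed

text \<open>The dissipation identity of the time derivative of the orbit, whose velocity gradient is
  \<open>v\<^sub>x\<close>.\<close>

lemma null_vx: "null_on_average (\<lambda>t. wip L b (vx t) (vx t))"
proof -
  have "null_on_average (\<lambda>t. (1/2) * (- (ip L (v1 t) (v t) + ip L (v t) (v1 t)) + (a * (- (ip L (vx t) (ux t) + ip L (ux t) (vx t)))
     + (- (ip L (z1 t) (z t) + ip L (z t) (z1 t)) + - (ip L (zx t) (yx t) + ip L (yx t) (zx t))))))"
    using pos
    by (intro null_cmult null_add null_wip_derivative(2)[OF bounded_weight_const L2s(5,5,7,7) ddt(3,3) bd(5,5)]
       null_wip_derivative(2)[OF bounded_weight_const L2s(4,4,6,6) ddt(8,8) bd(4,4)]
       null_wip_derivative(2)[OF bounded_weight_const L2s(12,12,14,14) ddt(6,6) bd(12,12)]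
       null_wip_derivative(2)[OF bounded_weight_const L2s(11,11,13,13) ddt(10,10) bd(11,11)]) simp_all
  then show ?thesis
  proof (rule null_mono)
    fix t :: real assume t: "t > 0"
    have "ip L (v1 t) (v t) + a * ip L (ux t) (vx t) + ip L (z1 t) (z t) + ip L (yx t) (zx t) = - wip L b (vx t) (vx t)"
      by (rule energy_identity[OF bw flux1[OF t] yxx[OF t] H10s(3)[OF t] H10s(6)[OF t]]) simp_all
    then show "wip L b (vx t) (vx t) \<le> (1/2) * (- (ip L (v1 t) (v t) + ip L (v t) (v1 t)) + (a * (- (ip L (vx t) (ux t) + ip L (ux t) (vx t)))
     + (- (ip L (z1 t) (z t) + ip L (z t) (z1 t)) + - (ip L (zx t) (yx t) + ip L (yx t) (zx t)))))"
      unfolding wip_commute[of L _ "v t" "v1 t"] wip_commute[of L _ "vx t" "ux t"] wip_commute[of L _ "z t" "z1 t"]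
        wip_commute[of L _ "zx t" "yx t"] by (simp add: algebra_simps)
  qed
qed

definition local_weight :: "real \<Rightarrow> real \<Rightarrow> (real \<Rightarrow> real) \<Rightarrow> (real \<Rightarrow> real) \<Rightarrow> bool" where
  "local_weight p q \<psi> \<psi>' \<longleftrightarrow> C1 \<psi> \<psi>' \<and> (\<forall>x. 0 \<le> \<psi> x) \<and> (\<forall>x. x \<notin> {p<..<q} \<longrightarrow> \<psi> x = 0 \<and> \<psi>' x = 0)"

lemma C1_weight: "C1 \<psi> \<psi>' \<Longrightarrow> bounded_weight L \<psi>" "C1 \<psi> \<psi>' \<Longrightarrow> bounded_weight L \<psi>'"
  using C1_continuous C1_continuous' bounded_weight_continuous by blast+

text \<open>On \<open>(\<alpha>\<^sub>1,\<alpha>\<^sub>3)\<close> the coefficient \<open>b\<close> is a positive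
  constant, so nullness for the weight \<open>b\<close> is nullness for every weight supported in this
  interval.\<close>

lemma null_b_left:
  assumes s: "bounded_weight L s" and supp: "\<And>x. x \<notin> {\<alpha>1<..<\<alpha>3} \<Longrightarrow> s x = 0"
    and f: "\<And>t. f t \<in> L2 L" "\<And>t. t > 0 \<Longrightarrow> nrm L (f t) \<le> M"
    and g: "\<And>t. g t \<in> L2 L" "null_on_average (\<lambda>t. wip L b (g t) (g t))"
  shows "null_on_average (\<lambda>t. \<bar>wip L s (f t) (g t)\<bar>)" "null_on_average (\<lambda>t. \<bar>wip L s (g t) (f t)\<bar>)"
proof -
  have w: "bounded_weight L (\<lambda>x. s x * (1 / b0))" using s by (intro bounded_weight_mult bounded_weight_const)
  show 1: "null_on_average (\<lambda>t. \<bar>wip L s (f t) (g t)\<bar>)"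
  proof (rule null_wip_weighted[OF w bw(1) b_nonneg _ f(1) g(1) f(2) g(2)])
    show "s x = s x * (1 / b0) * b x" for x by (rule support_factor[of x s, OF supp])
  qed
  then show "null_on_average (\<lambda>t. \<bar>wip L s (g t) (f t)\<bar>)" by (simp only: wip_commute[of L s "g _"])
qed

text \<open>In \<open>(\<alpha>\<^sub>1,\<alpha>\<^sub>2)\<close> the equation reads \<open>v\<^sub>t = (a u\<^sub>x + b
  v\<^sub>x)\<^sub>x\<close> with a null flux on the right. Testing it with \<open>\<psi> u\<close> shows
  that the pairing of \<open>u\<close> with \<open>v\<^sub>t\<close> is null, and this pairing differs from
  minus the squared norm of \<open>v\<close> by a time derivative.\<close>

lemma null_v_local:
  assumes \<psi>: "local_weight \<alpha>1 \<alpha>2 \<psi> \<psi>'"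
  shows "null_on_average (\<lambda>t. wip L \<psi> (v t) (v t))"
proof -
  have C: "C1 \<psi> \<psi>'" and supp: "\<And>x. x \<notin> {\<alpha>1<..<\<alpha>2} \<Longrightarrow> \<psi> x = 0" "\<And>x. x \<notin> {\<alpha>1<..<\<alpha>2} \<Longrightarrow> \<psi>' x = 0"
    using \<psi> by (auto simp: local_weight_def)
  note w = C1_weight[OF C]
  have supp3: "\<psi> x = 0" "\<psi>' x = 0" if "x \<notin> {\<alpha>1<..<\<alpha>3}" for x
    using that order by (auto intro!: supp)
  have e: "\<psi> 0 = 0" "\<psi> L = 0" using order by (auto intro!: supp)
  have pc: "\<psi> x * c x = 0" for x
    using supp(1)[of x] by (cases "x \<in> {\<alpha>1<..<\<alpha>2}") (auto simp: c_def local_coeff_def)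
  have wb: "bounded_weight L (\<lambda>x. \<psi> x * b x)" "bounded_weight L (\<lambda>x. \<psi>' x * b x)" using w by (auto intro!: bounded_weight_mult)
  have sb: "\<psi> x * b x = 0" "\<psi>' x * b x = 0" if "x \<notin> {\<alpha>1<..<\<alpha>3}" for x using supp3[OF that] by auto
  have "null_on_average (\<lambda>t. (wip L \<psi> (v t) (v t) + wip L \<psi> (u t) (v1 t)) +
     ((a * \<bar>wip L \<psi> (ux t) (ux t)\<bar> + \<bar>wip L (\<lambda>x. \<psi> x * b x) (vx t) (ux t)\<bar>) +
      (a * \<bar>wip L \<psi>' (ux t) (u t)\<bar> + \<bar>wip L (\<lambda>x. \<psi>' x * b x) (vx t) (u t)\<bar>)))"
    using pos
    by (intro null_add null_cmult null_wip_derivative(1)[OF w(1) L2s(3,5,5,7) ddt(2,3) bd(3,5)]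
       null_b_left(1)[OF w(1) supp3(1) L2s(4) bd(4) L2s(4) null_ux]
       null_b_left(1)[OF wb(1) sb(1) L2s(6) bd(6) L2s(4) null_ux]
       null_b_left(2)[OF w(2) supp3(2) L2s(3) bd(3) L2s(4) null_ux]
       null_b_left(2)[OF wb(2) sb(2) L2s(3) bd(3) L2s(6) null_vx]) simp_all
  then show ?thesis
  proof (rule null_mono)
    fix t :: real assume t: "t > 0"
    let ?F = "\<lambda>x. of_real a * ux t x + of_real (b x) * vx t x"
    let ?G = "\<lambda>x. v1 t x + of_real (c x) * z t x"
    have "wip L \<psi> ?G (u t) + wip L \<psi> ?F (ux t) + wip L \<psi>' ?F (u t) = 0"
      by (rule weak_ibp[OF pos(1) C e flux1[OF t] H10_derivative_hwd[OF H10s(2)[OF t]]])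
    then have "wip L \<psi> (v1 t) (u t) + (a * wip L \<psi> (ux t) (ux t) + wip L (\<lambda>x. \<psi> x * b x) (vx t) (ux t)) +
       (a * wip L \<psi>' (ux t) (u t) + wip L (\<lambda>x. \<psi>' x * b x) (vx t) (u t)) = 0"
      unfolding wip_plus_left[OF w(1) bw(2) L2s(7) L2s(12) L2s(3)] wip_flux_left[OF w(1) bw(1) L2s(4) L2s(6) L2s(4)]
        wip_flux_left[OF w(2) bw(1) L2s(4) L2s(6) L2s(3)] pc wip_zero_weight by simp
    moreover have "a * wip L \<psi> (ux t) (ux t) \<le> a * \<bar>wip L \<psi> (ux t) (ux t)\<bar>" "a * wip L \<psi>' (ux t) (u t) \<le> a * \<bar>wip L \<psi>' (ux t) (u t)\<bar>"
      using pos by (auto intro!: mult_left_mono)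
    ultimately show "wip L \<psi> (v t) (v t) \<le> (wip L \<psi> (v t) (v t) + wip L \<psi> (u t) (v1 t)) +
     ((a * \<bar>wip L \<psi> (ux t) (ux t)\<bar> + \<bar>wip L (\<lambda>x. \<psi> x * b x) (vx t) (ux t)\<bar>) +
      (a * \<bar>wip L \<psi>' (ux t) (u t)\<bar> + \<bar>wip L (\<lambda>x. \<psi>' x * b x) (vx t) (u t)\<bar>))"
      unfolding wip_commute[of L \<psi> "u t" "v1 t"] by linarith
  qed
qed

lemma null_self_product:
  assumes r: "bounded_weight L r" "\<And>x. 0 \<le> r x" and w: "bounded_weight L w" and s: "\<And>x. s x = w x * r x"
    and f: "\<And>t. f t \<in> L2 L" "\<And>t. t > 0 \<Longrightarrow> nrm L (f t) \<le> M"
    and g: "\<And>t. g t \<in> L2 L" "null_on_average (\<lambda>t. wip L r (g t) (g t))"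
  shows "null_on_average (\<lambda>t. \<bar>wip L s (f t) (g t)\<bar>)" "null_on_average (\<lambda>t. \<bar>wip L s (g t) (f t)\<bar>)"
proof -
  show 1: "null_on_average (\<lambda>t. \<bar>wip L s (f t) (g t)\<bar>)"
    by (rule null_wip_weighted[OF w r(1) r(2) s f(1) g(1) f(2) g(2)])
  then show "null_on_average (\<lambda>t. \<bar>wip L s (g t) (f t)\<bar>)"
    by (simp only: wip_commute[of L s "g _"])
qed

text \<open>Since \<open>p' = \<eta>1 - \<eta>2\<close>, integration by parts expresses the difference of the two
  weighted norms of \<open>g\<close> by the pairing of \<open>g\<close> with its gradient, which is null. A
  compactly supported primitive \<open>p\<close> exists whenever the two weights have the same integral,
  even if their supports are disjoint.\<close>

lemma null_transfer:
  assumes p: "C1 p (\<lambda>x. \<eta>1 x - \<eta>2 x)" and supp: "\<And>x. x \<notin> {\<alpha>1<..<\<alpha>3} \<Longrightarrow> p x = 0"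
    and \<eta>: "bounded_weight L \<eta>1" "bounded_weight L \<eta>2"
    and g: "\<And>t. g t \<in> L2 L" "\<And>t. t > 0 \<Longrightarrow> nrm L (g t) \<le> M" "\<And>t. gx t \<in> L2 L" "\<And>t. t > 0 \<Longrightarrow> H10_derivative L (g t) (gx t)"
    and gx: "null_on_average (\<lambda>t. wip L b (gx t) (gx t))" and n1: "null_on_average (\<lambda>t. wip L \<eta>1 (g t) (g t))"
  shows "null_on_average (\<lambda>t. wip L \<eta>2 (g t) (g t))"
proof -
  have e: "p 0 = 0" "p L = 0" using order by (auto intro!: supp)
  have "null_on_average (\<lambda>t. wip L \<eta>1 (g t) (g t) + 2 * \<bar>wip L p (g t) (gx t)\<bar>)"
    by (intro null_add null_cmult n1 null_b_left(1)[OF C1_weight(1)[OF p] supp g(1) g(2) g(3) gx]) simp_all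
  then show ?thesis
  proof (rule null_mono)
    fix t :: real assume t: "t > 0"
    have "wip L p (gx t) (g t) + wip L p (g t) (gx t) + wip L (\<lambda>x. \<eta>1 x - \<eta>2 x) (g t) (g t) = 0"
      by (rule weak_ibp[OF pos(1) p e H10_derivative_hwd[OF g(4)[OF t]] H10_derivative_hwd[OF g(4)[OF t]]])
    then have "2 * wip L p (g t) (gx t) + wip L \<eta>1 (g t) (g t) - wip L \<eta>2 (g t) (g t) = 0"
      unfolding wip_diff_weight[OF \<eta> g(1) g(1)] wip_commute[of L p "gx t" "g t"] by simp
    then show "wip L \<eta>2 (g t) (g t) \<le> wip L \<eta>1 (g t) (g t) + 2 * \<bar>wip L p (g t) (gx t)\<bar>" by linarith
  qed
qed

text \<open>In \<open>(\<alpha>\<^sub>2,\<alpha>\<^sub>3)\<close> the equation of the orbit is \<open>c\<^sub>0 y = (a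
  u0\<^sub>x + b u\<^sub>x)\<^sub>x - v\<close>. Testing with \<open>\<psi> y\<close> leaves pairings of
  \<open>u0\<^sub>x\<close> and \<open>u\<^sub>x\<close> with \<open>y\<close> and \<open>y\<^sub>x\<close>.
  Here \<open>u0\<^sub>x\<close> is not known to be null; but \<open>y\<close> and \<open>y\<^sub>x\<close>
  are time derivatives, and moving the time derivative to the other factor produces the null functions
  \<open>u\<^sub>x\<close> and \<open>v\<^sub>x\<close>.\<close>

lemma null_y_local:
  assumes \<psi>: "local_weight \<alpha>2 \<alpha>3 \<psi> \<psi>'" and nv: "null_on_average (\<lambda>t. wip L \<psi> (v t) (v t))"
  shows "null_on_average (\<lambda>t. wip L \<psi> (y t) (y t))"
proof -
  have C: "C1 \<psi> \<psi>'" and nn: "\<And>x. 0 \<le> \<psi> x"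
    and supp: "\<And>x. x \<notin> {\<alpha>2<..<\<alpha>3} \<Longrightarrow> \<psi> x = 0" "\<And>x. x \<notin> {\<alpha>2<..<\<alpha>3} \<Longrightarrow> \<psi>' x = 0"
    using \<psi> by (auto simp: local_weight_def)
  note w = C1_weight[OF C]
  have supp3: "\<psi> x = 0" "\<psi>' x = 0" if "x \<notin> {\<alpha>1<..<\<alpha>3}" for x
    using that order by (auto intro!: supp)
  have e: "\<psi> 0 = 0" "\<psi> L = 0" using order by (auto intro!: supp)
  have pc: "\<psi> x * c x = c0 * \<psi> x" for x
    using supp(1)[of x] order by (cases "x \<in> {\<alpha>2<..<\<alpha>3}") (auto simp: c_def local_coeff_def)
  have wb: "bounded_weight L (\<lambda>x. \<psi> x * b x)" "bounded_weight L (\<lambda>x. \<psi>' x * b x)" using w by (auto intro!: bounded_weight_mult)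
  have sb: "\<psi> x * b x = 0" "\<psi>' x * b x = 0" if "x \<notin> {\<alpha>1<..<\<alpha>3}" for x using supp3[OF that] by auto
  let ?b = "\<lambda>x. \<psi> x * b x" and ?b' = "\<lambda>x. \<psi>' x * b x"
  let ?small = "\<lambda>t. (a * \<bar>wip L \<psi> (ux t) (y0x t)\<bar> + \<bar>wip L ?b (vx t) (y0x t)\<bar>) + (a * \<bar>wip L \<psi>' (ux t) (y0 t)\<bar> + \<bar>wip L ?b' (vx t) (y0 t)\<bar>)"
  let ?ddt = "\<lambda>t. (a * (- (wip L \<psi> (ux t) (y0x t) + wip L \<psi> (u0x t) (yx t))) + - (wip L ?b (vx t) (y0x t) + wip L ?b (ux t) (yx t)))
      + (a * (- (wip L \<psi>' (ux t) (y0 t) + wip L \<psi>' (u0x t) (y t))) + - (wip L ?b' (vx t) (y0 t) + wip L ?b' (ux t) (y t)))"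
  have n1: "null_on_average ?small"
    using pos
    by (intro null_add null_cmult null_b_left(2)[OF w(1) supp3(1) L2s(9) bd(9) L2s(4) null_ux]
       null_b_left(2)[OF wb(1) sb(1) L2s(9) bd(9) L2s(6) null_vx]
       null_b_left(2)[OF w(2) supp3(2) L2s(8) bd(8) L2s(4) null_ux]
       null_b_left(2)[OF wb(2) sb(2) L2s(8) bd(8) L2s(6) null_vx]) simp_all
  have n2: "null_on_average ?ddt"
    using pos
    by (intro null_add null_cmult null_wip_derivative(2)[OF w(1) L2s(2,9,4,11) ddt(7,9) bd(2,9)]
       null_wip_derivative(2)[OF wb(1) L2s(4,9,6,11) ddt(8,9) bd(4,9)]
       null_wip_derivative(2)[OF w(2) L2s(2,8,4,10) ddt(7,4) bd(2,8)]
       null_wip_derivative(2)[OF wb(2) L2s(4,8,6,10) ddt(8,4) bd(4,8)]) simp_all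
  have n3: "null_on_average (\<lambda>t. \<bar>wip L \<psi> (v t) (y t)\<bar>)"
    by (rule null_self_product(2)[OF w(1) nn bounded_weight_const[of L 1] _ L2s(10) bd(10) L2s(5) nv]) simp
  have "null_on_average (\<lambda>t. (1/c0) * (?small t + (?ddt t + \<bar>wip L \<psi> (v t) (y t)\<bar>)))"
    using pos by (intro null_cmult[OF null_add[OF n1 null_add[OF n2 n3]]]) simp
  then show ?thesis
  proof (rule null_mono)
    fix t :: real assume t: "t > 0"
    let ?F = "\<lambda>x. of_real a * u0x t x + of_real (b x) * ux t x"
    let ?G = "\<lambda>x. v t x + of_real (c x) * y t x"
    have "wip L \<psi> ?G (y t) + wip L \<psi> ?F (yx t) + wip L \<psi>' ?F (y t) = 0"
      by (rule weak_ibp[OF pos(1) C e flux0[OF t] H10_derivative_hwd[OF H10s(5)[OF t]]])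
    then have *: "wip L \<psi> (v t) (y t) + c0 * wip L \<psi> (y t) (y t) + (a * wip L \<psi> (u0x t) (yx t) + wip L ?b (ux t) (yx t)) +
       (a * wip L \<psi>' (u0x t) (y t) + wip L ?b' (ux t) (y t)) = 0"
      unfolding wip_plus_left[OF w(1) bw(2) L2s(5) L2s(10) L2s(10)] wip_flux_left[OF w(1) bw(1) L2s(2) L2s(4) L2s(11)]
        wip_flux_left[OF w(2) bw(1) L2s(2) L2s(4) L2s(10)] pc wip_scale .
    have sm: "a * wip L \<psi> (ux t) (y0x t) \<le> a * \<bar>wip L \<psi> (ux t) (y0x t)\<bar>" "a * wip L \<psi>' (ux t) (y0 t) \<le> a * \<bar>wip L \<psi>' (ux t) (y0 t)\<bar>"
      using pos by (auto intro!: mult_left_mono)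
    have "c0 * wip L \<psi> (y t) (y t) \<le> ?small t + (?ddt t + \<bar>wip L \<psi> (v t) (y t)\<bar>)"
      using * sm unfolding distrib_left mult_minus_right by linarith
    then show "wip L \<psi> (y t) (y t) \<le> (1/c0) * (?small t + (?ddt t + \<bar>wip L \<psi> (v t) (y t)\<bar>))"
      using pos by (simp add: field_simps)
  qed
qed

text \<open>From \<open>y\<close> null the gradient follows by testing \<open>y\<^sub>x\<^sub>x = z1 - c v\<close> with
  \<open>y\<close>, and \<open>z\<close> by moving a time derivative in the pairing of \<open>z\<close> with
  \<open>y\<^sub>t\<close>. The square of \<open>\<psi>\<close> is used as weight because its derivative
  again contains the factor \<open>\<psi>\<close>, and so is controlled where \<open>y\<close> is null.\<close>

lemma null_local_energy:
  assumes \<psi>: "local_weight \<alpha>2 \<alpha>3 \<psi> \<psi>'" and nv: "null_on_average (\<lambda>t. wip L \<psi> (v t) (v t))"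
  defines "\<theta> \<equiv> \<lambda>x. \<psi> x * \<psi> x"
  shows "null_on_average (\<lambda>t. wip L \<theta> (v t) (v t))" "null_on_average (\<lambda>t. wip L \<theta> (ux t) (ux t))"
    "null_on_average (\<lambda>t. wip L \<theta> (z t) (z t))" "null_on_average (\<lambda>t. wip L \<theta> (yx t) (yx t))"
proof -
  have C: "C1 \<psi> \<psi>'" and nn: "\<And>x. 0 \<le> \<psi> x" and supp: "\<And>x. x \<notin> {\<alpha>2<..<\<alpha>3} \<Longrightarrow> \<psi> x = 0"
    using \<psi> by (auto simp: local_weight_def)
  note w = C1_weight[OF C]
  note ny = null_y_local[OF \<psi> nv]
  define \<theta>' where "\<theta>' x = \<psi> x * \<psi>' x + \<psi>' x * \<psi> x" for x
  have \<theta>C: "C1 \<theta> \<theta>'"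
    unfolding C1_def \<theta>_def \<theta>'_def
    by (intro conjI allI has_vector_derivative_mult[OF C1_derivative[OF C] C1_derivative[OF C]]
         continuous_intros C1_continuous[OF C] C1_continuous'[OF C])
  have w\<theta>: "bounded_weight L \<theta>" "bounded_weight L \<theta>'" using C1_weight[OF \<theta>C] by auto
  have e: "\<theta> 0 = 0" "\<theta> L = 0" using order supp[of 0] supp[of L] by (auto simp: \<theta>_def)
  show "null_on_average (\<lambda>t. wip L \<theta> (v t) (v t))"
    by (rule null_abs(1)[OF null_wip_self_weighted[OF w(1) w(1) nn _ L2s(5) nv]]) (simp add: \<theta>_def)
  show "null_on_average (\<lambda>t. wip L \<theta> (ux t) (ux t))"
    by (rule null_abs(1)[OF null_b_left(1)[OF w\<theta>(1) _ L2s(4) bd(4) L2s(4) null_ux]])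
       (use order in \<open>auto simp: \<theta>_def intro!: supp\<close>)
  have n1: "null_on_average (\<lambda>t. \<bar>wip L \<theta> (z1 t) (y t)\<bar>)"
    by (rule null_self_product(1)[OF w(1) nn w(1) _ L2s(14) bd(14) L2s(10) ny]) (simp add: \<theta>_def)
  have n2: "null_on_average (\<lambda>t. \<bar>wip L (\<lambda>x. \<theta> x * c x) (v t) (y t)\<bar>)"
    by (rule null_self_product(1)[OF w(1) nn bounded_weight_mult[OF w(1) bw(2)] _ L2s(5) bd(5) L2s(10) ny]) (simp add: \<theta>_def)
  have n3: "null_on_average (\<lambda>t. \<bar>wip L \<theta>' (yx t) (y t)\<bar>)"
    by (rule null_self_product(1)[OF w(1) nn bounded_weight_mult[OF bounded_weight_const[of L 2] w(2)] _ L2s(11) bd(11) L2s(10) ny])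
       (simp add: \<theta>'_def)
  show "null_on_average (\<lambda>t. wip L \<theta> (yx t) (yx t))"
  proof (rule null_mono[OF null_add[OF n1 null_add[OF n2 n3]]])
    fix t :: real assume t: "t > 0"
    have "wip L \<theta> (\<lambda>x. z1 t x - of_real (c x) * v t x) (y t) + wip L \<theta> (yx t) (yx t) + wip L \<theta>' (yx t) (y t) = 0"
      by (rule weak_ibp[OF pos(1) \<theta>C e yxx[OF t] H10_derivative_hwd[OF H10s(5)[OF t]]])
    then show "wip L \<theta> (yx t) (yx t) \<le> \<bar>wip L \<theta> (z1 t) (y t)\<bar> + (\<bar>wip L (\<lambda>x. \<theta> x * c x) (v t) (y t)\<bar> + \<bar>wip L \<theta>' (yx t) (y t)\<bar>)"
      unfolding wip_minus_weight_left[OF w\<theta>(1) bw(2) L2s(14) L2s(5) L2s(10)] by linarith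
  qed
  have "null_on_average (\<lambda>t. (wip L \<theta> (z1 t) (y t) + wip L \<theta> (z t) (z t)) + \<bar>wip L \<theta> (z1 t) (y t)\<bar>)"
    by (intro null_add n1 null_wip_derivative(1)[OF w\<theta>(1) L2s(12,10,14,12) ddt(6,5) bd(12,10)]) simp_all
  then show "null_on_average (\<lambda>t. wip L \<theta> (z t) (z t))" by (rule null_mono) linarith
qed

lemma wip_half_bound:
  assumes w: "bounded_weight L w" and W: "bounded_weight L W" and f: "f \<in> L2 L" and g: "g \<in> L2 L"
    and le: "\<And>x. x \<in> {0<..<L} \<Longrightarrow> \<bar>w x\<bar> \<le> W x"
  shows "\<bar>wip L w f g\<bar> \<le> (wip L W f f + wip L W g g) / 2"
proof -
  have nn: "0 \<le> W x" if "x \<in> {0<..<L}" for x using le[OF that] by linarith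
  have young: "s * wip L w f g \<le> (wip L W f f + wip L W g g) / 2" if s: "s = 1 \<or> s = -1" for s
  proof -
    have pw: "0 \<le> W x * (Re (f x * cnj (f x))) + W x * Re (g x * cnj (g x)) - 2 * s * (w x * Re (f x * cnj (g x)))"
      if x: "x \<in> {0<..<L}" for x
    proof -
      have "\<bar>w x\<bar> * \<bar>Re (f x * cnj (g x))\<bar> \<le> W x * (cmod (f x) * cmod (g x))"
        by (rule mult_mono[OF le[OF x] abs_Re_le_cmod[of "f x * cnj (g x)", unfolded norm_mult complex_mod_cnj] nn[OF x] abs_ge_zero])
      then have "\<bar>s * (w x * Re (f x * cnj (g x)))\<bar> \<le> W x * (cmod (f x) * cmod (g x))"
        using s unfolding abs_mult by (elim disjE) simp_all
      moreover have "W x * (2 * (cmod (f x) * cmod (g x))) \<le> W x * ((cmod (f x))\<^sup>2 + (cmod (g x))\<^sup>2)"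
        using sum_squares_bound[of "cmod (f x)" "cmod (g x)"] nn[OF x] by (intro mult_left_mono) (auto simp: mult.assoc)
      ultimately show ?thesis unfolding Re_mult_cnj_self distrib_left by linarith
    qed
    have "0 \<le> (LINT x|lebesgue_on {0<..<L}. W x * (Re (f x * cnj (f x))) + W x * Re (g x * cnj (g x)) - 2 * s * (w x * Re (f x * cnj (g x))))"
      by (rule Bochner_Integration.integral_nonneg) (use pw in simp)
    also have "\<dots> = wip L W f f + wip L W g g - 2 * s * wip L w f g"
      unfolding wip_def
      by (simp only: Bochner_Integration.integral_diff[OF Bochner_Integration.integrable_add[OF wip_integrable[OF W f f] wip_integrable[OF W g g]]
            Bochner_Integration.integrable_mult_right[OF wip_integrable[OF w f g]]]
          Bochner_Integration.integral_add[OF wip_integrable[OF W f f] wip_integrable[OF W g g]] Bochner_Integration.integral_mult_right_zero)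
    finally show ?thesis by simp
  qed
  show ?thesis using young[of 1] young[of "-1"] by simp
qed

text \<open>Twice the energy of the time derivative of the orbit; \<open>energy0\<close> is twice the energy of the
  orbit.\<close>

definition energy1 :: "real \<Rightarrow> real" where
  "energy1 t = ip L (v t) (v t) + a * ip L (ux t) (ux t) + ip L (z t) (z t) + ip L (yx t) (yx t)"

definition energy0 :: "real \<Rightarrow> real" where
  "energy0 t = ip L (u t) (u t) + a * ip L (u0x t) (u0x t) + ip L (y t) (y t) + ip L (y0x t) (y0x t)"

text \<open>The multipliers \<open>q u\<^sub>x\<close> and \<open>q y\<^sub>x\<close> bound the integral of half of
  \<open>q'\<close> times the energy density by time derivatives, damping terms and the coupling terms with
  weight \<open>q c\<close>. The constant in front of \<open>\<bar>q\<bar>\<close> in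
  \<open>dominate\<close> is such that the coupling terms are absorbed pointwise, both in the parts of the
  energy without the factor \<open>a\<close> and in \<open>a \<bar>u\<^sub>x\<bar>\<^sup>2\<close>. Where
  \<open>q\<close> fails to dominate, \<open>\<psi>\<close> is positive and the local energy is null.\<close>

lemma null_energy1:
  assumes \<psi>: "local_weight \<alpha>2 \<alpha>3 \<psi> \<psi>'" and nv: "null_on_average (\<lambda>t. wip L \<psi> (v t) (v t))"
    and q: "C1 q q'" "q 0 = 0" "q L = 0" and \<delta>: "\<delta> > 0" and C: "C \<ge> 0"
    and dominate: "\<And>x. x \<in> {0<..<L} \<Longrightarrow> \<delta> - C * (\<psi> x * \<psi> x) \<le> (1/2) * q' x - (c0 * (1 + 1/a) / 2) * \<bar>q x\<bar>"
  shows "null_on_average energy1"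
proof -
  define \<theta> where "\<theta> = (\<lambda>x. \<psi> x * \<psi> x)"
  define \<kappa> where "\<kappa> = c0 * (1 + 1/a) / 2"
  note loc = null_local_energy[OF \<psi> nv, folded \<theta>_def]
  have w\<theta>: "bounded_weight L \<theta>"
    using C1_weight(1)[of \<psi> \<psi>'] \<psi> unfolding \<theta>_def local_weight_def by (intro bounded_weight_mult) blast+
  note w = C1_weight[OF q(1)]
  let ?qb = "\<lambda>x. q x * b x" and ?qbc = "\<lambda>x. q x * b x * c x" and ?q'b = "\<lambda>x. q' x * b x" and ?q'bb = "\<lambda>x. q' x * b x * b x"
    and ?qc = "\<lambda>x. q x * c x"
  have ws: "bounded_weight L ?qb" "bounded_weight L ?qbc" "bounded_weight L ?q'b" "bounded_weight L ?q'bb" "bounded_weight L ?qc"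
    using w by (auto intro!: bounded_weight_mult)
  have r1: "null_on_average (\<lambda>t. \<bar>wip L ?q'b (ux t) (vx t)\<bar>)"
    by (rule null_wip_weighted[OF w(2) bw(1) b_nonneg refl L2s(4) L2s(6) bd(4) null_vx])
  have r2: "null_on_average (\<lambda>t. \<bar>wip L ?q'bb (vx t) (vx t)\<bar>)"
    by (rule null_wip_self_weighted[OF ws(3) bw(1) b_nonneg refl L2s(6) null_vx])
  have r3: "null_on_average (\<lambda>t. \<bar>wip L ?qb (v1 t) (vx t)\<bar>)"
    by (rule null_wip_weighted[OF w(1) bw(1) b_nonneg refl L2s(7) L2s(6) bd(7) null_vx])
  have r4: "null_on_average (\<lambda>t. \<bar>wip L ?qbc (z t) (vx t)\<bar>)"
    by (rule null_wip_weighted[OF ws(5) bw(1) b_nonneg _ L2s(12) L2s(6) bd(12) null_vx]) simp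
  let ?R = "\<lambda>t. \<bar>wip L ?q'b (ux t) (vx t)\<bar> + ((1/(2*a)) * \<bar>wip L ?q'bb (vx t) (vx t)\<bar> + (1/a) * (\<bar>wip L ?qb (v1 t) (vx t)\<bar> + \<bar>wip L ?qbc (z t) (vx t)\<bar>))"
  let ?D = "\<lambda>t. - (wip L q (v1 t) (ux t) + wip L q (v t) (vx t)) + - (wip L q (z1 t) (yx t) + wip L q (z t) (zx t))"
  let ?E\<theta> = "\<lambda>t. wip L \<theta> (v t) (v t) + (a * wip L \<theta> (ux t) (ux t) + (wip L \<theta> (z t) (z t) + wip L \<theta> (yx t) (yx t)))"
  have "null_on_average (\<lambda>t. (1/\<delta>) * ((?R t + ?D t) + C * ?E\<theta> t))"
    using pos C \<delta>
    by (intro null_cmult null_add r1 r2 r3 r4 loc null_wip_derivative(2)[OF w(1) L2s(5,4,7,6) ddt(3,8) bd(5,4)]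
        null_wip_derivative(2)[OF w(1) L2s(12,11,14,13) ddt(6,10) bd(12,11)]) simp_all
  then show ?thesis
  proof (rule null_mono)
    fix t :: real assume t: "t > 0"
    let ?F = "\<lambda>x. of_real a * ux t x + of_real (b x) * vx t x"
    let ?G = "\<lambda>x. v1 t x + of_real (c x) * z t x"
    have FL: "?F \<in> L2 L" and GL: "?G \<in> L2 L" by (rule L2_plus(3)[OF bw(1) L2s(4) L2s(6)], rule L2_plus(1)[OF bw(2) L2s(7) L2s(12)])
    define U where "U = wip L q' (ux t) (ux t)"
    \<comment> \<open>The multiplier for the first equation is \<open>q\<close> times the flux, because
         \<open>u\<^sub>x\<close> alone need not have a weak derivative.\<close>
    have "wip L q ?G ?F + wip L q ?F ?G + wip L q' ?F ?F = 0"
      by (rule weak_ibp[OF pos(1) q flux1[OF t] flux1[OF t]])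
    then have "2 * wip L q ?G ?F + wip L q' ?F ?F = 0" unfolding wip_commute[of L q ?F ?G] by simp
    moreover have "wip L q ?G ?F = a * (wip L q (v1 t) (ux t) + wip L ?qc (z t) (ux t)) + (wip L ?qb (v1 t) (vx t) + wip L ?qbc (z t) (vx t))"
      unfolding wip_flux_right[OF w(1) bw(1) L2s(4) L2s(6) GL] wip_plus_left[OF w(1) bw(2) L2s(7) L2s(12) L2s(4)]
        wip_plus_left[OF ws(1) bw(2) L2s(7) L2s(12) L2s(6)] ..
    moreover have "wip L q' ?F ?F = a * (a * U + wip L ?q'b (ux t) (vx t)) + (a * wip L ?q'b (ux t) (vx t) + wip L ?q'bb (vx t) (vx t))"
      unfolding wip_flux_right[OF w(2) bw(1) L2s(4) L2s(6) FL] wip_flux_left[OF w(2) bw(1) L2s(4) L2s(6) L2s(4)]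
        wip_flux_left[OF ws(3) bw(1) L2s(4) L2s(6) L2s(6)] U_def wip_commute[of L ?q'b "vx t" "ux t"] ..
    ultimately have "a * (2 * wip L q (v1 t) (ux t) + 2 * wip L ?qc (z t) (ux t) + a * U + 2 * wip L ?q'b (ux t) (vx t))
        + 2 * (wip L ?qb (v1 t) (vx t) + wip L ?qbc (z t) (vx t)) + wip L ?q'bb (vx t) (vx t) = 0"
      by (simp add: algebra_simps)
    then have "2 * wip L q (v1 t) (ux t) + 2 * wip L ?qc (z t) (ux t) + a * U + 2 * wip L ?q'b (ux t) (vx t)
        + 2 * ((1/a) * (wip L ?qb (v1 t) (vx t) + wip L ?qbc (z t) (vx t))) + (1/a) * wip L ?q'bb (vx t) (vx t) = 0"
      using pos(2) by (simp add: field_simps)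
    moreover have "- ((1/a) * (wip L ?qb (v1 t) (vx t) + wip L ?qbc (z t) (vx t))) \<le> (1/a) * (\<bar>wip L ?qb (v1 t) (vx t)\<bar> + \<bar>wip L ?qbc (z t) (vx t)\<bar>)"
      unfolding mult_minus_right[symmetric] using pos(2) by (intro mult_left_mono) auto
    moreover have "- ((1/a) * wip L ?q'bb (vx t) (vx t)) \<le> 2 * ((1/(2*a)) * \<bar>wip L ?q'bb (vx t) (vx t)\<bar>)"
    proof -
      have "- ((1/a) * wip L ?q'bb (vx t) (vx t)) \<le> (1/a) * \<bar>wip L ?q'bb (vx t) (vx t)\<bar>"
        unfolding mult_minus_right[symmetric] using pos(2) by (intro mult_left_mono) auto
      then show ?thesis by simp
    qed
    ultimately have k1: "a * U / 2 + wip L ?qc (z t) (ux t) \<le> - wip L q (v1 t) (ux t) + ?R t"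
      by linarith
    \<comment> \<open>The kinetic terms, from integrating \<open>q\<close> times the space derivative of
         \<open>\<bar>v\<bar>\<^sup>2\<close> and \<open>\<bar>z\<bar>\<^sup>2\<close>.\<close>
    have k2: "wip L q' (v t) (v t) / 2 = - wip L q (v t) (vx t)"
      using weak_ibp[OF pos(1) q H10_derivative_hwd[OF H10s(3)[OF t]] H10_derivative_hwd[OF H10s(3)[OF t]]]
      unfolding wip_commute[of L q "vx t" "v t"] by simp
    have k3: "wip L q' (z t) (z t) / 2 = - wip L q (z t) (zx t)"
      using weak_ibp[OF pos(1) q H10_derivative_hwd[OF H10s(6)[OF t]] H10_derivative_hwd[OF H10s(6)[OF t]]]
      unfolding wip_commute[of L q "zx t" "z t"] by simp
    have k4: "wip L q' (yx t) (yx t) / 2 - wip L ?qc (v t) (yx t) = - wip L q (z1 t) (yx t)"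
      using weak_ibp[OF pos(1) q yxx[OF t] yxx[OF t]]
      unfolding wip_commute[of L q "yx t"] wip_minus_weight_left[OF w(1) bw(2) L2s(14) L2s(5) L2s(11)] by simp
    let ?W = "\<lambda>x. c0 * \<bar>q x\<bar>"
    have W: "bounded_weight L ?W" "bounded_weight L (\<lambda>x. \<bar>q x\<bar>)" using w(1) by (auto intro!: bounded_weight_mult bounded_weight_abs)
    have qc: "\<bar>q x * c x\<bar> \<le> c0 * \<bar>q x\<bar>" for x
      using mult_right_mono[OF c_bounds(2)[of x] abs_ge_zero[of "q x"]] c_bounds(1)[of x] by (simp add: abs_mult mult.commute)
    \<comment> \<open>Each coupling term is split evenly between its two factors.\<close>
    have h1: "\<bar>wip L ?qc (z t) (ux t)\<bar> \<le> (c0 * wip L (\<lambda>x. \<bar>q x\<bar>) (z t) (z t) + c0 * wip L (\<lambda>x. \<bar>q x\<bar>) (ux t) (ux t)) / 2"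
      using wip_half_bound[OF ws(5) W(1) L2s(12) L2s(4) qc, of t t] unfolding wip_scale .
    have h2: "\<bar>wip L ?qc (v t) (yx t)\<bar> \<le> (c0 * wip L (\<lambda>x. \<bar>q x\<bar>) (v t) (v t) + c0 * wip L (\<lambda>x. \<bar>q x\<bar>) (yx t) (yx t)) / 2"
      using wip_half_bound[OF ws(5) W(1) L2s(5) L2s(11) qc, of t t] unfolding wip_scale .
    have low: "\<delta> * ip L f f - C * wip L \<theta> f f \<le> wip L q' f f / 2 - \<kappa> * wip L (\<lambda>x. \<bar>q x\<bar>) f f" if f: "f \<in> L2 L" for f
    proof -
      have wl: "bounded_weight L (\<lambda>x. \<delta> * 1)" "bounded_weight L (\<lambda>x. C * \<theta> x)" "bounded_weight L (\<lambda>x. (1/2) * q' x)" "bounded_weight L (\<lambda>x. \<kappa> * \<bar>q x\<bar>)"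
        by (intro bounded_weight_mult bounded_weight_const w w\<theta> W)+
      have "wip L (\<lambda>x. \<delta> * 1 - C * \<theta> x) f f \<le> wip L (\<lambda>x. (1/2) * q' x - \<kappa> * \<bar>q x\<bar>) f f"
      proof (rule wip_mono_weight[OF bounded_weight_diff[OF wl(1,2)] bounded_weight_diff[OF wl(3,4)] f])
        show "\<delta> * 1 - C * \<theta> x \<le> (1/2) * q' x - \<kappa> * \<bar>q x\<bar>" if "x \<in> {0<..<L}" for x
          using dominate[OF that] by (simp add: \<theta>_def \<kappa>_def)
      qed
      then show ?thesis unfolding wip_diff_weight[OF wl(1,2) f f] wip_diff_weight[OF wl(3,4) f f] wip_scale by simp
    qed
    have Q: "0 \<le> wip L (\<lambda>x. \<bar>q x\<bar>) f f" for f by (rule wip_nonneg) simp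
    have \<kappa>: "\<kappa> \<ge> c0 / 2" "a * \<kappa> \<ge> c0 / 2" using pos by (auto simp: \<kappa>_def field_simps)
    have l1: "\<delta> * ip L f f - C * wip L \<theta> f f \<le> wip L q' f f / 2 - (c0 * wip L (\<lambda>x. \<bar>q x\<bar>) f f) / 2" if f: "f \<in> L2 L" for f
      using low[OF f] mult_right_mono[OF \<kappa>(1) Q[of f]] by simp
    have l2: "\<delta> * (a * ip L f f) - C * (a * wip L \<theta> f f) \<le> a * wip L q' f f / 2 - (c0 * wip L (\<lambda>x. \<bar>q x\<bar>) f f) / 2" if f: "f \<in> L2 L" for f
    proof -
      have "a * (\<delta> * ip L f f - C * wip L \<theta> f f) \<le> a * (wip L q' f f / 2 - \<kappa> * wip L (\<lambda>x. \<bar>q x\<bar>) f f)"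
        using low[OF f] pos(2) by (intro mult_left_mono) auto
      moreover have "c0 / 2 * wip L (\<lambda>x. \<bar>q x\<bar>) f f \<le> (a * \<kappa>) * wip L (\<lambda>x. \<bar>q x\<bar>) f f" by (rule mult_right_mono[OF \<kappa>(2) Q])
      ultimately show ?thesis by (simp add: algebra_simps)
    qed
    have "\<delta> * energy1 t - C * ?E\<theta> t \<le> ?R t + ?D t"
    proof -
      \<comment> \<open>The final bookkeeping is linear in the pairings, which are abstracted to real variables.\<close>
      have sum: "dE - cE \<le> R + (- (A + B) + - (G + F))"
        if "dE = d1 + d2 + d3 + d4" "cE = c1 + (c2 + (c3 + c4))" "d1 - c1 \<le> qv / 2 - Qv / 2" "d3 - c3 \<le> qz / 2 - Qz / 2"
          "d4 - c4 \<le> qy / 2 - Qy / 2" "d2 - c2 \<le> qu / 2 - Qu / 2" "- W1 \<le> (Qz + Qu) / 2" "W2 \<le> (Qv + Qy) / 2"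
          "qu / 2 + W1 \<le> - A + R" "qv / 2 = - B" "qz / 2 = - F" "qy / 2 - W2 = - G"
        for dE cE d1 d2 d3 d4 c1 c2 c3 c4 qv qz qy qu Qv Qz Qy Qu W1 W2 A B F G R :: real
        using that by (simp add: field_simps)
      have "\<delta> * energy1 t = \<delta> * ip L (v t) (v t) + \<delta> * (a * ip L (ux t) (ux t)) + \<delta> * ip L (z t) (z t) + \<delta> * ip L (yx t) (yx t)"
        unfolding energy1_def distrib_left ..
      moreover have "C * ?E\<theta> t = C * wip L \<theta> (v t) (v t) + (C * (a * wip L \<theta> (ux t) (ux t)) + (C * wip L \<theta> (z t) (z t) + C * wip L \<theta> (yx t) (yx t)))"
        unfolding distrib_left ..
      ultimately show ?thesis
        by (rule sum[OF _ _ l1[OF L2s(5)[of t]] l1[OF L2s(12)[of t]] l1[OF L2s(11)[of t]] l2[OF L2s(4)[of t]]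
          abs_le_D2[OF h1] abs_le_D1[OF h2] k1[unfolded U_def] k2 k3 k4])
    qed
    then have "\<delta> * energy1 t \<le> (?R t + ?D t) + C * ?E\<theta> t" by linarith
    then have "(1/\<delta>) * (\<delta> * energy1 t) \<le> (1/\<delta>) * ((?R t + ?D t) + C * ?E\<theta> t)" using \<delta> by (intro mult_left_mono) auto
    then show "energy1 t \<le> (1/\<delta>) * ((?R t + ?D t) + C * ?E\<theta> t)" using \<delta> by simp
  qed
qed

text \<open>Poincare's inequality makes \<open>u\<close> and \<open>y\<close> null. The equations of the orbit, paired
  with \<open>u0\<close> and \<open>y0\<close>, then express the gradients of the displacements by pairings
  of null functions with bounded ones.\<close>

lemma null_energy0:
  assumes E1: "null_on_average energy1" shows "null_on_average energy0"
proof -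
  have nn: "0 \<le> a * ip L f f" for f using pos by simp
  have n: "null_on_average (\<lambda>t. ip L (v t) (v t))" "null_on_average (\<lambda>t. ip L (z t) (z t))" "null_on_average (\<lambda>t. ip L (yx t) (yx t))"
    by (rule null_mono[OF E1], unfold energy1_def, use nn ip_nonneg in \<open>smt (verit)\<close>)+
  have "null_on_average (\<lambda>t. a * ip L (ux t) (ux t))"
    by (rule null_mono[OF E1], unfold energy1_def, use nn ip_nonneg in \<open>smt (verit)\<close>)
  then have nux: "null_on_average (\<lambda>t. ip L (ux t) (ux t))" using null_cmult[of _ "1/a"] pos by fastforce
  have P: "null_on_average (\<lambda>t. ip L (f t) (f t))"
    if f: "\<And>t. t > 0 \<Longrightarrow> H10_derivative L (f t) (fx t)" and fx: "null_on_average (\<lambda>t. ip L (fx t) (fx t))" for f fx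
  proof (rule null_mono[OF null_cmult[OF fx, of "L\<^sup>2"]])
    fix t :: real assume "t > 0"
    then have "(nrm L (f t))\<^sup>2 \<le> (L * nrm L (fx t))\<^sup>2" by (intro power_mono Poincare[OF pos(1) f]) auto
    then show "ip L (f t) (f t) \<le> L\<^sup>2 * ip L (fx t) (fx t)" by (simp add: nrm_power2 power_mult_distrib)
  qed simp
  have nu: "null_on_average (\<lambda>t. ip L (u t) (u t))" by (rule P[OF H10s(2) nux])
  have ny: "null_on_average (\<lambda>t. ip L (y t) (y t))" by (rule P[OF H10s(5) n(3)])
  have weighted: "null_on_average (\<lambda>t. \<bar>wip L w (f t) (g t)\<bar>)"
    if "bounded_weight L w" "\<And>t. f t \<in> L2 L" "\<And>t. g t \<in> L2 L" "\<And>t. t > 0 \<Longrightarrow> nrm L (g t) \<le> M" "null_on_average (\<lambda>t. ip L (f t) (f t))" for w f g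
    using null_self_product(2)[OF bounded_weight_const[of L 1] _ that(1) _ that(3) that(4) that(2) that(5), of w] by simp
  have s1: "null_on_average (\<lambda>t. \<bar>ip L (v t) (u0 t)\<bar> + (\<bar>wip L c (y t) (u0 t)\<bar> + \<bar>wip L b (ux t) (u0x t)\<bar>))"
    by (intro null_add weighted[OF bounded_weight_const L2s(5) L2s(1) bd(1) n(1)] weighted[OF bw(2) L2s(10) L2s(1) bd(1) ny]
        weighted[OF bw(1) L2s(4) L2s(2) bd(2) nux])
  have s2: "null_on_average (\<lambda>t. \<bar>ip L (z t) (y0 t)\<bar> + \<bar>wip L c (u t) (y0 t)\<bar>)"
    by (intro null_add weighted[OF bounded_weight_const L2s(12) L2s(8) bd(8) n(2)] weighted[OF bw(2) L2s(3) L2s(8) bd(8) nu])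
  show ?thesis
  proof (rule null_mono[OF null_add[OF null_add[OF nu ny] null_add[OF s1 s2]]])
    fix t :: real assume t: "t > 0"
    have "ip L (v t) (u0 t) + wip L c (y t) (u0 t) = - (a * ip L (u0x t) (u0x t) + wip L b (ux t) (u0x t))"
      using H10_ibp[OF flux0[OF t] H10s(1)[OF t]]
      unfolding wip_plus_left[OF bounded_weight_const bw(2) L2s(5) L2s(10) L2s(1)]
        wip_flux_left[OF bounded_weight_const bw(1) L2s(2) L2s(4) L2s(2)] by simp
    moreover have "ip L (z t) (y0 t) - wip L c (u t) (y0 t) = - ip L (y0x t) (y0x t)"
      using H10_ibp[OF y0xx[OF t] H10s(4)[OF t]]
      unfolding wip_minus_weight_left[OF bounded_weight_const bw(2) L2s(12) L2s(3) L2s(8)] by simp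
    ultimately show "energy0 t \<le> (ip L (u t) (u t) + ip L (y t) (y t)) +
      ((\<bar>ip L (v t) (u0 t)\<bar> + (\<bar>wip L c (y t) (u0 t)\<bar> + \<bar>wip L b (ux t) (u0x t)\<bar>)) + (\<bar>ip L (z t) (y0 t)\<bar> + \<bar>wip L c (u t) (y0 t)\<bar>))"
      unfolding energy0_def by linarith
  qed
qed

end

section \<open>Choice of the multipliers\<close>

lemma DERIV_positive_part_square: "((\<lambda>s. (max 0 s)\<^sup>2) has_real_derivative 2 * max 0 s) (at (s::real))"
proof (cases s "0::real" rule: linorder_cases)
  case less
  have "((\<lambda>s. 0) has_real_derivative 0) (at s)" by simp
  then have "((\<lambda>s. (max 0 s)\<^sup>2) has_real_derivative 0) (at s)"
    by (rule has_field_derivative_transform_within_open[where S="{..<0}"]) (use less in auto)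
  then show ?thesis using less by simp
next
  case greater
  have "((\<lambda>s. s\<^sup>2) has_real_derivative 2 * s) (at s)" by (auto intro!: derivative_eq_intros)
  then have "((\<lambda>s. (max 0 s)\<^sup>2) has_real_derivative 2 * s) (at s)"
    by (rule has_field_derivative_transform_within_open[where S="{0<..}"]) (use greater in auto)
  then show ?thesis using greater by simp
next
  case equal
  have "((\<lambda>h. (max 0 h)\<^sup>2 / h) \<longlongrightarrow> 0) (at (0::real))"
  proof (rule Lim_null_comparison)
    show "\<forall>\<^sub>F h in at 0. norm ((max 0 h)\<^sup>2 / h) \<le> \<bar>h::real\<bar>"
      by (intro always_eventually allI) (auto simp: max_def power2_eq_square)
    show "((\<lambda>h::real. \<bar>h\<bar>) \<longlongrightarrow> 0) (at 0)" using tendsto_rabs[OF tendsto_ident_at[of 0 UNIV]] by simp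
  qed
  then have "((\<lambda>s. (max 0 s)\<^sup>2) has_real_derivative 0) (at (0::real))" unfolding DERIV_def by simp
  then show ?thesis using equal by simp
qed

lemma C1_bump:
  assumes "l < (r::real)"
  obtains \<psi> \<psi>' :: "real \<Rightarrow> real" where "C1 \<psi> \<psi>'" "\<And>x. 0 \<le> \<psi> x" "\<And>x. x \<notin> {l<..<r} \<Longrightarrow> \<psi> x = 0" "\<And>x. x \<notin> {l<..<r} \<Longrightarrow> \<psi>' x = 0"
    "\<And>x. x \<in> {l<..<r} \<Longrightarrow> \<psi> x > 0"
proof -
  define s where "s x = (x - l) * (r - x)" for x
  define \<psi> where "\<psi> x = (max 0 (s x))\<^sup>2" for x
  define \<psi>' where "\<psi>' x = 2 * max 0 (s x) * ((r - x) - (x - l))" for x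
  have sp: "s x > 0 \<longleftrightarrow> x \<in> {l<..<r}" for x
    using assms by (auto simp: s_def zero_less_mult_iff)
  have "(\<psi> has_real_derivative \<psi>' x) (at x)" for x
  proof -
    have "(s has_real_derivative ((r - x) - (x - l))) (at x)"
      unfolding s_def by (auto intro!: derivative_eq_intros)
    then show ?thesis unfolding \<psi>_def \<psi>'_def by (rule DERIV_chain2[OF DERIV_positive_part_square])
  qed
  moreover have "continuous_on UNIV \<psi>'" unfolding \<psi>'_def s_def by (intro continuous_intros)
  ultimately have "C1 \<psi> \<psi>'" by (simp add: C1_def has_real_derivative_iff_has_vector_derivative)
  moreover have "\<psi> x = 0" "\<psi>' x = 0" if "x \<notin> {l<..<r}" for x
  proof -
    have "\<not> s x > 0" using sp[of x] that by blast
    then have "max 0 (s x) = 0" by simp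
    then show "\<psi> x = 0" "\<psi>' x = 0" by (simp_all add: \<psi>_def \<psi>'_def)
  qed
  moreover have "\<psi> x > 0" if "x \<in> {l<..<r}" for x using sp[of x] that by (simp add: \<psi>_def)
  moreover have "0 \<le> \<psi> x" for x by (simp add: \<psi>_def)
  ultimately show ?thesis using that[of \<psi> \<psi>'] by blast
qed

lemma C1_shift: "C1 f f' \<Longrightarrow> C1 (\<lambda>x. f (x - s)) (\<lambda>x. f' (x - (s::real)))"
  for f :: "real \<Rightarrow> real"
proof -
  assume f: "C1 f f'"
  have "((\<lambda>x. f (x - s)) has_real_derivative f' (x - s) * 1) (at x)" for x
    using C1_derivative[OF f] unfolding has_real_derivative_iff_has_vector_derivative[symmetric]
    by (intro DERIV_chain2[where f=f]) (auto intro!: derivative_eq_intros)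
  moreover have "continuous_on UNIV (\<lambda>x. f' (x - s))"
    by (rule continuous_on_compose2[OF C1_continuous'[OF f]]) (auto intro!: continuous_intros)
  ultimately show ?thesis unfolding C1_def has_real_derivative_iff_has_vector_derivative by simp
qed

lemma C1_diff: "C1 F F' \<Longrightarrow> C1 G G' \<Longrightarrow> C1 (\<lambda>x. F x - G x) (\<lambda>x. F' x - G' x)"
  unfolding C1_def by (auto intro!: has_vector_derivative_diff continuous_intros)

text \<open>The weight \<open>\<psi>\<close> is a translate of \<open>\<eta>\<close> and so has the same integral; the
  primitive of the difference is the integral of \<open>\<eta>\<close> over a moving window, which vanishes
  outside \<open>(\<alpha>\<^sub>1,\<alpha>\<^sub>3)\<close>.\<close>

lemma transfer_weights:
  assumes "0 < \<alpha>1" "\<alpha>1 < \<alpha>2" "\<alpha>2 < (\<alpha>3::real)"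
  obtains \<eta> \<eta>' \<psi> \<psi>' p :: "real \<Rightarrow> real" where
    "C1 \<eta> \<eta>'" "\<And>x. 0 \<le> \<eta> x" "\<And>x. x \<notin> {\<alpha>1<..<\<alpha>2} \<Longrightarrow> \<eta> x = 0 \<and> \<eta>' x = 0"
    "C1 \<psi> \<psi>'" "\<And>x. 0 \<le> \<psi> x" "\<And>x. x \<notin> {\<alpha>2<..<\<alpha>3} \<Longrightarrow> \<psi> x = 0 \<and> \<psi>' x = 0"
    "\<And>x. x \<in> {\<alpha>2<..<\<alpha>2 + min (\<alpha>2 - \<alpha>1) (\<alpha>3 - \<alpha>2)} \<Longrightarrow> \<psi> x > 0"
    "C1 p (\<lambda>x. \<eta> x - \<psi> x)" "\<And>x. x \<notin> {\<alpha>1<..<\<alpha>3} \<Longrightarrow> p x = 0"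
proof -
  \<comment> \<open>A bump of width \<open>h\<close> fits to the right of both \<open>\<alpha>\<^sub>1\<close> and
       \<open>\<alpha>\<^sub>2\<close>.\<close>
  define h where "h = min (\<alpha>2 - \<alpha>1) (\<alpha>3 - \<alpha>2)"
  define s where "s = \<alpha>2 - \<alpha>1"
  have h: "h > 0" "\<alpha>1 + h \<le> \<alpha>2" "\<alpha>2 + h \<le> \<alpha>3" using assms by (auto simp: h_def)
  obtain \<eta> \<eta>' :: "real \<Rightarrow> real" where \<eta>: "C1 \<eta> \<eta>'" "\<And>x. 0 \<le> \<eta> x" "\<And>x. x \<notin> {\<alpha>1<..<\<alpha>1+h} \<Longrightarrow> \<eta> x = 0"
     "\<And>x. x \<notin> {\<alpha>1<..<\<alpha>1+h} \<Longrightarrow> \<eta>' x = 0" "\<And>x. x \<in> {\<alpha>1<..<\<alpha>1+h} \<Longrightarrow> \<eta> x > 0"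
    using C1_bump[of \<alpha>1 "\<alpha>1 + h"] h(1) by (metis less_add_same_cancel1)
  define \<psi> \<psi>' where "\<psi> x = \<eta> (x - s)" and "\<psi>' x = \<eta>' (x - s)" for x
  have z: "\<eta> x = 0" if "x \<le> \<alpha>1" for x using \<eta>(3)[of x] that by simp
  obtain \<Phi> :: "real \<Rightarrow> real" where \<Phi>: "C1 \<Phi> \<eta>" "\<And>x. x \<le> 0 \<Longrightarrow> \<Phi> x = 0" "\<And>x. \<Phi> x = integral {0..x} \<eta>"
  proof (rule antiderivative[OF C1_continuous[OF \<eta>(1)]])
    show "\<eta> x = 0" if "x \<le> 0" for x using z[of x] that assms(1) by linarith
  qed blast
  define p where "p x = \<Phi> x - \<Phi> (x - s)" for x
  have left: "\<Phi> x = 0" if "x \<le> \<alpha>1" for x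
  proof -
    have "integral {0..x} \<eta> = integral {0..x} (\<lambda>x::real. 0::real)"
      by (rule Henstock_Kurzweil_Integration.integral_cong) (use that z in auto)
    then show ?thesis by (simp add: \<Phi>(3))
  qed
  obtain k :: real where right: "\<And>x. x \<in> {\<alpha>1 + h..} \<Longrightarrow> \<Phi> x = k"
  proof (rule has_vector_derivative_zero_constant[of "{\<alpha>1 + h..}" \<Phi>])
    show "convex {\<alpha>1 + h..}" by simp
    show "(\<Phi> has_vector_derivative 0) (at x within {\<alpha>1 + h..})" if "x \<in> {\<alpha>1 + h..}" for x
      using has_vector_derivative_at_within[OF C1_derivative[OF \<Phi>(1), of x]] \<eta>(3)[of x] that by simp
  qed auto
  show ?thesis
  proof (rule that[of \<eta> \<eta>' \<psi> \<psi>' p])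
    show "C1 \<eta> \<eta>'" by (rule \<eta>(1))
    show "0 \<le> \<eta> x" "0 \<le> \<psi> x" for x using \<eta>(2) by (auto simp: \<psi>_def)
    show "\<eta> x = 0 \<and> \<eta>' x = 0" if "x \<notin> {\<alpha>1<..<\<alpha>2}" for x using \<eta>(3,4)[of x] that h by auto
    show "C1 \<psi> \<psi>'" unfolding \<psi>_def \<psi>'_def by (rule C1_shift[OF \<eta>(1)])
    show "\<psi> x = 0 \<and> \<psi>' x = 0" if "x \<notin> {\<alpha>2<..<\<alpha>3}" for x
      using \<eta>(3,4)[of "x - s"] that h by (auto simp: \<psi>_def \<psi>'_def s_def)
    show "\<psi> x > 0" if "x \<in> {\<alpha>2<..<\<alpha>2 + min (\<alpha>2 - \<alpha>1) (\<alpha>3 - \<alpha>2)}" for x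
      unfolding \<psi>_def by (rule \<eta>(5)) (use that in \<open>auto simp: s_def h_def\<close>)
    show "C1 p (\<lambda>x. \<eta> x - \<psi> x)" unfolding p_def \<psi>_def by (rule C1_diff[OF \<Phi>(1) C1_shift[OF \<Phi>(1)]])
    show "p x = 0" if "x \<notin> {\<alpha>1<..<\<alpha>3}" for x
    proof (cases "x \<le> \<alpha>1")
      case True then show ?thesis using left[of x] left[of "x - s"] assms by (simp add: p_def s_def)
    next
      case False
      then have "x \<ge> \<alpha>3" using that by simp
      then have "x \<in> {\<alpha>1 + h..}" "x - s \<in> {\<alpha>1 + h..}" using h assms by (auto simp: s_def)
      then show ?thesis using right by (simp add: p_def)
    qed
  qed
qed

text \<open>The multiplier is a cubic with zeros at 0, \<open>m\<close> and \<open>L\<close>, times a Gaussian centred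
  at \<open>m\<close>. Near 0 and \<open>L\<close> the cubic itself is increasing; in between, the Gaussian
  contributes to \<open>q'\<close> its product with \<open>2 k (x - m)\<^sup>2 x (L - x)\<close>, which for
  large \<open>k\<close> beats both the decrease of the cubic and the term with
  \<open>\<bar>q\<bar>\<close>.\<close>

lemma global_weight:
  assumes L: "L > 0" and m: "0 < m" "m < L" and d: "d > 0" and \<kappa>: "\<kappa> \<ge> 0"
  obtains q q' \<delta> where "C1 q (q' :: real \<Rightarrow> real)" "q 0 = 0" "q L = 0" "\<delta> > 0"
    "\<And>x. x \<in> {0<..<L} \<Longrightarrow> d \<le> \<bar>x - m\<bar> \<Longrightarrow> \<delta> \<le> (1/2) * q' x - \<kappa> * \<bar>q x\<bar>"
proof -
  \<comment> \<open>Chosen so that \<open>k * t\<^sup>2 - \<kappa> * t \<ge> 1\<close> for all \<open>t \<ge> d\<close>.\<close>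
  define k where "k = (1/d + \<kappa>) / d"
  define r where "r x = exp (- k * (x - m)\<^sup>2)" for x
  define P where "P x = x * (L - x) * (m - x)" for x
  define P' where "P' x = (L - 2 * x) * (m - x) - x * (L - x)" for x
  define q where "q x = P x * r x" for x
  define q' where "q' x = (P' x - 2 * k * (x - m) * P x) * r x" for x
  define \<mu> where "\<mu> = min m (L - m)"
  define \<delta> where "\<delta> = exp (- k * L\<^sup>2) * (\<mu> * L / 4)"
  have k: "k > 0" using d \<kappa> by (auto simp: k_def intro!: divide_pos_pos add_pos_nonneg)
  have \<mu>: "\<mu> > 0" "\<mu> \<le> m" "\<mu> \<le> L - m" using m by (auto simp: \<mu>_def)
  have "(P has_real_derivative P' x) (at x)" for x
    unfolding P_def P'_def by (auto intro!: derivative_eq_intros simp: algebra_simps)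
  moreover have "(r has_real_derivative (- 2 * k * (x - m)) * r x) (at x)" for x
    unfolding r_def by (auto intro!: derivative_eq_intros simp: algebra_simps)
  ultimately have "(q has_real_derivative P' x * r x + (- 2 * k * (x - m)) * r x * P x) (at x)" for x
    unfolding q_def by (rule DERIV_mult)
  moreover have "P' x * r x + (- 2 * k * (x - m)) * r x * P x = q' x" for x by (simp add: q'_def algebra_simps)
  ultimately have "(q has_real_derivative q' x) (at x)" for x by metis
  moreover have "continuous_on UNIV q'" unfolding q'_def P'_def P_def r_def by (intro continuous_intros)
  ultimately have C: "C1 q q'" by (simp add: C1_def has_real_derivative_iff_has_vector_derivative)
  have main: "\<delta> \<le> (1/2) * q' x - \<kappa> * \<bar>q x\<bar>" if x: "x \<in> {0<..<L}" and dx: "d \<le> \<bar>x - m\<bar>" for x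
  proof -
    define t where "t = \<bar>x - m\<bar>"
    define w where "w = x * (L - x)"
    have w: "w > 0" using x by (simp add: w_def)
    have r0: "r x > 0" by (simp add: r_def)
    have "k * d - \<kappa> = 1 / d" using d by (simp add: k_def)
    moreover have "k * d \<le> k * t" using dx k by (simp add: t_def)
    ultimately have kt: "1 / d \<le> k * t - \<kappa>" by simp
    have "d * (1 / d) \<le> t * (k * t - \<kappa>)"
      using dx kt d by (intro mult_mono) (auto simp: t_def)
    then have one: "1 \<le> k * t\<^sup>2 - \<kappa> * t" using d by (simp add: power2_eq_square algebra_simps)
    have aq: "\<bar>q x\<bar> = w * t * r x"
      using w r0 by (simp add: q_def P_def w_def[symmetric] t_def abs_mult abs_minus_commute)
    have t2: "t\<^sup>2 = (x - m)\<^sup>2" by (simp add: t_def)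
    have Pk: "- (2 * k * (x - m) * P x) = 2 * k * w * t\<^sup>2" unfolding t2 P_def w_def by (simp add: power2_eq_square algebra_simps)
    have "(1/2) * q' x - \<kappa> * \<bar>q x\<bar> = (P' x / 2 + w * (k * t\<^sup>2 - \<kappa> * t)) * r x"
      unfolding aq q'_def using Pk by (simp add: algebra_simps)
    moreover have "\<mu> * L / 4 \<le> P' x / 2 + w * (k * t\<^sup>2 - \<kappa> * t)"
    proof -
      \<comment> \<open>This identity shows that \<open>P' + 2 w\<close> is bounded below by a positive constant on all of
           \<open>(0,L)\<close>.\<close>
      have "L * P' x + 2 * L * w = m * (L - x)\<^sup>2 + (L - m) * x\<^sup>2"
        by (simp add: P'_def w_def power2_eq_square algebra_simps)
      also have "\<dots> \<ge> \<mu> * (L - x)\<^sup>2 + \<mu> * x\<^sup>2" using \<mu> by (intro add_mono mult_right_mono) auto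
      also have "\<mu> * (L - x)\<^sup>2 + \<mu> * x\<^sup>2 = \<mu> * ((L - x)\<^sup>2 + x\<^sup>2)" by (simp add: distrib_left)
      also have "\<mu> * ((L - x)\<^sup>2 + x\<^sup>2) \<ge> \<mu> * (L\<^sup>2 / 2)"
      proof (rule mult_left_mono)
        have "0 \<le> (L - 2 * x)\<^sup>2" by simp
        then show "L\<^sup>2 / 2 \<le> (L - x)\<^sup>2 + x\<^sup>2" by (simp add: power2_eq_square algebra_simps)
      qed (use \<mu> in simp)
      finally have "L * (\<mu> * L / 2) \<le> L * (P' x + 2 * w)" by (simp add: power2_eq_square algebra_simps)
      then have "\<mu> * L / 2 \<le> P' x + 2 * w" using L by simp
      moreover have "w * 1 \<le> w * (k * t\<^sup>2 - \<kappa> * t)" using one w by (intro mult_left_mono) auto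
      ultimately show ?thesis by simp
    qed
    moreover have "exp (- k * L\<^sup>2) \<le> r x"
    proof -
      have "\<bar>x - m\<bar> \<le> L" using x m by auto
      then have "(x - m)\<^sup>2 \<le> L\<^sup>2" using L by (simp add: abs_le_square_iff[symmetric])
      then show ?thesis using k by (simp add: r_def)
    qed
    moreover from calculation(2) have "0 \<le> P' x / 2 + w * (k * t\<^sup>2 - \<kappa> * t)"
      by (rule order_trans[rotated]) (use \<mu> L in simp)
    ultimately show ?thesis unfolding \<delta>_def
      using mult_mono[of "\<mu> * L / 4" "P' x / 2 + w * (k * t\<^sup>2 - \<kappa> * t)" "exp (- k * L\<^sup>2)" "r x"]
      by (simp add: mult.commute)
  qed
  show ?thesis
    by (rule that[OF C _ _ _ main]) (use \<mu> L in \<open>auto simp: q_def P_def \<delta>_def\<close>)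
qed

context kv_trajectory begin

lemma null_energy: "null_on_average energy0"
proof -
  obtain \<eta> \<eta>' \<psi> \<psi>' p :: "real \<Rightarrow> real" where
    \<eta>: "C1 \<eta> \<eta>'" "\<And>x. 0 \<le> \<eta> x" "\<And>x. x \<notin> {\<alpha>1<..<\<alpha>2} \<Longrightarrow> \<eta> x = 0 \<and> \<eta>' x = 0" and
    \<psi>: "C1 \<psi> \<psi>'" "\<And>x. 0 \<le> \<psi> x" "\<And>x. x \<notin> {\<alpha>2<..<\<alpha>3} \<Longrightarrow> \<psi> x = 0 \<and> \<psi>' x = 0"
    "\<And>x. x \<in> {\<alpha>2<..<\<alpha>2 + min (\<alpha>2 - \<alpha>1) (\<alpha>3 - \<alpha>2)} \<Longrightarrow> \<psi> x > 0" and
    p: "C1 p (\<lambda>x. \<eta> x - \<psi> x)" "\<And>x. x \<notin> {\<alpha>1<..<\<alpha>3} \<Longrightarrow> p x = 0"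
    using transfer_weights[OF order(1,2,3)] by blast
  have l\<eta>: "local_weight \<alpha>1 \<alpha>2 \<eta> \<eta>'" and l\<psi>: "local_weight \<alpha>2 \<alpha>3 \<psi> \<psi>'"
    unfolding local_weight_def using \<eta> \<psi> by blast+
  have nv: "null_on_average (\<lambda>t. wip L \<psi> (v t) (v t))"
    by (rule null_transfer[OF p C1_weight(1)[OF \<eta>(1)] C1_weight(1)[OF \<psi>(1)] L2s(5) bd(5) L2s(6) H10s(3) null_vx null_v_local[OF l\<eta>]])
  define h where "h = min (\<alpha>2 - \<alpha>1) (\<alpha>3 - \<alpha>2)"
  have h: "h > 0" "\<alpha>2 + h \<le> \<alpha>3" using order by (auto simp: h_def)
  \<comment> \<open>The interval \<open>[m - d, m + d]\<close> is a compact part of the region where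
       \<open>\<psi>\<close> is positive.\<close>
  define m where "m = \<alpha>2 + h / 2"
  define d where "d = h / 4"
  have I: "{m - d..m + d} \<subseteq> {\<alpha>2<..<\<alpha>2 + h}" "m - d \<le> m + d" using h by (auto simp: m_def d_def)
  have "\<exists>x\<in>{m - d..m + d}. \<forall>y\<in>{m - d..m + d}. \<psi> x \<le> \<psi> y"
    using I(2) by (intro continuous_attains_inf continuous_on_subset[OF C1_continuous[OF \<psi>(1)]]) auto
  then obtain x0 where x0: "x0 \<in> {m - d..m + d}" "\<And>y. y \<in> {m - d..m + d} \<Longrightarrow> \<psi> x0 \<le> \<psi> y" by blast
  define \<rho> where "\<rho> = \<psi> x0"
  have \<rho>: "\<rho> > 0" unfolding \<rho>_def using \<psi>(4)[of x0] x0(1) I(1) by (auto simp: h_def)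
  define \<kappa> where "\<kappa> = c0 * (1 + 1/a) / 2"
  have \<kappa>: "\<kappa> \<ge> 0" using pos by (simp add: \<kappa>_def)
  have mL: "0 < m" "m < L" "d > 0" using h order by (auto simp: m_def d_def)
  obtain q q' \<delta> where q: "C1 q q'" "q 0 = 0" "q L = 0" "\<delta> > 0"
    "\<And>x. x \<in> {0<..<L} \<Longrightarrow> d \<le> \<bar>x - m\<bar> \<Longrightarrow> \<delta> \<le> (1/2) * q' x - \<kappa> * \<bar>q x\<bar>"
    using global_weight[OF pos(1) mL \<kappa>] by blast
  have "bounded_weight L (\<lambda>x. (1/2) * q' x - \<kappa> * \<bar>q x\<bar>)"
    by (intro bounded_weight_diff bounded_weight_mult bounded_weight_const bounded_weight_abs C1_weight[OF q(1)])
  then obtain K where K: "\<forall>x\<in>{0<..<L}. \<bar>(1/2) * q' x - \<kappa> * \<bar>q x\<bar>\<bar> \<le> K" unfolding bounded_weight_def by blast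
  have "m \<in> {0<..<L}" using mL by simp
  then have K0: "K \<ge> 0" using K abs_ge_zero order_trans by blast
  \<comment> \<open>Large enough that on \<open>[m - d, m + d]\<close> the local energy compensates the worst value
       \<open>-K\<close>.\<close>
  define C where "C = (\<delta> + K) / (\<rho> * \<rho>)"
  have C: "C \<ge> 0" "C * (\<rho> * \<rho>) = \<delta> + K" using q(4) K0 \<rho> by (auto simp: C_def)
  have dom: "\<delta> - C * (\<psi> x * \<psi> x) \<le> (1/2) * q' x - (c0 * (1 + 1/a) / 2) * \<bar>q x\<bar>" if x: "x \<in> {0<..<L}" for x
  proof (cases "d \<le> \<bar>x - m\<bar>")
    case True
    have "0 \<le> C * (\<psi> x * \<psi> x)" using C(1) by simp
    then show ?thesis using q(5)[OF x True] unfolding \<kappa>_def by linarith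
  next
    case False
    then have "\<rho> \<le> \<psi> x" unfolding \<rho>_def by (intro x0(2)) auto
    then have "C * (\<rho> * \<rho>) \<le> C * (\<psi> x * \<psi> x)" using \<rho> C(1) by (intro mult_left_mono mult_mono) auto
    moreover have "- K \<le> (1/2) * q' x - \<kappa> * \<bar>q x\<bar>" using abs_le_D2[OF bspec[OF K x]] by linarith
    ultimately show ?thesis using C(2) unfolding \<kappa>_def by linarith
  qed
  show ?thesis by (rule null_energy0[OF null_energy1[OF l\<psi> nv q(1,2,3,4) C(1) dom]])
qed

end

section \<open>Smooth data in the domain of the squared operator\<close>

text \<open>Near the jumps of the coefficient the test function vanishes, and elsewhere the coefficient is locally
  constant; hence the coefficient commutes with differentiation on these functions.\<close>

lemma tests_local_coeff:
  assumes \<phi>: "\<phi> \<in> tests L P" and pq: "p \<in> P" "q \<in> P"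
  shows "(\<lambda>x. of_real (local_coeff k p q x) * \<phi> x) \<in> tests L P"
proof -
  have deriv: "((\<lambda>x. of_real (local_coeff k p q x) * g x) has_vector_derivative of_real (local_coeff k p q x) * vd g x) (at x)"
    if g: "g \<in> tests L P" for g x
  proof -
    obtain K where K: "compact K" "K \<subseteq> {0<..<L} - P" "\<And>x. x \<notin> K \<Longrightarrow> g x = 0"
      using g unfolding tests_def by blast
    have gd: "((\<lambda>x. j * g x) has_vector_derivative j * vd g x) (at x)" for j
      by (rule has_vector_derivative_mult_right[OF smooth_has_vector_derivative[OF tests_smooth[OF g]]])
    have step: ?thesis if S: "open S" "x \<in> S" "\<And>y. y \<in> S \<Longrightarrow> of_real (local_coeff k p q y) * g y = of_real (local_coeff k p q x) * g y" for S
      by (rule has_vector_derivative_transform_within_open[OF gd S(1,2)]) (simp add: S(3))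
    show ?thesis
    proof (cases "x \<in> K")
      case False
      have "open (- K)" using K(1) by (simp add: compact_imp_closed open_Compl)
      then show ?thesis by (rule step) (use False K(3) in auto)
    next
      case True
      then have "x \<noteq> p" "x \<noteq> q" using K(2) pq by auto
      then consider "x \<in> {p<..<q}" | "x < p" | "q < x" by force
      then show ?thesis
      proof cases
        case 1
        then show ?thesis by (intro step[of "{p<..<q}"]) (auto simp: local_coeff_def)
      next
        case 2
        then show ?thesis by (intro step[of "{..<p}"]) (auto simp: local_coeff_def)
      next
        case 3
        then show ?thesis by (intro step[of "{q<..}"]) (auto simp: local_coeff_def)
      qed
    qed
  qed
  have "smooth (\<lambda>x. of_real (local_coeff k p q x) * \<phi> x)"
  proof (rule smooth_coinduct[where P="\<lambda>h. \<exists>g\<in>tests L P. h = (\<lambda>x. of_real (local_coeff k p q x) * g x)"])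
    show "\<exists>g\<in>tests L P. (\<lambda>x. of_real (local_coeff k p q x) * \<phi> x) = (\<lambda>x. of_real (local_coeff k p q x) * g x)"
      using \<phi> by blast
    fix h assume "\<exists>g\<in>tests L P. h = (\<lambda>x. of_real (local_coeff k p q x) * g x)"
    then obtain g where g: "g \<in> tests L P" and h: "h = (\<lambda>x. of_real (local_coeff k p q x) * g x)" by blast
    have "\<forall>x. h differentiable at x" unfolding h using deriv[OF g] differentiableI_vector by blast
    moreover have "vd h = (\<lambda>x. of_real (local_coeff k p q x) * vd g x)" unfolding h by (rule vd_eqI[OF deriv[OF g]])
    ultimately show "(\<forall>x. h differentiable at x) \<and> (\<exists>g\<in>tests L P. vd h = (\<lambda>x. of_real (local_coeff k p q x) * g x))"
      using tests_vd[OF g] by (intro conjI bexI[of _ "vd g"])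
  qed
  moreover obtain K where "compact K" "K \<subseteq> {0<..<L} - P" "\<And>x. x \<notin> K \<Longrightarrow> \<phi> x = 0"
    using \<phi> unfolding tests_def by blast
  ultimately show ?thesis by (intro testsI_closed[where K=K]) auto
qed

lemma tests_test: "\<phi> \<in> tests L P \<Longrightarrow> \<phi> \<in> test_functions L"
  using tests_subset by blast

lemma wderiv_AE:
  assumes L: "L > 0" and f: "has_weak_derivative L f g"
  shows "has_weak_derivative L f (wderiv L f)" "AE x in lebesgue_on {0<..<L}. wderiv L f x = g x"
proof -
  show "has_weak_derivative L f (wderiv L f)" using f by (intro wderiv_hwd) (auto simp: H1_def)
  then show "AE x in lebesgue_on {0<..<L}. wderiv L f x = g x" by (rule hwd_unique[OF L _ f])
qed

text \<open>The operator is defined through \<open>wderiv\<close>, an arbitrary representative, so images of smooth data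
  are smooth only up to null sets; the properties of test functions are therefore needed up to null sets.\<close>

lemma AE_test_H10:
  assumes L: "L > 0" and \<phi>: "\<phi> \<in> test_functions L" and f: "f \<in> L2 L" "AE x in lebesgue_on {0<..<L}. f x = \<phi> x"
  shows "f \<in> H10 L" "has_weak_derivative L f (vd \<phi>)" "AE x in lebesgue_on {0<..<L}. wderiv L f x = vd \<phi> x"
    "wderiv L f \<in> L2 L"
proof -
  have "AE x in lebesgue_on {0<..<L}. \<phi> x = f x" using f(2) by (rule eventually_mono) simp
  then have H: "H10_derivative L f (vd \<phi>)"
    by (rule H10_derivative_cong_AE[OF H10_derivative_test[OF L \<phi>] f(1) _ test_L2(2)[OF \<phi>]]) simp
  show "f \<in> H10 L" by (rule H10_derivative_H10[OF L H])
  show h: "has_weak_derivative L f (vd \<phi>)" by (rule H10_derivative_hwd[OF H])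
  show "AE x in lebesgue_on {0<..<L}. wderiv L f x = vd \<phi> x" by (rule wderiv_AE(2)[OF L h])
  show "wderiv L f \<in> L2 L" by (rule hwd_L2(2)[OF wderiv_AE(1)[OF L h]])
qed

lemma H10_L2: "L > 0 \<Longrightarrow> f \<in> H10 L \<Longrightarrow> f \<in> L2 L" "L > 0 \<Longrightarrow> f \<in> H10 L \<Longrightarrow> wderiv L f \<in> L2 L"
  using hwd_L2 H10_derivative_hwd H10_wderiv by blast+

text \<open>For flat data the flux is a test function although the coefficient \<open>b\<close> jumps. Of the first
  displacement only the derivative has to be flat, since a function that vanishes near interior points could
  not approximate a general element of \<open>H\<^sup>1\<^sub>0\<close>.\<close>

lemma flat_data_in_domain:
  fixes L a b0 \<alpha>1 \<alpha>3 :: real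
  assumes L: "L > 0" and P: "\<alpha>1 \<in> P" "\<alpha>3 \<in> P"
    and u: "U \<in> test_functions L" "vd U \<in> tests L P" "u \<in> L2 L" "AE x in lebesgue_on {0<..<L}. u x = U x"
    and v: "V \<in> tests L P" "v \<in> L2 L" "AE x in lebesgue_on {0<..<L}. v x = V x"
    and y: "Y \<in> test_functions L" "y \<in> L2 L" "AE x in lebesgue_on {0<..<L}. y x = Y x"
    and z: "Z \<in> test_functions L" "z \<in> L2 L" "AE x in lebesgue_on {0<..<L}. z x = Z x"
  defines "F \<equiv> \<lambda>x. of_real a * vd U x + of_real (local_coeff b0 \<alpha>1 \<alpha>3 x) * vd V x"
  shows "(u, v, y, z) \<in> kv_domain L a (local_coeff b0 \<alpha>1 \<alpha>3)" "F \<in> tests L P"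
    "AE x in lebesgue_on {0<..<L}. wderiv L (flux L a (local_coeff b0 \<alpha>1 \<alpha>3) u v) x = vd F x"
    "wderiv L (flux L a (local_coeff b0 \<alpha>1 \<alpha>3) u v) \<in> L2 L"
    "AE x in lebesgue_on {0<..<L}. wderiv L (wderiv L y) x = vd (vd Y) x" "wderiv L (wderiv L y) \<in> L2 L"
proof -
  note Vt = tests_test[OF v(1)]
  note u' = AE_test_H10[OF L u(1,3,4)] and v' = AE_test_H10[OF L Vt v(2,3)]
    and y' = AE_test_H10[OF L y] and z' = AE_test_H10[OF L z]
  let ?f = "flux L a (local_coeff b0 \<alpha>1 \<alpha>3) u v"
  show Ft: "F \<in> tests L P" unfolding F_def
    by (intro tests_add tests_cmult u(2) tests_local_coeff[OF tests_vd[OF v(1)] P])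
  have fL2: "?f \<in> L2 L" unfolding flux_def
    by (intro L2_plus(3) bounded_weight_local_coeff u'(4) v'(4))
  have "AE x in lebesgue_on {0<..<L}. ?f x = F x"
    using u'(3) v'(3) by (rule AE_mp[OF _ AE_mp], intro AE_I2) (simp add: flux_def F_def)
  note f' = AE_test_H10[OF L tests_test[OF Ft] fL2 this]
  show "AE x in lebesgue_on {0<..<L}. wderiv L ?f x = vd F x" "wderiv L ?f \<in> L2 L" by (rule f')+
  have "vd Y \<in> test_functions L" using y(1) tests_vd by (simp add: test_functions_eq)
  note yx' = AE_test_H10[OF L this y'(4,3)]
  show "AE x in lebesgue_on {0<..<L}. wderiv L (wderiv L y) x = vd (vd Y) x" "wderiv L (wderiv L y) \<in> L2 L" by (rule yx')+
  have "?f \<in> H1 L" "y \<in> H1 L" "wderiv L y \<in> H1 L" using f'(2) y'(2) yx'(2) by (auto simp: H1_def)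
  then show "(u, v, y, z) \<in> kv_domain L a (local_coeff b0 \<alpha>1 \<alpha>3)"
    using u'(1) v'(1) y'(1) z'(1) v(2) z(2) by (simp add: kv_domain_def energy_space_def H2_def)
qed

text \<open>The operator maps flat smooth data, up to null sets, to data of the same kind, to which
  \<open>flat_data_in_domain\<close> applies a second time.\<close>

lemma domain_square_flat_data:
  fixes L a b0 c0 \<alpha>1 \<alpha>2 \<alpha>3 \<alpha>4 :: real
  assumes L: "L > 0" and U: "U \<in> test_functions L" "vd U \<in> tests L {\<alpha>1, \<alpha>2, \<alpha>3, \<alpha>4}"
    and V: "V \<in> tests L {\<alpha>1, \<alpha>2, \<alpha>3, \<alpha>4}" and Y: "Y \<in> test_functions L" and Z: "Z \<in> tests L {\<alpha>1, \<alpha>2, \<alpha>3, \<alpha>4}"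
  defines "D \<equiv> kv_domain L a (local_coeff b0 \<alpha>1 \<alpha>3)"
    and "A \<equiv> kv_operator L a (local_coeff b0 \<alpha>1 \<alpha>3) (local_coeff c0 \<alpha>2 \<alpha>4)"
  shows "(U, V, Y, Z) \<in> D" "A (U, V, Y, Z) \<in> D"
proof -
  let ?P = "{\<alpha>1, \<alpha>2, \<alpha>3, \<alpha>4}" and ?c = "local_coeff c0 \<alpha>2 \<alpha>4"
  have P: "\<alpha>1 \<in> ?P" "\<alpha>2 \<in> ?P" "\<alpha>3 \<in> ?P" "\<alpha>4 \<in> ?P" by auto
  have AE_refl: "AE x in lebesgue_on {0<..<L}. f x = f x" for f :: "real \<Rightarrow> complex" by simp
  note VL = tests_L2[OF V] and ZL = tests_L2[OF Z] and UL = test_L2(1)[OF U(1)] and YL = test_L2(1)[OF Y]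
  note d = flat_data_in_domain[OF L P(1,3) U UL AE_refl V VL AE_refl Y YL AE_refl tests_test[OF Z] ZL AE_refl]
  show "(U, V, Y, Z) \<in> D" unfolding D_def by (rule d(1))
  define F where "F = (\<lambda>x. of_real a * vd U x + of_real (local_coeff b0 \<alpha>1 \<alpha>3 x) * vd V x)"
  have Ft: "F \<in> tests L ?P" unfolding F_def by (rule d(2))
  define w where "w = (\<lambda>x. wderiv L (flux L a (local_coeff b0 \<alpha>1 \<alpha>3) U V) x - of_real (?c x) * Z x)"
  define s where "s = (\<lambda>x. wderiv L (wderiv L Y) x + of_real (?c x) * V x)"
  define W where "W = (\<lambda>x. vd F x - of_real (?c x) * Z x)"
  define S where "S = (\<lambda>x. vd (vd Y) x + of_real (?c x) * V x)"
  have Wt: "W \<in> tests L ?P" unfolding W_def by (intro tests_diff tests_vd[OF Ft] tests_local_coeff[OF Z P(2,4)])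
  have "vd (vd Y) \<in> tests L {}" using Y tests_vd by (simp add: test_functions_eq)
  then have St: "S \<in> test_functions L" unfolding S_def test_functions_eq
    using tests_local_coeff[OF V P(2,4), of c0] tests_test by (intro tests_add) (auto simp: test_functions_eq)
  have wL: "w \<in> L2 L" unfolding w_def by (intro L2_plus(2) bounded_weight_local_coeff d(4) ZL)
  have sL: "s \<in> L2 L" unfolding s_def by (intro L2_plus(1) bounded_weight_local_coeff d(6) VL)
  have wW: "AE x in lebesgue_on {0<..<L}. w x = W x"
    using d(3) by (rule eventually_mono) (simp add: w_def W_def F_def)
  have sS: "AE x in lebesgue_on {0<..<L}. s x = S x"
    using d(5) by (rule eventually_mono) (simp add: s_def S_def)
  have "A (U, V, Y, Z) = (V, w, Z, s)" unfolding A_def w_def s_def by simp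
  then show "A (U, V, Y, Z) \<in> D" unfolding D_def
    using flat_data_in_domain(1)[OF L P(1,3) tests_test[OF V] tests_vd[OF V] VL AE_refl Wt wL wW tests_test[OF Z] ZL AE_refl St sL sS]
    by simp
qed

section \<open>Contraction semigroups on a seminormed space\<close>

text \<open>The elements are representatives: addition and the listed laws of scaling are exact, whereas the semigroup
  laws hold only up to vectors of seminorm zero.\<close>

locale seminormed_semigroup =
  fixes scl :: "complex \<Rightarrow> 'a \<Rightarrow> 'a::ab_group_add" and H :: "'a set" and N :: "'a \<Rightarrow> real" and T :: "real \<Rightarrow> 'a \<Rightarrow> 'a"
    and D :: "'a set" and A :: "'a \<Rightarrow> 'a"
  assumes H_add: "U \<in> H \<Longrightarrow> W \<in> H \<Longrightarrow> U + W \<in> H" and H_diff: "U \<in> H \<Longrightarrow> W \<in> H \<Longrightarrow> U - W \<in> H"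
    and H_scl: "U \<in> H \<Longrightarrow> scl k U \<in> H"
    and N_nonneg: "0 \<le> N U" and N_add: "U \<in> H \<Longrightarrow> W \<in> H \<Longrightarrow> N (U + W) \<le> N U + N W"
    and N_scl: "U \<in> H \<Longrightarrow> N (scl k U) = cmod k * N U" and scl_minus_one: "scl (- 1) U = - U"
    and scl_diff: "scl k (U - W) = scl k U - scl k W" and scl_minus: "scl (- k) U = - scl k U"
    and D_H: "D \<subseteq> H" and A_H: "U \<in> D \<Longrightarrow> A U \<in> H"
    and semigroup: "contraction_C0_semigroup scl H N T" and generator: "is_generator scl H N T D A"
begin

lemma N_minus: "U \<in> H \<Longrightarrow> N (- U) = N U"
  using N_scl[of U "-1"] by (simp add: scl_minus_one)

lemma H_minus: "U \<in> H \<Longrightarrow> - U \<in> H"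
  using H_scl[of U "-1"] by (simp add: scl_minus_one)

lemma N_diff_commute: "U \<in> H \<Longrightarrow> W \<in> H \<Longrightarrow> N (U - W) = N (W - U)"
  using N_minus[OF H_diff, of U W] by simp

lemma N_zero: "N (U - U) = 0" if "U \<in> H"
proof -
  have zero: "scl 0 0 = 0" using scl_diff[of 0 U U] by (simp only: diff_self)
  have "N (scl 0 0) = cmod 0 * N 0" using N_scl[OF H_diff[OF that that], of 0] unfolding diff_self .
  then show ?thesis unfolding zero norm_zero mult_zero_left diff_self .
qed

lemma N_triangle_diff: "U \<in> H \<Longrightarrow> V \<in> H \<Longrightarrow> W \<in> H \<Longrightarrow> N (U - W) \<le> N (U - V) + N (V - W)"
  using N_add[OF H_diff H_diff, of U V V W] by simp

definition eqv :: "'a \<Rightarrow> 'a \<Rightarrow> bool" where "eqv U W \<longleftrightarrow> U \<in> H \<and> W \<in> H \<and> N (U - W) = 0"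

lemma eqv_refl: "U \<in> H \<Longrightarrow> eqv U U" unfolding eqv_def using N_zero by blast

lemma eqv_sym: "eqv U W \<Longrightarrow> eqv W U" by (auto simp: eqv_def N_diff_commute)

lemma eqv_trans:
  assumes "eqv U V" "eqv V W" shows "eqv U W"
  using assms N_triangle_diff[of U V W] N_nonneg[of "U - W"] by (auto simp: eqv_def)

lemma eqv_N: assumes "eqv U W" shows "N U = N W"
proof -
  have "N U \<le> N (U - W) + N W" "N W \<le> N (W - U) + N U"
    using N_add[OF H_diff, of U W W] N_add[OF H_diff, of W U U] assms by (auto simp: eqv_def)
  then show ?thesis using assms N_diff_commute[of U W] by (auto simp: eqv_def)
qed

lemma eqv_add:
  assumes "eqv U U'" "eqv W W'" shows "eqv (U + W) (U' + W')"
proof -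
  have "N ((U - U') + (W - W')) \<le> 0" using N_add[OF H_diff H_diff, of U U' W W'] assms by (simp add: eqv_def)
  moreover have "(U + W) - (U' + W') = (U - U') + (W - W')" by simp
  ultimately have "N ((U + W) - (U' + W')) \<le> 0" by (simp only:)
  then have "N ((U + W) - (U' + W')) = 0" by (rule order_antisym[OF _ N_nonneg])
  then show ?thesis using assms by (simp add: eqv_def H_add)
qed

lemma eqv_diff:
  assumes "eqv U U'" "eqv W W'" shows "eqv (U - W) (U' - W')"
proof -
  have m: "eqv (- W) (- W')" using assms(2) N_diff_commute[of W W'] by (auto simp: eqv_def H_minus)
  from eqv_add[OF assms(1) m] show ?thesis by simp
qed

lemma eqv_scl: "eqv U W \<Longrightarrow> eqv (scl k U) (scl k W)"
  using N_scl[OF H_diff, of U W k] by (simp add: eqv_def H_scl scl_diff)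

lemma T_H: "t \<ge> 0 \<Longrightarrow> U \<in> H \<Longrightarrow> T t U \<in> H"
  and T_contr: "t \<ge> 0 \<Longrightarrow> U \<in> H \<Longrightarrow> N (T t U) \<le> N U"
  using semigroup unfolding contraction_C0_semigroup_def by blast+

lemma T_add: "t \<ge> 0 \<Longrightarrow> U \<in> H \<Longrightarrow> W \<in> H \<Longrightarrow> eqv (T t (U + W)) (T t U + T t W)"
  using semigroup unfolding contraction_C0_semigroup_def eqv_def by (simp add: H_add)

lemma T_scl: "t \<ge> 0 \<Longrightarrow> U \<in> H \<Longrightarrow> eqv (T t (scl k U)) (scl k (T t U))"
  using semigroup unfolding contraction_C0_semigroup_def eqv_def by (simp add: H_scl)

lemma T_plus: "s \<ge> 0 \<Longrightarrow> t \<ge> 0 \<Longrightarrow> U \<in> H \<Longrightarrow> eqv (T (s + t) U) (T s (T t U))"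
  using semigroup unfolding contraction_C0_semigroup_def eqv_def by simp

lemma T_diff:
  assumes "t \<ge> 0" "U \<in> H" "W \<in> H" shows "eqv (T t (U - W)) (T t U - T t W)"
proof -
  have "eqv (T t (U - W + W)) (T t (U - W) + T t W)" by (rule T_add[OF assms(1) H_diff[OF assms(2,3)] assms(3)])
  then have "eqv (T t U) (T t (U - W) + T t W)" by simp
  from eqv_diff[OF this eqv_refl[OF T_H[OF assms(1,3)]]] have "eqv (T t U - T t W) (T t (U - W))" by simp
  then show ?thesis by (rule eqv_sym)
qed

lemma T_continuous_0: "U \<in> H \<Longrightarrow> ((\<lambda>t. N (T t U - U)) \<longlongrightarrow> 0) (at_right 0)"
  using semigroup unfolding contraction_C0_semigroup_def by blast

definition quotient :: "'a \<Rightarrow> real \<Rightarrow> 'a" where "quotient U h = scl (of_real (1 / h)) (T h U - U) - A U"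

lemma quotient_H: "U \<in> D \<Longrightarrow> h \<ge> 0 \<Longrightarrow> quotient U h \<in> H"
  unfolding quotient_def using D_H by (intro H_diff H_scl T_H A_H) auto

lemma quotient_tendsto: "U \<in> D \<Longrightarrow> ((\<lambda>h. N (quotient U h)) \<longlongrightarrow> 0) (at_right 0)"
  using generator D_H A_H[of U] N_zero[of "A U"] unfolding is_generator_def quotient_def by blast

lemma T_quotient:
  assumes U: "U \<in> D" and t: "t \<ge> 0" and h: "h \<ge> 0"
  shows "eqv (scl (of_real (1 / h)) (T (h + t) U - T t U) - T t (A U)) (T t (quotient U h))"
proof -
  have UH: "U \<in> H" using U D_H by blast
  note in_H = UH T_H[OF h UH] T_H[OF t UH] A_H[OF U]
  have "eqv (T t (T h U - U)) (T t (T h U) - T t U)" by (rule T_diff[OF t in_H(2,1)])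
  moreover have "eqv (T t (T h U) - T t U) (T (h + t) U - T t U)"
    using eqv_diff[OF eqv_sym[OF T_plus[OF t h UH]] eqv_refl[OF in_H(3)]] by (simp add: add.commute)
  ultimately have "eqv (T t (T h U - U)) (T (h + t) U - T t U)" by (rule eqv_trans)
  note 1 = eqv_trans[OF T_scl[OF t H_diff[OF in_H(2,1)]] eqv_scl[OF this]]
  note 2 = T_diff[OF t H_scl[OF H_diff[OF in_H(2,1)]] in_H(4)]
  show ?thesis unfolding quotient_def
    by (rule eqv_sym[OF eqv_trans[OF 2 eqv_diff[OF 1 eqv_refl[OF T_H[OF t in_H(4)]]]]])
qed

text \<open>The difference quotient of the orbit at time \<open>t\<close> is the image under \<open>T t\<close> of the
  one at time 0, so contractivity transports its convergence.\<close>

lemma generator_invariant: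
  assumes U: "U \<in> D" and t: "t \<ge> 0"
  shows "T t U \<in> D" "eqv (A (T t U)) (T t (A U))"
proof -
  have UH: "U \<in> H" and AU: "A U \<in> H" using U D_H A_H by auto
  note in_H = UH T_H[OF t UH] T_H[OF t AU]
  have "((\<lambda>h. N (scl (of_real (1 / h)) (T h (T t U) - T t U) - T t (A U))) \<longlongrightarrow> 0) (at_right 0)"
  proof (rule Lim_null_comparison[OF _ quotient_tendsto[OF U]])
    have "N (scl (of_real (1 / h)) (T h (T t U) - T t U) - T t (A U)) \<le> N (quotient U h)" if h: "h > 0" for h
    proof -
      note h0 = less_imp_le[OF h]
      have "eqv (scl (of_real (1 / h)) (T h (T t U) - T t U) - T t (A U)) (T t (quotient U h))"
        by (rule eqv_trans[OF eqv_diff[OF eqv_scl[OF eqv_diff[OF eqv_sym[OF T_plus[OF h0 t UH]] eqv_refl[OF in_H(2)]]] eqv_refl[OF in_H(3)]]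
             T_quotient[OF U t h0]])
      then show ?thesis using eqv_N T_contr[OF t quotient_H[OF U h0]] by metis
    qed
    then show "\<forall>\<^sub>F h in at_right 0. norm (N (scl (of_real (1 / h)) (T h (T t U) - T t U) - T t (A U))) \<le> N (quotient U h)"
      using N_nonneg by (intro eventually_at_right_less[THEN eventually_mono]) simp
  qed
  then have "T t U \<in> D \<and> N (A (T t U) - T t (A U)) = 0"
    using generator in_H(2,3) unfolding is_generator_def by blast
  then show "T t U \<in> D" "eqv (A (T t U)) (T t (A U))" using in_H A_H by (auto simp: eqv_def)
qed

text \<open>The generator gives right derivatives only. The difference quotient to the left over a step \<open>k\<close>
  is the image under \<open>T (t - k)\<close> of the right quotient at time 0; the remaining difference of
  \<open>A U\<close> and \<open>T k (A U)\<close> is small by strong continuity.\<close>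

lemma orbit_derivative:
  assumes U: "U \<in> D" and t: "t > 0"
  shows "((\<lambda>h. N (scl (of_real (1 / h)) (T (t + h) U - T t U) - T t (A U))) \<longlongrightarrow> 0) (at 0)"
proof -
  have UH: "U \<in> H" and AU: "A U \<in> H" using U D_H A_H by auto
  let ?R = "\<lambda>h. N (scl (of_real (1 / h)) (T (t + h) U - T t U) - T t (A U))"
  let ?S = "\<lambda>h. N (quotient U h) + N (T h (A U) - A U)"
  have S: "(?S \<longlongrightarrow> 0) (at_right 0)"
    using tendsto_add[OF quotient_tendsto[OF U] T_continuous_0[OF AU]] by simp
  have right: "?R h \<le> ?S h" if h: "h > 0" for h
  proof -
    note h0 = less_imp_le[OF h] and t0 = less_imp_le[OF t]
    have "?R h = N (T t (quotient U h))" using eqv_N[OF T_quotient[OF U t0 h0]] by (simp add: add.commute)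
    then show ?thesis using T_contr[OF t0 quotient_H[OF U h0]] N_nonneg[of "T h (A U) - A U"] by linarith
  qed
  have left: "?R (- k) \<le> ?S k" if k: "0 < k" "k < t" for k
  proof -
    have k0: "k \<ge> 0" "t - k \<ge> 0" "t \<ge> 0" using k by auto
    have "scl (of_real (1 / (- k))) (T (t - k) U - T t U) = scl (of_real (1 / k)) (T t U - T (t - k) U)"
      using scl_minus[of "of_real (1/k)" "T (t - k) U - T t U"] by (simp add: scl_diff)
    then have "?R (- k) = N (scl (of_real (1 / k)) (T t U - T (t - k) U) - T t (A U))" by simp
    also have "\<dots> \<le> N (scl (of_real (1 / k)) (T t U - T (t - k) U) - T (t - k) (A U)) + N (T (t - k) (A U) - T t (A U))"
      using k0 UH AU by (intro N_triangle_diff H_diff H_scl T_H)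
    also have "N (scl (of_real (1 / k)) (T t U - T (t - k) U) - T (t - k) (A U)) = N (T (t - k) (quotient U k))"
      using eqv_N[OF T_quotient[OF U k0(2,1)]] by simp
    also have "\<dots> \<le> N (quotient U k)" by (rule T_contr[OF k0(2) quotient_H[OF U k0(1)]])
    also have "N (T (t - k) (A U) - T t (A U)) = N (T (t - k) (A U - T k (A U)))"
    proof -
      have "eqv (T t (A U)) (T (t - k) (T k (A U)))" using T_plus[OF k0(2,1) AU] by simp
      from eqv_diff[OF eqv_refl[OF T_H[OF k0(2) AU]] this]
      have "eqv (T (t - k) (A U) - T t (A U)) (T (t - k) (A U) - T (t - k) (T k (A U)))" .
      from eqv_trans[OF this eqv_sym[OF T_diff[OF k0(2) AU T_H[OF k0(1) AU]]]] show ?thesis by (rule eqv_N)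
    qed
    also have "\<dots> \<le> N (A U - T k (A U))" using k0 AU by (intro T_contr H_diff T_H)
    also have "\<dots> = N (T k (A U) - A U)" using k0 AU by (intro N_diff_commute T_H)
    finally show ?thesis by simp
  qed
  have "(?R \<longlongrightarrow> 0) (at_right 0)"
  proof (rule Lim_null_comparison[OF _ S])
    show "\<forall>\<^sub>F h in at_right 0. norm (?R h) \<le> ?S h"
      using right N_nonneg by (intro eventually_at_right_less[THEN eventually_mono]) simp
  qed
  moreover have "(?R \<longlongrightarrow> 0) (at_left 0)"
  proof -
    have "((\<lambda>k. ?R (- k)) \<longlongrightarrow> 0) (at_right 0)"
    proof (rule Lim_null_comparison[OF _ S])
      have "\<forall>\<^sub>F k in at_right 0. k \<in> {0<..<t}" using t by (rule eventually_at_right_real)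
      then show "\<forall>\<^sub>F k in at_right 0. norm (?R (- k)) \<le> ?S k"
      proof (rule eventually_mono)
        fix k assume "k \<in> {0<..<t}"
        then have "?R (- k) \<le> ?S k" by (intro left) auto
        then show "norm (?R (- k)) \<le> ?S k" using N_nonneg by simp
      qed
    qed
    then show ?thesis by (simp add: filterlim_at_left_to_right)
  qed
  ultimately show ?thesis by (simp add: filterlim_split_at)
qed

lemma orbit_decreasing: "0 \<le> s \<Longrightarrow> s \<le> t \<Longrightarrow> U \<in> H \<Longrightarrow> N (T t U) \<le> N (T s U)"
  using eqv_N[OF T_plus[of "t - s" s U]] T_contr[OF _ T_H, of "t - s" s U] by simp

text \<open>Contractivity makes the approximation of the initial value uniform in time.\<close>

lemma strongly_stable_if_dense:
  assumes dense: "\<And>U e. U \<in> H \<Longrightarrow> e > 0 \<Longrightarrow> \<exists>W\<in>H. N (U - W) < e \<and> ((\<lambda>t. N (T t W)) \<longlongrightarrow> 0) at_top"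
    and U: "U \<in> H"
  shows "((\<lambda>t. N (T t U)) \<longlongrightarrow> 0) at_top"
proof (rule tendstoI)
  fix e :: real assume "e > 0"
  then have e: "e/2 > 0" by simp
  obtain W where W: "W \<in> H" "N (U - W) < e/2" "((\<lambda>t. N (T t W)) \<longlongrightarrow> 0) at_top" using dense[OF U e] by blast
  have "\<forall>\<^sub>F t in at_top. dist (N (T t W)) 0 < e/2" by (rule tendstoD[OF W(3) e])
  then show "\<forall>\<^sub>F t in at_top. dist (N (T t U)) 0 < e"
    using eventually_ge_at_top[of 0]
  proof eventually_elim
    case (elim t)
    have "N (T t U) \<le> N (T t U - T t W) + N (T t W)"
      using N_add[OF H_diff[OF T_H T_H] T_H, of t U t W t W] elim U W(1) by simp
    also have "N (T t U - T t W) = N (T t (U - W))" using eqv_N[OF T_diff[OF elim(2) U W(1)]] by simp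
    also have "\<dots> \<le> N (U - W)" by (rule T_contr[OF elim(2) H_diff[OF U W(1)]])
    finally show ?case using elim W(2) N_nonneg by (simp add: dist_real_def)
  qed
qed

end

section \<open>The energy space\<close>

lemma state_ops:
  "(u, v, y, z) + (u', v', y', z') = ((\<lambda>x. u x + u' x, \<lambda>x. v x + v' x, \<lambda>x. y x + y' x, \<lambda>x. z x + z' x) :: state)"
  "(u, v, y, z) - (u', v', y', z') = ((\<lambda>x. u x - u' x, \<lambda>x. v x - v' x, \<lambda>x. y x - y' x, \<lambda>x. z x - z' x) :: state)"
  "- (u, v, y, z) = ((\<lambda>x. - u x, \<lambda>x. - v x, \<lambda>x. - y x, \<lambda>x. - z x) :: state)"
  by (auto simp: fun_eq_iff)

lemma energy_space_iff: "(u, v, y, z) \<in> energy_space L \<longleftrightarrow> u \<in> H10 L \<and> v \<in> L2 L \<and> y \<in> H10 L \<and> z \<in> L2 L"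
  by (simp add: energy_space_def)

text \<open>Writing the energy norm as the Euclidean norm of four real norms gives the triangle inequality without
  recourse to the complex inner product.\<close>

lemma energy_norm_eq:
  assumes L: "L > 0" and a: "a > 0" and u: "H10_derivative L u ux" and y: "H10_derivative L y yx" and v: "v \<in> L2 L" and z: "z \<in> L2 L"
  shows "energy_norm L a (u, v, y, z) = norm ((nrm L v, sqrt a * nrm L ux), (nrm L z, nrm L yx))"
proof -
  note wu = wderiv_AE[OF L H10_derivative_hwd[OF u]] and wy = wderiv_AE[OF L H10_derivative_hwd[OF y]]
  have "nrm L (wderiv L u) = nrm L ux"
    by (rule nrm_cong_AE[OF wu(2) hwd_L2(2)[OF wu(1)] hwd_L2(2)[OF H10_derivative_hwd[OF u]]])
  moreover have "nrm L (wderiv L y) = nrm L yx"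
    by (rule nrm_cong_AE[OF wy(2) hwd_L2(2)[OF wy(1)] hwd_L2(2)[OF H10_derivative_hwd[OF y]]])
  ultimately show ?thesis
    using a hwd_L2(2)[OF wu(1)] hwd_L2(2)[OF wy(1)] v z
    by (simp add: energy_norm_def L2_inner_Re norm_Pair nrm_power2[symmetric] power_mult_distrib)
qed

lemma energy_norm_wderiv:
  assumes "L > 0" "a > 0" "(u, v, y, z) \<in> energy_space L"
  shows "energy_norm L a (u, v, y, z) = norm ((nrm L v, sqrt a * nrm L (wderiv L u)), (nrm L z, nrm L (wderiv L y)))"
  using assms by (intro energy_norm_eq H10_wderiv) (auto simp: energy_space_iff)

lemma norm_quadruple_bounds:
  fixes p q r s :: real
  shows "\<bar>p\<bar> \<le> norm ((p, q), (r, s))" "\<bar>q\<bar> \<le> norm ((p, q), (r, s))" "\<bar>r\<bar> \<le> norm ((p, q), (r, s))" "\<bar>s\<bar> \<le> norm ((p, q), (r, s))"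
  unfolding norm_Pair by (auto intro!: real_le_rsqrt)

lemma norm_quadruple_mono:
  fixes p q r s :: real
  assumes "0 \<le> p" "p \<le> p'" "0 \<le> q" "q \<le> q'" "0 \<le> r" "r \<le> r'" "0 \<le> s" "s \<le> s'"
  shows "norm ((p, q), (r, s)) \<le> norm ((p', q'), (r', s'))"
proof -
  have "p\<^sup>2 \<le> p'\<^sup>2" "q\<^sup>2 \<le> q'\<^sup>2" "r\<^sup>2 \<le> r'\<^sup>2" "s\<^sup>2 \<le> s'\<^sup>2" using assms by (auto intro!: power_mono)
  then show ?thesis by (simp add: norm_Pair)
qed

lemma energy_norm_components:
  assumes L: "L > 0" and a: "a > 0" and U: "(u, v, y, z) \<in> energy_space L"
  defines "e \<equiv> energy_norm L a (u, v, y, z)"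
  shows "nrm L v \<le> e" "nrm L (wderiv L u) \<le> e / sqrt a" "nrm L z \<le> e" "nrm L (wderiv L y) \<le> e"
    "nrm L u \<le> L * (e / sqrt a)" "nrm L y \<le> L * e"
proof -
  note q = norm_quadruple_bounds[where p="nrm L v" and q="sqrt a * nrm L (wderiv L u)" and r="nrm L z" and s="nrm L (wderiv L y)",
      folded energy_norm_wderiv[OF L a U] e_def]
  show "nrm L v \<le> e" "nrm L z \<le> e" and y: "nrm L (wderiv L y) \<le> e" using q(1,3,4) by simp_all
  have "sqrt a * nrm L (wderiv L u) \<le> e" using q(2) a by simp
  then show u: "nrm L (wderiv L u) \<le> e / sqrt a" using a by (simp add: pos_le_divide_eq mult.commute)
  have H: "H10_derivative L u (wderiv L u)" "H10_derivative L y (wderiv L y)"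
    using U H10_wderiv[OF L] by (auto simp: energy_space_iff)
  show "nrm L u \<le> L * (e / sqrt a)" using Poincare[OF L H(1)] mult_left_mono[OF u less_imp_le[OF L]] by linarith
  show "nrm L y \<le> L * e" using Poincare[OF L H(2)] mult_left_mono[OF y less_imp_le[OF L]] by linarith
qed

lemma energy_space_lincomb:
  assumes L: "L > 0" and U: "(u, v, y, z) \<in> energy_space L" and W: "(u', v', y', z') \<in> energy_space L"
  shows "(\<lambda>x. j * u x + k * u' x, \<lambda>x. j * v x + k * v' x, \<lambda>x. j * y x + k * y' x, \<lambda>x. j * z x + k * z' x) \<in> energy_space L"
    "H10_derivative L (\<lambda>x. j * u x + k * u' x) (\<lambda>x. j * wderiv L u x + k * wderiv L u' x)"
    "H10_derivative L (\<lambda>x. j * y x + k * y' x) (\<lambda>x. j * wderiv L y x + k * wderiv L y' x)"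
proof -
  have H: "H10_derivative L u (wderiv L u)" "H10_derivative L u' (wderiv L u')" "H10_derivative L y (wderiv L y)" "H10_derivative L y' (wderiv L y')"
    using U W H10_wderiv[OF L] by (auto simp: energy_space_iff)
  show 1: "H10_derivative L (\<lambda>x. j * u x + k * u' x) (\<lambda>x. j * wderiv L u x + k * wderiv L u' x)"
    by (rule H10_derivative_lincomb[OF L H(1,2)])
  show 2: "H10_derivative L (\<lambda>x. j * y x + k * y' x) (\<lambda>x. j * wderiv L y x + k * wderiv L y' x)"
    by (rule H10_derivative_lincomb[OF L H(3,4)])
  show "(\<lambda>x. j * u x + k * u' x, \<lambda>x. j * v x + k * v' x, \<lambda>x. j * y x + k * y' x, \<lambda>x. j * z x + k * z' x) \<in> energy_space L"
    using H10_derivative_H10[OF L 1] H10_derivative_H10[OF L 2] U W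
    by (auto simp: energy_space_iff intro!: L2_add L2_cmult)
qed

lemma energy_space_scale:
  assumes L: "L > 0" and "U \<in> energy_space L" shows "state_scale k U \<in> energy_space L"
proof -
  obtain u v y z where U: "U = (u, v, y, z)" by (cases U)
  show ?thesis using energy_space_lincomb(1)[OF L assms(2,2)[unfolded U], of k 0] by (simp add: U)
qed

lemma energy_space_closed:
  assumes L: "L > 0" and "U \<in> energy_space L" "W \<in> energy_space L"
  shows "U + W \<in> energy_space L" "U - W \<in> energy_space L"
proof -
  obtain u v y z where U: "U = (u, v, y, z)" by (cases U)
  obtain u' v' y' z' where W: "W = (u', v', y', z')" by (cases W)
  note c = energy_space_lincomb(1)[OF L assms(2,3)[unfolded U W]]
  show "U + W \<in> energy_space L" unfolding U W state_ops using c[of 1 1] by simp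
  show "U - W \<in> energy_space L" unfolding U W state_ops using c[of 1 "-1"] by simp
qed

lemma energy_norm_triangle:
  assumes L: "L > 0" and a: "a > 0" and "U \<in> energy_space L" "W \<in> energy_space L"
  shows "energy_norm L a (U + W) \<le> energy_norm L a U + energy_norm L a W"
proof -
  obtain u v y z where U: "U = (u, v, y, z)" by (cases U)
  obtain u' v' y' z' where W: "W = (u', v', y', z')" by (cases W)
  note UH = assms(3)[unfolded U] and WH = assms(4)[unfolded W]
  note c = energy_space_lincomb[OF L UH WH, of 1 1, simplified]
  have L2: "v \<in> L2 L" "z \<in> L2 L" "v' \<in> L2 L" "z' \<in> L2 L" "wderiv L u \<in> L2 L" "wderiv L u' \<in> L2 L" "wderiv L y \<in> L2 L" "wderiv L y' \<in> L2 L"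
    using UH WH H10_L2(2)[OF L] by (auto simp: energy_space_iff)
  have "energy_norm L a (U + W) = norm ((nrm L (\<lambda>x. v x + v' x), sqrt a * nrm L (\<lambda>x. wderiv L u x + wderiv L u' x)),
      (nrm L (\<lambda>x. z x + z' x), nrm L (\<lambda>x. wderiv L y x + wderiv L y' x)))"
    unfolding U W state_ops by (rule energy_norm_eq[OF L a c(2,3) L2_add[OF L2(1,3)] L2_add[OF L2(2,4)]])
  also have "\<dots> \<le> norm ((nrm L v + nrm L v', sqrt a * (nrm L (wderiv L u) + nrm L (wderiv L u'))),
      (nrm L z + nrm L z', nrm L (wderiv L y) + nrm L (wderiv L y')))"
    using a by (intro norm_quadruple_mono mult_left_mono nrm_triangle L2) auto
  also have "\<dots> \<le> energy_norm L a U + energy_norm L a W"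
    unfolding U W energy_norm_wderiv[OF L a UH] energy_norm_wderiv[OF L a WH]
    using norm_triangle_ineq[of "((nrm L v, sqrt a * nrm L (wderiv L u)), (nrm L z, nrm L (wderiv L y)))"
       "((nrm L v', sqrt a * nrm L (wderiv L u')), (nrm L z', nrm L (wderiv L y')))"] by (simp add: distrib_left)
  finally show ?thesis .
qed

lemma energy_norm_scale:
  assumes L: "L > 0" and a: "a > 0" and "U \<in> energy_space L"
  shows "energy_norm L a (state_scale k U) = cmod k * energy_norm L a U"
proof -
  obtain u v y z where U: "U = (u, v, y, z)" by (cases U)
  note UH = assms(3)[unfolded U]
  note c = energy_space_lincomb[OF L UH UH, of k 0, simplified]
  have L2: "v \<in> L2 L" "z \<in> L2 L" using UH by (auto simp: energy_space_iff)
  have "energy_norm L a (state_scale k U) = norm ((nrm L (\<lambda>x. k * v x), sqrt a * nrm L (\<lambda>x. k * wderiv L u x)),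
      (nrm L (\<lambda>x. k * z x), nrm L (\<lambda>x. k * wderiv L y x)))"
    unfolding U state_scale.simps by (rule energy_norm_eq[OF L a c(2,3) L2_cmult[OF L2(1)] L2_cmult[OF L2(2)]])
  also have "\<dots> = norm (cmod k *\<^sub>R ((nrm L v, sqrt a * nrm L (wderiv L u)), (nrm L z, nrm L (wderiv L y))))"
    by (simp add: nrm_cmult mult.left_commute)
  finally show ?thesis unfolding U energy_norm_wderiv[OF L a UH] norm_scaleR by simp
qed

lemma domain_energy_space: "kv_domain L a b \<subseteq> energy_space L"
  by (auto simp: kv_domain_def)

lemma kv_operator_energy_space:
  assumes L: "L > 0" and c: "bounded_weight L c" and U: "U \<in> kv_domain L a b"
  shows "kv_operator L a b c U \<in> energy_space L"
proof -
  obtain u v y z where [simp]: "U = (u, v, y, z)" by (cases U)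
  have d: "v \<in> H10 L" "z \<in> H10 L" "flux L a b u v \<in> H1 L" "wderiv L y \<in> H1 L" using U by (auto simp: kv_domain_def H2_def)
  have L2: "wderiv L (flux L a b u v) \<in> L2 L" "wderiv L (wderiv L y) \<in> L2 L" "v \<in> L2 L" "z \<in> L2 L"
    using hwd_L2(2)[OF wderiv_hwd[OF d(3)]] hwd_L2(2)[OF wderiv_hwd[OF d(4)]] H10_L2(1)[OF L] d by auto
  then show ?thesis using d(1,2) L2_plus(2)[OF c L2(1,4)] L2_plus(1)[OF c L2(2,3)] by (simp add: energy_space_iff)
qed

lemma kv_seminormed_semigroup:
  assumes L: "L > 0" and a: "a > 0" and c: "bounded_weight L c"
    and sg: "contraction_C0_semigroup state_scale (energy_space L) (energy_norm L a) T"
    and gen: "is_generator state_scale (energy_space L) (energy_norm L a) T (kv_domain L a b) (kv_operator L a b c)"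
  shows "seminormed_semigroup state_scale (energy_space L) (energy_norm L a) T (kv_domain L a b) (kv_operator L a b c)"
proof
  fix U W :: state and k :: complex
  show "U \<in> energy_space L \<Longrightarrow> W \<in> energy_space L \<Longrightarrow> U + W \<in> energy_space L" by (rule energy_space_closed(1)[OF L])
  show "U \<in> energy_space L \<Longrightarrow> W \<in> energy_space L \<Longrightarrow> U - W \<in> energy_space L" by (rule energy_space_closed(2)[OF L])
  show "U \<in> energy_space L \<Longrightarrow> state_scale k U \<in> energy_space L" by (rule energy_space_scale[OF L])
  show "0 \<le> energy_norm L a U"
  proof -
    obtain u v y z where U: "U = (u, v, y, z)" by (cases U)
    have "0 \<le> Re (L2_inner L f f)" for f
      unfolding L2_inner_def
    proof (cases "integrable (lebesgue_on {0<..<L}) (\<lambda>x. f x * cnj (f x))")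
      case True
      show "0 \<le> Re (LINT x|lebesgue_on {0<..<L}. f x * cnj (f x))"
        unfolding integral_Re[OF True, symmetric] Re_mult_cnj_self by (rule Bochner_Integration.integral_nonneg) simp
    qed (simp add: not_integrable_integral_eq)
    then show ?thesis unfolding energy_norm_def U using a by simp
  qed
  show "U \<in> energy_space L \<Longrightarrow> W \<in> energy_space L \<Longrightarrow> energy_norm L a (U + W) \<le> energy_norm L a U + energy_norm L a W"
    by (rule energy_norm_triangle[OF L a])
  show "U \<in> energy_space L \<Longrightarrow> energy_norm L a (state_scale k U) = cmod k * energy_norm L a U" by (rule energy_norm_scale[OF L a])
  show "state_scale (- 1) U = - U" "state_scale k (U - W) = state_scale k U - state_scale k W" "state_scale (- k) U = - state_scale k U"
    by (cases U; cases W; auto simp: fun_eq_iff algebra_simps)+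
  show "kv_domain L a b \<subseteq> energy_space L" by (rule domain_energy_space)
  show "U \<in> kv_domain L a b \<Longrightarrow> kv_operator L a b c U \<in> energy_space L" by (rule kv_operator_energy_space[OF L c])
qed (fact sg gen)+

lemma energy_norm_zero_components:
  assumes L: "L > 0" and a: "a > 0" and U: "(u, v, y, z) \<in> energy_space L" and 0: "energy_norm L a (u, v, y, z) = 0"
  shows "AE x in lebesgue_on {0<..<L}. u x = 0" "AE x in lebesgue_on {0<..<L}. wderiv L u x = 0" "AE x in lebesgue_on {0<..<L}. v x = 0"
    "AE x in lebesgue_on {0<..<L}. y x = 0" "AE x in lebesgue_on {0<..<L}. wderiv L y x = 0" "AE x in lebesgue_on {0<..<L}. z x = 0"
proof -
  note c = energy_norm_components[OF L a U, unfolded 0, simplified]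
  have L2: "u \<in> L2 L" "v \<in> L2 L" "y \<in> L2 L" "z \<in> L2 L" "wderiv L u \<in> L2 L" "wderiv L y \<in> L2 L"
    using U H10_L2[OF L] by (auto simp: energy_space_iff)
  have z: "AE x in lebesgue_on {0<..<L}. f x = 0" if "f \<in> L2 L" "nrm L f \<le> 0" for f
    using nrm_zero_iff[OF that(1)] that(2) nrm_nonneg[of L f] by auto
  show "AE x in lebesgue_on {0<..<L}. u x = 0" "AE x in lebesgue_on {0<..<L}. wderiv L u x = 0" "AE x in lebesgue_on {0<..<L}. v x = 0"
    "AE x in lebesgue_on {0<..<L}. y x = 0" "AE x in lebesgue_on {0<..<L}. wderiv L y x = 0" "AE x in lebesgue_on {0<..<L}. z x = 0"
    by (rule z[OF L2(1) c(5)] z[OF L2(5) c(2)] z[OF L2(2) c(1)] z[OF L2(3) c(6)] z[OF L2(6) c(4)] z[OF L2(4) c(3)])+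
qed

text \<open>The relation \<open>A (u,v,y,z) = (u',v',y',z')\<close> holds only in the energy seminorm. Here it is turned
  into the differential equations between the representatives, with \<open>v\<close> and \<open>z\<close>
  replaced by \<open>u'\<close> and \<open>y'\<close>.\<close>

lemma domain_image_relations:
  assumes L: "L > 0" and a: "a > 0" and b: "bounded_weight L b" and c: "bounded_weight L c"
    and P: "(u, v, y, z) \<in> kv_domain L a b" and Q: "(u', v', y', z') \<in> energy_space L"
    and eq: "energy_norm L a (kv_operator L a b c (u, v, y, z) - (u', v', y', z')) = 0"
  shows "AE x in lebesgue_on {0<..<L}. v x = u' x" "AE x in lebesgue_on {0<..<L}. wderiv L v x = wderiv L u' x"
    "AE x in lebesgue_on {0<..<L}. z x = y' x" "AE x in lebesgue_on {0<..<L}. wderiv L z x = wderiv L y' x"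
    "has_weak_derivative L (\<lambda>x. of_real a * wderiv L u x + of_real (b x) * wderiv L u' x) (\<lambda>x. v' x + of_real (c x) * y' x)"
    "has_weak_derivative L (wderiv L y) (\<lambda>x. z' x - of_real (c x) * u' x)"
proof -
  let ?f = "flux L a b u v"
  have d: "u \<in> H10 L" "v \<in> H10 L" "z \<in> H10 L" "?f \<in> H1 L" "wderiv L y \<in> H1 L"
    using P by (auto simp: kv_domain_def H2_def energy_space_iff)
  have q: "u' \<in> H10 L" "v' \<in> L2 L" "y' \<in> H10 L" "z' \<in> L2 L" using Q by (auto simp: energy_space_iff)
  have diff: "kv_operator L a b c (u, v, y, z) - (u', v', y', z') = (\<lambda>x. v x - u' x, \<lambda>x. wderiv L ?f x - of_real (c x) * z x - v' x,
     \<lambda>x. z x - y' x, \<lambda>x. wderiv L (wderiv L y) x + of_real (c x) * v x - z' x)" (is "_ = (?A, ?B, ?C, ?E)")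
    unfolding kv_operator.simps state_ops ..
  have H: "(?A, ?B, ?C, ?E) \<in> energy_space L"
    using energy_space_closed(2)[OF L kv_operator_energy_space[OF L c P] Q] unfolding diff .
  note z = energy_norm_zero_components[OF L a H eq[unfolded diff]]
  show v: "AE x in lebesgue_on {0<..<L}. v x = u' x" using z(1) by simp
  show z': "AE x in lebesgue_on {0<..<L}. z x = y' x" using z(4) by simp
  have hw: "has_weak_derivative L g (wderiv L g)" if "g \<in> H10 L" for g by (rule H10_derivative_hwd[OF H10_wderiv[OF L that]])
  show vx: "AE x in lebesgue_on {0<..<L}. wderiv L v x = wderiv L u' x"
    using z(2) wderiv_AE(2)[OF L hwd_diff[OF hw[OF d(2)] hw[OF q(1)]]] by eventually_elim simp
  show "AE x in lebesgue_on {0<..<L}. wderiv L z x = wderiv L y' x"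
    using z(5) wderiv_AE(2)[OF L hwd_diff[OF hw[OF d(3)] hw[OF q(3)]]] by eventually_elim simp
  show "has_weak_derivative L (\<lambda>x. of_real a * wderiv L u x + of_real (b x) * wderiv L u' x) (\<lambda>x. v' x + of_real (c x) * y' x)"
  proof (rule hwd_cong_AE[OF wderiv_hwd[OF d(4)]])
    show "(\<lambda>x. of_real a * wderiv L u x + of_real (b x) * wderiv L u' x) \<in> L2 L"
      by (rule L2_plus(3)[OF b H10_L2(2)[OF L d(1)] H10_L2(2)[OF L q(1)]])
    show "(\<lambda>x. v' x + of_real (c x) * y' x) \<in> L2 L" by (rule L2_plus(1)[OF c q(2) H10_L2(1)[OF L q(3)]])
    show "AE x in lebesgue_on {0<..<L}. ?f x = of_real a * wderiv L u x + of_real (b x) * wderiv L u' x"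
      using vx by eventually_elim (simp add: flux_def)
    show "AE x in lebesgue_on {0<..<L}. wderiv L ?f x = v' x + of_real (c x) * y' x"
      using z(3) z' by eventually_elim (simp add: algebra_simps)
  qed
  show "has_weak_derivative L (wderiv L y) (\<lambda>x. z' x - of_real (c x) * u' x)"
  proof (rule hwd_cong_AE[OF wderiv_hwd[OF d(5)]])
    show "wderiv L y \<in> L2 L" by (rule hwd_L2(1)[OF wderiv_hwd[OF d(5)]])
    show "(\<lambda>x. z' x - of_real (c x) * u' x) \<in> L2 L" by (rule L2_plus(2)[OF c q(4) H10_L2(1)[OF L q(1)]])
    show "AE x in lebesgue_on {0<..<L}. wderiv L (wderiv L y) x = z' x - of_real (c x) * u' x"
      using z(6) v by eventually_elim (simp add: algebra_simps)
  qed simp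
qed

lemma L2_time_derivative_cong:
  assumes "L2_time_derivative L p p' t" "\<And>s. p s \<in> L2 L" "p' \<in> L2 L" "p'' \<in> L2 L" "AE x in lebesgue_on {0<..<L}. p' x = p'' x"
  shows "L2_time_derivative L p p'' t"
proof -
  have "nrm L (\<lambda>x. of_real (1 / h) * (p (t + h) x - p t x) - p' x) = nrm L (\<lambda>x. of_real (1 / h) * (p (t + h) x - p t x) - p'' x)" for h
  proof (rule nrm_cong_AE)
    show "AE x in lebesgue_on {0<..<L}. of_real (1 / h) * (p (t + h) x - p t x) - p' x = of_real (1 / h) * (p (t + h) x - p t x) - p'' x"
      using assms(5) by eventually_elim simp
  qed (rule L2_diff[OF L2_cmult[OF L2_diff[OF assms(2) assms(2)]] assms(3)] L2_diff[OF L2_cmult[OF L2_diff[OF assms(2) assms(2)]] assms(4)])+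
  then show ?thesis using assms(1) unfolding L2_time_derivative_def by simp
qed

text \<open>Convergence in the energy norm controls the gradients of the displacements and the velocities directly, and
  the displacements themselves by Poincare's inequality.\<close>

lemma components_time_derivative:
  assumes L: "L > 0" and a: "a > 0" and S: "\<And>s. (u s, v s, y s, z s) \<in> energy_space L" and S': "(u', v', y', z') \<in> energy_space L"
    and lim: "((\<lambda>h. energy_norm L a (state_scale (of_real (1 / h)) ((u (t + h), v (t + h), y (t + h), z (t + h)) - (u t, v t, y t, z t)) - (u', v', y', z'))) \<longlongrightarrow> 0) (at 0)"
  shows "L2_time_derivative L u u' t" "L2_time_derivative L v v' t" "L2_time_derivative L y y' t" "L2_time_derivative L z z' t"
    "L2_time_derivative L (\<lambda>s. wderiv L (u s)) (wderiv L u') t" "L2_time_derivative L (\<lambda>s. wderiv L (y s)) (wderiv L y') t"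
proof -
  define N where "N h = energy_norm L a (state_scale (of_real (1 / h)) ((u (t + h), v (t + h), y (t + h), z (t + h)) - (u t, v t, y t, z t)) - (u', v', y', z'))" for h
  define q where "q p p' h x = of_real (1 / h) * (p (t + h) x - p t x) - p' x" for p :: "real \<Rightarrow> real \<Rightarrow> complex" and p' :: "real \<Rightarrow> complex" and h x
  have st: "state_scale (of_real (1 / h)) ((u (t + h), v (t + h), y (t + h), z (t + h)) - (u t, v t, y t, z t)) - (u', v', y', z')
     = (q u u' h, q v v' h, q y y' h, q z z' h)" for h
    unfolding state_ops state_scale.simps q_def[abs_def] ..
  have H: "(q u u' h, q v v' h, q y y' h, q z z' h) \<in> energy_space L" for h
    unfolding st[symmetric] by (intro energy_space_closed(2)[OF L] energy_space_scale[OF L] S S')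
  have Nq: "energy_norm L a (q u u' h, q v v' h, q y y' h, q z z' h) = N h" for h unfolding N_def st ..
  note comp = energy_norm_components[OF L a H, unfolded Nq]
  have qexp: "(\<lambda>x. of_real (1 / h) * (p (t + h) x - p t x) - p' x) = q p p' h" for p p' h
    by (rule ext) (simp only: q_def)
  have lim0: "(N \<longlongrightarrow> 0) (at 0)" using lim unfolding N_def .
  have conv: "((\<lambda>h. nrm L (f h)) \<longlongrightarrow> 0) (at 0)" if "\<And>h. nrm L (f h) \<le> K * N h" for f K
    by (rule Lim_null_comparison[OF _ tendsto_mult_right_zero[OF lim0, of K]]) (use that in simp)
  have hw: "has_weak_derivative L g (wderiv L g)" if "g \<in> H10 L" for g by (rule H10_derivative_hwd[OF H10_wderiv[OF L that]])
  have wq: "nrm L (\<lambda>x. of_real (1 / h) * (wderiv L (p (t + h)) x - wderiv L (p t) x) - wderiv L p' x) = nrm L (wderiv L (q p p' h))"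
    if p: "\<And>s. p s \<in> H10 L" "p' \<in> H10 L" for p p' h
  proof -
    have "has_weak_derivative L (q p p' h) (\<lambda>x. of_real (1 / h) * (wderiv L (p (t + h)) x - wderiv L (p t) x) - wderiv L p' x)"
      unfolding q_def[abs_def] by (intro hwd_diff hwd_cmult hw p)
    from nrm_cong_AE[OF wderiv_AE(2)[OF L this] hwd_L2(2)[OF wderiv_AE(1)[OF L this]] hwd_L2(2)[OF this]] show ?thesis by simp
  qed
  have mem: "\<And>s. u s \<in> H10 L" "u' \<in> H10 L" "\<And>s. y s \<in> H10 L" "y' \<in> H10 L" using S S' by (auto simp: energy_space_iff)
  note T = L2_time_derivative_def
  show "L2_time_derivative L u u' t" unfolding T qexp by (rule conv[where K="L / sqrt a"]) (use comp(5) in simp)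
  show "L2_time_derivative L v v' t" unfolding T qexp by (rule conv[where K=1]) (use comp(1) in simp)
  show "L2_time_derivative L y y' t" unfolding T qexp by (rule conv[where K=L]) (use comp(6) in simp)
  show "L2_time_derivative L z z' t" unfolding T qexp by (rule conv[where K=1]) (use comp(3) in simp)
  show "L2_time_derivative L (\<lambda>s. wderiv L (u s)) (wderiv L u') t" unfolding T
  proof (rule conv[where K="1 / sqrt a"])
    show "nrm L (\<lambda>x. of_real (1 / h) * (wderiv L (u (t + h)) x - wderiv L (u t) x) - wderiv L u' x) \<le> 1 / sqrt a * N h" for h
      by (rule order_trans[OF eq_refl[OF wq[OF mem(1,2)]]]) (use comp(2)[of h] in simp)
  qed
  show "L2_time_derivative L (\<lambda>s. wderiv L (y s)) (wderiv L y') t" unfolding T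
  proof (rule conv[where K=1])
    show "nrm L (\<lambda>x. of_real (1 / h) * (wderiv L (y (t + h)) x - wderiv L (y t) x) - wderiv L y' x) \<le> 1 * N h" for h
      by (rule order_trans[OF eq_refl[OF wq[OF mem(3,4)]]]) (use comp(4)[of h] in simp)
  qed
qed

section \<open>Strong stability\<close>

lemma mean_test_derivative:
  assumes "L > 0" "\<phi> \<in> test_functions L" shows "(LINT x|lebesgue_on {0<..<L}. vd \<phi> x) = 0"
proof -
  have t: "\<phi> \<in> tests L {}" using assms by (simp add: test_functions_eq)
  then obtain K where "K \<subseteq> {0<..<L} - {}" "\<forall>x. x \<notin> K \<longrightarrow> \<phi> x = 0" unfolding tests_def by blast
  then have "\<phi> 0 = 0" "\<phi> L = 0" by auto
  note C = C1_smooth[OF tests_smooth[OF t]]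
  show ?thesis
    using integral_interval_derivative[OF less_imp_le[OF assms(1)] C1_derivative[OF C] C1_continuous'[OF C]] \<open>\<phi> 0 = 0\<close> \<open>\<phi> L = 0\<close> by simp
qed

lemma H10_approx_test:
  assumes L: "L > 0" and u: "u \<in> H10 L" and e: "e > 0"
  obtains \<phi> where "\<phi> \<in> test_functions L" "nrm L (\<lambda>x. wderiv L u x - vd \<phi> x) < e"
proof -
  obtain \<phi> where \<phi>: "\<And>n::nat. \<phi> n \<in> test_functions L" "(\<lambda>n. nrm L (\<lambda>x. vd (\<phi> n) x - wderiv L u x)) \<longlonglongrightarrow> 0"
    using H10_wderiv[OF L u] unfolding H10_derivative_def by blast
  obtain n where "nrm L (\<lambda>x. vd (\<phi> n) x - wderiv L u x) < e"
    using order_tendstoD(2)[OF \<phi>(2) e] by (auto simp: eventually_sequentially)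
  then show ?thesis using that[OF \<phi>(1)[of n]] nrm_diff_commute[of L "wderiv L u" "vd (\<phi> n)"] by simp
qed

text \<open>The displacement \<open>u\<close> is approximated in two steps: by a test function, and then by one whose
  derivative is flat, which is possible because the derivative of a test function has mean zero.\<close>

lemma domain_square_dense:
  fixes L a b0 c0 \<alpha>1 \<alpha>2 \<alpha>3 \<alpha>4 :: real
  assumes L: "L > 0" and a: "a > 0" and U: "U \<in> energy_space L" and e: "e > 0"
  defines "D \<equiv> kv_domain L a (local_coeff b0 \<alpha>1 \<alpha>3)"
    and "A \<equiv> kv_operator L a (local_coeff b0 \<alpha>1 \<alpha>3) (local_coeff c0 \<alpha>2 \<alpha>4)"
  shows "\<exists>W\<in>D. A W \<in> D \<and> energy_norm L a (U - W) < e"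
proof -
  let ?P = "{\<alpha>1, \<alpha>2, \<alpha>3, \<alpha>4}"
  obtain u v y z where Uc: "U = (u, v, y, z)" by (cases U)
  have mem: "u \<in> H10 L" "v \<in> L2 L" "y \<in> H10 L" "z \<in> L2 L" using U by (auto simp: Uc energy_space_iff)
  \<comment> \<open>The four components contribute at most \<open>d\<close>, \<open>2 * sqrt a * d\<close>,
       \<open>d\<close> and \<open>d\<close> to the error.\<close>
  define d where "d = e / (2 * (4 + 2 * sqrt a))"
  have d: "d > 0" using e a by (auto simp: d_def intro!: divide_pos_pos add_pos_nonneg)
  obtain \<phi> where \<phi>: "\<phi> \<in> test_functions L" "nrm L (\<lambda>x. wderiv L u x - vd \<phi> x) < d" by (rule H10_approx_test[OF L mem(1) d])
  obtain Y where Y: "Y \<in> test_functions L" "nrm L (\<lambda>x. wderiv L y x - vd Y x) < d" by (rule H10_approx_test[OF L mem(3) d])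
  obtain u1 where u1: "u1 \<in> test_functions L" "vd u1 \<in> tests L ?P" "nrm L (\<lambda>x. vd \<phi> x - vd u1 x) < d"
    by (rule mean_zero_approx[OF L _ test_L2(2)[OF \<phi>(1)] mean_test_derivative[OF L \<phi>(1)] d, of ?P]) auto
  obtain V where V: "V \<in> tests L ?P" "nrm L (\<lambda>x. v x - V x) < d" by (rule tests_dense_obtain[OF L _ mem(2) d, of ?P]) auto
  obtain Z where Z: "Z \<in> tests L ?P" "nrm L (\<lambda>x. z x - Z x) < d" by (rule tests_dense_obtain[OF L _ mem(4) d, of ?P]) auto
  have W: "(u1, V, Y, Z) \<in> D" "A (u1, V, Y, Z) \<in> D"
    unfolding D_def A_def by (rule domain_square_flat_data[OF L u1(1,2) V(1) Y(1) Z(1)])+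
  have ux: "nrm L (\<lambda>x. wderiv L u x - vd u1 x) \<le> 2 * d"
  proof -
    have "nrm L (\<lambda>x. (wderiv L u x - vd \<phi> x) + (vd \<phi> x - vd u1 x)) \<le> nrm L (\<lambda>x. wderiv L u x - vd \<phi> x) + nrm L (\<lambda>x. vd \<phi> x - vd u1 x)"
      by (intro nrm_triangle L2_diff H10_L2(2)[OF L mem(1)] test_L2(2) \<phi> u1)
    then show ?thesis using \<phi>(2) u1(3) by simp
  qed
  have H: "H10_derivative L (\<lambda>x. u x - u1 x) (\<lambda>x. wderiv L u x - vd u1 x)" "H10_derivative L (\<lambda>x. y x - Y x) (\<lambda>x. wderiv L y x - vd Y x)"
    using H10_derivative_lincomb[OF L H10_wderiv[OF L mem(1)] H10_derivative_test[OF L u1(1)], of 1 "-1"]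
      H10_derivative_lincomb[OF L H10_wderiv[OF L mem(3)] H10_derivative_test[OF L Y(1)], of 1 "-1"] by simp_all
  have "energy_norm L a (U - (u1, V, Y, Z)) = norm ((nrm L (\<lambda>x. v x - V x), sqrt a * nrm L (\<lambda>x. wderiv L u x - vd u1 x)),
      (nrm L (\<lambda>x. z x - Z x), nrm L (\<lambda>x. wderiv L y x - vd Y x)))"
    unfolding Uc state_ops by (rule energy_norm_eq[OF L a H L2_diff[OF mem(2) tests_L2[OF V(1)]] L2_diff[OF mem(4) tests_L2[OF Z(1)]]])
  also have "\<dots> \<le> (nrm L (\<lambda>x. v x - V x) + sqrt a * nrm L (\<lambda>x. wderiv L u x - vd u1 x)) + (nrm L (\<lambda>x. z x - Z x) + nrm L (\<lambda>x. wderiv L y x - vd Y x))"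
    using a by (intro order_trans[OF norm_Pair_le] add_mono order_trans[OF norm_Pair_le]) simp_all
  also have "\<dots> \<le> (d + sqrt a * (2 * d)) + (d + d)"
    using V Z Y ux a by (intro add_mono mult_left_mono) auto
  also have "\<dots> \<le> d * (4 + 2 * sqrt a)" using d a by (simp add: algebra_simps)
  also have "\<dots> = e / 2"
  proof -
    have "4 + 2 * sqrt a > 0" using a by (intro add_pos_nonneg) auto
    then show ?thesis by (simp add: d_def field_simps)
  qed
  also have "\<dots> < e" using e by simp
  finally show ?thesis using W by blast
qed

theorem theorem2p3:
  fixes L a b0 c0 \<alpha>1 \<alpha>2 \<alpha>3 \<alpha>4 :: real
    and T :: "real \<Rightarrow> state \<Rightarrow> state"
  assumes "L > 0" and "a > 0" and "b0 > 0" and "c0 > 0"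
    and "0 < \<alpha>1" and "\<alpha>1 < \<alpha>2" and "\<alpha>2 < \<alpha>3" and "\<alpha>3 < \<alpha>4" and "\<alpha>4 < L"
    and "contraction_C0_semigroup state_scale (energy_space L) (energy_norm L a) T"
    and "is_generator state_scale (energy_space L) (energy_norm L a) T
           (kv_domain L a (local_coeff b0 \<alpha>1 \<alpha>3))
           (kv_operator L a (local_coeff b0 \<alpha>1 \<alpha>3) (local_coeff c0 \<alpha>2 \<alpha>4))"
  shows "\<forall>U0\<in>energy_space L. ((\<lambda>t. energy_norm L a (T t U0)) \<longlongrightarrow> 0) at_top"
proof -
  define b where "b = local_coeff b0 \<alpha>1 \<alpha>3"
  define c where "c = local_coeff c0 \<alpha>2 \<alpha>4"
  define H where "H = energy_space L"
  define N where "N = energy_norm L a"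
  define D where "D = kv_domain L a b"
  define A where "A = kv_operator L a b c"
  note L = assms(1) and a = assms(2)
  have bw: "bounded_weight L b" "bounded_weight L c" by (simp_all add: b_def c_def)
  interpret S: seminormed_semigroup state_scale H N T D A
    unfolding H_def N_def D_def A_def using assms(10,11) unfolding b_def c_def
    by (intro kv_seminormed_semigroup L a bounded_weight_local_coeff)
  have stable: "((\<lambda>t. N (T t Y0)) \<longlongrightarrow> 0) at_top" if Y0: "Y0 \<in> D" "A Y0 \<in> D" for Y0
  proof -
    \<comment> \<open>The orbit and its first two time derivatives; they are frozen for negative times so as to be defined
         everywhere.\<close>
    define Y X Z where "Y t = T (max 0 t) Y0" and "X t = T (max 0 t) (A Y0)" and "Z t = T (max 0 t) (A (A Y0))" for t
    define pu pv py pz :: "state \<Rightarrow> real \<Rightarrow> complex"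
      where "pu U = fst U" and "pv U = fst (snd U)" and "py U = fst (snd (snd U))" and "pz U = snd (snd (snd U))" for U
    have parts: "U = (pu U, pv U, py U, pz U)" for U by (simp add: pu_def pv_def py_def pz_def)
    have inD: "Y t \<in> D" "X t \<in> D" for t unfolding Y_def X_def by (intro S.generator_invariant(1) Y0; simp)+
    have AAH: "A (A Y0) \<in> H" "A Y0 \<in> H" "Y0 \<in> H" using Y0 S.A_H S.D_H by auto
    have inH: "Y t \<in> H" "X t \<in> H" "Z t \<in> H" for t unfolding Y_def X_def Z_def by (intro S.T_H AAH; simp)+
    have AY: "N (A (Y t) - X t) = 0" and AX: "N (A (X t) - Z t) = 0" for t
      using S.generator_invariant(2)[OF Y0(1), of "max 0 t"] S.generator_invariant(2)[OF Y0(2), of "max 0 t"]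
      unfolding S.eqv_def Y_def X_def Z_def by simp_all
    define M0 where "M0 = N Y0 + N (A Y0) + N (A (A Y0))"
    have NM: "N (Y t) \<le> M0" "N (X t) \<le> M0" "N (Z t) \<le> M0" for t
      using S.T_contr[of "max 0 t" Y0] S.T_contr[of "max 0 t" "A Y0"] S.T_contr[of "max 0 t" "A (A Y0)"] AAH
        S.N_nonneg[of Y0] S.N_nonneg[of "A Y0"] S.N_nonneg[of "A (A Y0)"]
      unfolding Y_def X_def Z_def M0_def by simp_all
    have HY: "(pu (Y t), pv (Y t), py (Y t), pz (Y t)) \<in> energy_space L"
      and HX: "(pu (X t), pv (X t), py (X t), pz (X t)) \<in> energy_space L"
      and HZ: "(pu (Z t), pv (Z t), py (Z t), pz (Z t)) \<in> energy_space L" for t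
      using inH[of t] by (simp_all only: parts[symmetric] H_def)
    have DY: "(pu (Y t), pv (Y t), py (Y t), pz (Y t)) \<in> kv_domain L a b"
      and DX: "(pu (X t), pv (X t), py (X t), pz (X t)) \<in> kv_domain L a b" for t
      using inD[of t] by (simp_all only: parts[symmetric] D_def)
    \<comment> \<open>The abstract relations \<open>A (Y t) = X t\<close> and \<open>A (X t) = Z t\<close> become the
         differential equations of the trajectory.\<close>
    note relY = domain_image_relations[OF L a bw DY HX, unfolded parts[symmetric], OF AY[unfolded N_def A_def]]
    note relX = domain_image_relations[OF L a bw DX HZ, unfolded parts[symmetric], OF AX[unfolded N_def A_def]]
    have memD: "pv (X t) \<in> H10 L" "pz (X t) \<in> H10 L" for t using DX[of t] by (auto simp: kv_domain_def)
    have H10: "pu (Y t) \<in> H10 L" "py (Y t) \<in> H10 L" "pu (X t) \<in> H10 L" "py (X t) \<in> H10 L" "pu (Z t) \<in> H10 L" "py (Z t) \<in> H10 L" for t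
      using HY[of t] HX[of t] HZ[of t] by (auto simp: energy_space_iff)
    have L2Z: "pv (Z t) \<in> L2 L" "pz (Z t) \<in> L2 L" "pv (Y t) \<in> L2 L" "pz (Y t) \<in> L2 L" for t
      using HZ[of t] HY[of t] by (auto simp: energy_space_iff)
    note L2H = H10_L2[OF L H10(1)] H10_L2[OF L H10(2)] H10_L2[OF L H10(3)] H10_L2[OF L H10(4)] H10_L2[OF L H10(5)] H10_L2[OF L H10(6)]
      H10_L2[OF L memD(1)] H10_L2[OF L memD(2)]
    define M where "M = M0 + M0 / sqrt a + L * (M0 / sqrt a) + L * M0"
    have M0: "0 \<le> M0" using S.N_nonneg by (simp add: M0_def)
    have Mle: "M0 \<le> M" "M0 / sqrt a \<le> M" "L * (M0 / sqrt a) \<le> M" "L * M0 \<le> M"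
      using M0 L a unfolding M_def by (simp_all add: add_nonneg_nonneg)
    have bound: "nrm L v \<le> M" "nrm L (wderiv L u) \<le> M" "nrm L z \<le> M" "nrm L (wderiv L y) \<le> M" "nrm L u \<le> M" "nrm L y \<le> M"
      if U: "(u, v, y, z) \<in> energy_space L" and e: "energy_norm L a (u, v, y, z) \<le> M0" for u v y z
    proof -
      note q = energy_norm_components[OF L a U]
      have ea: "energy_norm L a (u, v, y, z) / sqrt a \<le> M0 / sqrt a" using e a by (simp add: divide_right_mono)
      have eL: "L * (energy_norm L a (u, v, y, z) / sqrt a) \<le> L * (M0 / sqrt a)" by (rule mult_left_mono[OF ea less_imp_le[OF L]])
      have eL': "L * energy_norm L a (u, v, y, z) \<le> L * M0" by (rule mult_left_mono[OF e less_imp_le[OF L]])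
      show "nrm L v \<le> M" "nrm L (wderiv L u) \<le> M" "nrm L z \<le> M" "nrm L (wderiv L y) \<le> M" "nrm L u \<le> M" "nrm L y \<le> M"
        using q e ea eL eL' Mle by linarith+
    qed
    note bY = bound[OF HY, unfolded parts[symmetric], OF NM(1)[unfolded N_def]]
    note bX = bound[OF HX, unfolded parts[symmetric], OF NM(2)[unfolded N_def]]
    note bZ = bound[OF HZ, unfolded parts[symmetric], OF NM(3)[unfolded N_def]]
    have bvx: "nrm L (wderiv L (pv (X t))) \<le> M" for t
      using nrm_cong_AE[OF relX(2)[of t] H10_L2(2)[OF L memD(1)] H10_L2(2)[OF L H10(5)]] bZ(2)[of t] by simp
    have bzx: "nrm L (wderiv L (pz (X t))) \<le> M" for t
      using nrm_cong_AE[OF relX(4)[of t] H10_L2(2)[OF L memD(2)] H10_L2(2)[OF L H10(6)]] bZ(4)[of t] by simp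
    \<comment> \<open>The velocity components of \<open>X\<close> agree with the displacements of \<open>Z\<close> almost
         everywhere; in the equations the former are used.\<close>
    have flux1: "has_weak_derivative L (\<lambda>x. of_real a * wderiv L (pu (X t)) x + of_real (b x) * wderiv L (pv (X t)) x)
        (\<lambda>x. pv (Z t) x + of_real (c x) * pz (X t) x)" for t
    proof (rule hwd_cong_AE[OF relX(5)[of t]])
      show "(\<lambda>x. of_real a * wderiv L (pu (X t)) x + of_real (b x) * wderiv L (pv (X t)) x) \<in> L2 L"
        by (rule L2_plus(3)[OF bw(1) H10_L2(2)[OF L H10(3)] H10_L2(2)[OF L memD(1)]])
      show "(\<lambda>x. pv (Z t) x + of_real (c x) * pz (X t) x) \<in> L2 L" by (rule L2_plus(1)[OF bw(2) L2Z(1) H10_L2(1)[OF L memD(2)]])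
      show "AE x in lebesgue_on {0<..<L}. of_real a * wderiv L (pu (X t)) x + of_real (b x) * wderiv L (pu (Z t)) x
          = of_real a * wderiv L (pu (X t)) x + of_real (b x) * wderiv L (pv (X t)) x"
        using relX(2)[of t] by eventually_elim simp
      show "AE x in lebesgue_on {0<..<L}. pv (Z t) x + of_real (c x) * py (Z t) x = pv (Z t) x + of_real (c x) * pz (X t) x"
        using relX(3)[of t] by eventually_elim simp
    qed
    have yxx: "has_weak_derivative L (wderiv L (py (X t))) (\<lambda>x. pz (Z t) x - of_real (c x) * pv (X t) x)" for t
    proof (rule hwd_cong_AE[OF relX(6)[of t] H10_L2(2)[OF L H10(4)]])
      show "(\<lambda>x. pz (Z t) x - of_real (c x) * pv (X t) x) \<in> L2 L" by (rule L2_plus(2)[OF bw(2) L2Z(2) H10_L2(1)[OF L memD(1)]])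
      show "AE x in lebesgue_on {0<..<L}. pz (Z t) x - of_real (c x) * pu (Z t) x = pz (Z t) x - of_real (c x) * pv (X t) x"
        using relX(1)[of t] by eventually_elim simp
    qed simp
    have orbit: "((\<lambda>h. energy_norm L a (state_scale (of_real (1 / h)) (T (max 0 (t + h)) U - T (max 0 t) U) - T (max 0 t) (A U))) \<longlongrightarrow> 0) (at 0)"
      if U: "U \<in> D" and t: "t > 0" for U t
    proof (rule Lim_transform_eventually[OF S.orbit_derivative[OF U t]])
      have "\<forall>\<^sub>F h in at 0. h \<in> {-t<..<t}" using t by (intro eventually_at_in_open') auto
      then show "\<forall>\<^sub>F h in at 0. N (state_scale (of_real (1 / h)) (T (t + h) U - T t U) - T t (A U)) =
          energy_norm L a (state_scale (of_real (1 / h)) (T (max 0 (t + h)) U - T (max 0 t) U) - T (max 0 t) (A U))"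
        by (rule eventually_mono) (use t in \<open>auto simp: N_def max_def\<close>)
    qed
    note tY = components_time_derivative[OF L a HY HX, unfolded parts[symmetric], OF orbit[OF Y0(1), folded Y_def X_def]]
    note tX = components_time_derivative[OF L a HX HZ, unfolded parts[symmetric], OF orbit[OF Y0(2), folded X_def Z_def]]
    have sym: "AE x in lebesgue_on {0<..<L}. g x = f x" if "AE x in lebesgue_on {0<..<L}. f x = g x" for f g :: "real \<Rightarrow> complex"
      using that by eventually_elim simp
    have K: "kv_trajectory L a b0 c0 \<alpha>1 \<alpha>2 \<alpha>3 \<alpha>4 M b c (\<lambda>t. pu (Y t)) (\<lambda>t. wderiv L (pu (Y t))) (\<lambda>t. pu (X t)) (\<lambda>t. wderiv L (pu (X t))) (\<lambda>t. pv (X t)) (\<lambda>t. wderiv L (pv (X t))) (\<lambda>t. pv (Z t)) (\<lambda>t. py (Y t)) (\<lambda>t. wderiv L (py (Y t))) (\<lambda>t. py (X t)) (\<lambda>t. wderiv L (py (X t))) (\<lambda>t. pz (X t)) (\<lambda>t. wderiv L (pz (X t))) (\<lambda>t. pz (Z t))"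
      by (rule kv_trajectory.intro,
        rule b_def, rule c_def, rule assms(1), rule assms(2), rule assms(3), rule assms(4), rule assms(5),
        rule assms(6), rule assms(7), rule assms(8), rule assms(9), rule L2H(1), rule L2H(2), rule L2H(5),
        rule L2H(6), rule L2H(13), rule L2H(14), rule L2Z(1), rule L2H(3), rule L2H(4), rule L2H(7),
        rule L2H(8), rule L2H(15), rule L2H(16), rule L2Z(2), rule bY(5), rule bY(2), rule bX(5), rule bX(2),
        rule bX(1), rule bvx, rule bZ(1), rule bY(6), rule bY(4), rule bX(6), rule bX(4), rule bX(3), rule bzx,
        rule bZ(3), rule H10_wderiv[OF L H10(1)], rule H10_wderiv[OF L H10(3)], rule H10_wderiv[OF L memD(1)],
        rule H10_wderiv[OF L H10(2)], rule H10_wderiv[OF L H10(4)], rule H10_wderiv[OF L memD(2)],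
        rule relY(5), rule flux1, rule relY(6), rule yxx,
        (rule tY(1), assumption),
        (rule L2_time_derivative_cong[OF tX(1) L2H(5) L2H(9) L2H(13) sym[OF relX(1)]], assumption),
        (rule tX(2), assumption), (rule tY(3), assumption),
        (rule L2_time_derivative_cong[OF tX(3) L2H(7) L2H(11) L2H(15) sym[OF relX(3)]], assumption),
        (rule tX(4), assumption), (rule tY(5), assumption),
        (rule L2_time_derivative_cong[OF tX(5) L2H(6) L2H(10) L2H(14) sym[OF relX(2)]], assumption),
        (rule tY(6), assumption),
        (rule L2_time_derivative_cong[OF tX(6) L2H(8) L2H(12) L2H(16) sym[OF relX(4)]], assumption))
    interpret K: kv_trajectory L a b0 c0 \<alpha>1 \<alpha>2 \<alpha>3 \<alpha>4 M b c "\<lambda>t. pu (Y t)" "\<lambda>t. wderiv L (pu (Y t))" "\<lambda>t. pu (X t)" "\<lambda>t. wderiv L (pu (X t))" "\<lambda>t. pv (X t)" "\<lambda>t. wderiv L (pv (X t))" "\<lambda>t. pv (Z t)" "\<lambda>t. py (Y t)" "\<lambda>t. wderiv L (py (Y t))" "\<lambda>t. py (X t)" "\<lambda>t. wderiv L (py (X t))" "\<lambda>t. pz (X t)" "\<lambda>t. wderiv L (pz (X t))" "\<lambda>t. pz (Z t)"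
      by (rule K)
    have energy: "(N (Y t))\<^sup>2 = K.energy0 t" for t
    proof -
      have "N (Y t) = norm ((nrm L (pv (Y t)), sqrt a * nrm L (wderiv L (pu (Y t)))), (nrm L (pz (Y t)), nrm L (wderiv L (py (Y t)))))"
        using energy_norm_wderiv[OF L a HY[of t]] by (simp only: parts[symmetric] N_def)
      moreover have "nrm L (pv (Y t)) = nrm L (pu (X t))" by (rule nrm_cong_AE[OF relY(1) L2Z(3) L2H(5)])
      moreover have "nrm L (pz (Y t)) = nrm L (py (X t))" by (rule nrm_cong_AE[OF relY(3) L2Z(4) L2H(7)])
      ultimately show ?thesis using a by (simp add: norm_Pair power_mult_distrib nrm_power2 K.energy0_def)
    qed
    have dec: "K.energy0 t \<le> K.energy0 s" if "0 < s" "s \<le> t" for s t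
      unfolding energy[symmetric] using S.orbit_decreasing[of s t Y0] that AAH(3) S.N_nonneg by (intro power_mono) (auto simp: Y_def)
    have "(K.energy0 \<longlongrightarrow> 0) at_top"
      by (rule null_decreasing_tendsto_0[OF K.null_energy _ dec]) (simp_all add: energy[symmetric])
    then have "((\<lambda>t. sqrt (K.energy0 t)) \<longlongrightarrow> sqrt 0) at_top" by (rule tendsto_real_sqrt)
    then have "((\<lambda>t. N (Y t)) \<longlongrightarrow> 0) at_top" using S.N_nonneg by (simp add: energy[symmetric])
    then show ?thesis
      by (rule Lim_transform_eventually) (use eventually_ge_at_top[of 0] in \<open>eventually_elim, simp add: Y_def\<close>)
  qed
  show ?thesis
  proof
    fix U0 assume "U0 \<in> energy_space L"
    then have U0: "U0 \<in> H" by (simp add: H_def)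
    have "((\<lambda>t. N (T t U0)) \<longlongrightarrow> 0) at_top"
    proof (rule S.strongly_stable_if_dense[OF _ U0])
      fix U :: state and e :: real assume "U \<in> H" "e > 0"
      then have "\<exists>W\<in>D. A W \<in> D \<and> N (U - W) < e"
        unfolding H_def D_def A_def N_def b_def c_def by (rule domain_square_dense[OF L a])
      then show "\<exists>W\<in>H. N (U - W) < e \<and> ((\<lambda>t. N (T t W)) \<longlongrightarrow> 0) at_top" using stable S.D_H by blast
    qed
    then show "((\<lambda>t. energy_norm L a (T t U0)) \<longlongrightarrow> 0) at_top" by (simp add: N_def)
  qed
qed

end
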